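(* Suppose the inspection phase of an optimal trajectory for the Average-Case Disk-Inspection problem does not touch the unit disk. Then the inspection phase is given by the curve $\mathcal T^{\tau_0}$ restricted to $[0,\xi]$ for some inspection-feasible $\tau_0$, where $(\psi,\tau)$ solves $\mathrm{Sys}(\tau_0)$ and $\xi=\xi(\tau_0)>1/2$ is the deployment parameter of $\tau_0$; together with the deployment phase, namely the segment from $O$ to $\mathcal T^{\tau_0}(\xi)$, the optimal cost of the Average-Case Disk-Inspection problem equals the minimum, over all inspection-feasible $\tau_0\in\mathcal I$ (with $\xi=\xi(\tau_0)$), of $$\frac{1}{2\pi}\log\!\left(\frac{1+\sin(\xi\pi)}{1-\sin(\xi\pi)}\right)+\frac{\xi}{\cos((1-\xi)\pi)}+2\pi\int_0^{\xi}\frac{x\,\tau(x)}{\sin\psi(x)}\,dx,$$ where $\theta=(1-\xi)\pi$ is the corresponding deployment angle.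
   Context: Let $D$ be the closed unit disk centered at the origin $O$ of $\mathbb{R}^2$. A point $A$ inspects a point $P$ on the unit circle if $\|\lambda A+(1-\lambda)P\|\ge 1$ for all $\lambda\in[0,1]$. An inspective trajectory is a continuous, piecewise differentiable curve with one endpoint at $O$ whose convex hull contains $D$; traversed at unit speed from $O$, $I_P$ is the length travelled from $O$ until the first point that inspects $P$. The Average-Case Disk-Inspection problem asks for an inspective trajectory minimizing $\mathbb{E}_P[I_P]$ with $P$ uniform on the unit circle. An optimal trajectory starts with a deployment phase, a straight segment from $O$ to a point $(1,\tan\theta)$ on the line $x=1$ ($\theta$ is the deployment angle), followed by the rest of the trajectory, called the inspection phase. For $\tau_0\ge 0$, $\mathrm{Sys}(\tau_0)$ is the ODE system for $\psi,\tau:[0,1]\to\mathbb{R}$: $\psi'(x)=-2\pi+\frac{\cot\psi(x)}{x}$, $\psi(0)=\pi/2$; $\frac{1}{2\pi}\tau'(x)=\tau(x)\cot\psi(x)-1$, $\tau(0)=\tau_0$ (it has a unique solution on $[0,1]$). The associated curve is $\mathcal T^{\tau_0}(x)=(\cos(2\pi x)-\tau(x)\sin(2\pi x),\ -\sin(2\pi x)-\tau(x)\cos(2\pi x))$, $x\in[0,1]$. The value $\tau_0$ is inspection-feasible if $\|\mathcal T^{\tau_0}(x)\|>1$ for all $x\in[0,1]$ and there exists $\xi\in(0,1]$ with $\mathcal T^{\tau_0}_1(\xi)=1$ (first coordinate); $\mathcal I$ denotes the set of inspection-feasible values, and the deployment parameter $\xi(\tau_0)$ is the smallest $\xi>0$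 with $\mathcal T^{\tau_0}_1(\xi)=1$. *)

theory Defs
  imports "HOL-Analysis.Analysis"
begin

text \<open>The plane is the Euclidean space \<open>real \<times> real\<close>, the disk is \<open>cball 0 1\<close> and the
  unit circle is \<open>sphere 0 1\<close>.\<close>

type_synonym plane = "real \<times> real"

definition inspects :: "plane \<Rightarrow> plane \<Rightarrow> bool" where
  "inspects A P \<longleftrightarrow> (\<forall>l\<in>{0..1}. norm (l *\<^sub>R A + (1 - l) *\<^sub>R P) \<ge> 1)"

text \<open>Trajectories are given by their unit-speed parametrization on \<open>{0..L}\<close>, so that
  \<open>t\<close> is the length travelled from the origin to \<open>\<gamma> t\<close>.\<close>

definition inspective_trajectory :: "(real \<Rightarrow> plane) \<Rightarrow> real \<Rightarrow> bool" where
  "inspective_trajectory \<gamma> L \<longleftrightarrow>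
     0 \<le> L \<and> \<gamma> 0 = 0 \<and> \<gamma> piecewise_differentiable_on {0..L} \<and>
     (\<exists>S. finite S \<and>
        (\<forall>t\<in>{0..L} - S. norm (vector_derivative \<gamma> (at t within {0..L})) = 1)) \<and>
     cball 0 1 \<subseteq> convex hull (\<gamma> ` {0..L})"

definition inspection_time :: "(real \<Rightarrow> plane) \<Rightarrow> real \<Rightarrow> plane \<Rightarrow> real" where
  "inspection_time \<gamma> L P = Inf {t \<in> {0..L}. inspects (\<gamma> t) P}"

definition uniform_circle :: "plane measure" where
  "uniform_circle =
     distr (uniform_measure lborel {0..2*pi}) borel (\<lambda>\<phi>. (cos \<phi>, sin \<phi>))"

definition avg_cost :: "(real \<Rightarrow> plane) \<Rightarrow> real \<Rightarrow> real" where
  "avg_cost \<gamma> L = (\<integral>P. inspection_time \<gamma> L P \<partial>uniform_circle)"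

definition optimal_cost :: real where
  "optimal_cost = Inf {avg_cost \<gamma> L | \<gamma> L. inspective_trajectory \<gamma> L}"

definition optimal_trajectory :: "(real \<Rightarrow> plane) \<Rightarrow> real \<Rightarrow> bool" where
  "optimal_trajectory \<gamma> L \<longleftrightarrow>
     inspective_trajectory \<gamma> L \<and>
     (\<forall>\<gamma>' L'. inspective_trajectory \<gamma>' L' \<longrightarrow> avg_cost \<gamma> L \<le> avg_cost \<gamma>' L')"

text \<open>The deployment phase is the whole initial straight piece of the trajectory; it ends at
  \<open>(1, tan \<theta>)\<close>, which is at distance \<open>1 / cos \<theta>\<close> from the origin. Without the last
  conjunct every sufficiently long part of that piece would, after a rotation, be a deployment
  phase as well, and \<open>\<theta>\<close> would not be determined by the trajectory.\<close>

definition deployment_phase :: "(real \<Rightarrow> plane) \<Rightarrow> real \<Rightarrow> real \<Rightarrow> bool" where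
  "deployment_phase \<gamma> L \<theta> \<longleftrightarrow>
     0 \<le> \<theta> \<and> \<theta> < pi/2 \<and> 1 / cos \<theta> \<le> L \<and>
     (\<forall>t\<in>{0..1 / cos \<theta>}. \<gamma> t = t *\<^sub>R (cos \<theta>, sin \<theta>)) \<and>
     (\<forall>d\<in>{0..L}. (\<forall>t\<in>{0..d}. \<gamma> t = t *\<^sub>R (cos \<theta>, sin \<theta>)) \<longrightarrow> d \<le> 1 / cos \<theta>)"

text \<open>A trajectory may continue after all of the circle has been inspected. Such a tail does
  not influence the cost, hence it is arbitrary even for an optimal trajectory; the inspection
  phase ends when the inspection is complete.\<close>

definition completion_time :: "(real \<Rightarrow> plane) \<Rightarrow> real \<Rightarrow> real" where
  "completion_time \<gamma> L = Inf {t \<in> {0..L}. cball 0 1 \<subseteq> convex hull (\<gamma> ` {0..t})}"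

definition inspection_interval :: "(real \<Rightarrow> plane) \<Rightarrow> real \<Rightarrow> real \<Rightarrow> real set" where
  "inspection_interval \<gamma> L \<theta> = {1 / cos \<theta> .. completion_time \<gamma> L}"

text \<open>At \<open>x = 0\<close> the right-hand side of the equation for \<open>\<psi>\<close> is of the form \<open>0/0\<close>, so that
  equation is required on \<open>(0, 1]\<close>, together with continuity of \<open>\<psi>\<close> on \<open>[0, 1]\<close>.
  The condition \<open>sin (\<psi> x) \<noteq> 0\<close> says that \<open>cot (\<psi> x)\<close> is meaningful.\<close>

definition Sys :: "real \<Rightarrow> (real \<Rightarrow> real) \<Rightarrow> (real \<Rightarrow> real) \<Rightarrow> bool" where
  "Sys \<tau>0 \<psi> \<tau> \<longleftrightarrow>
     continuous_on {0..1} \<psi> \<and> \<psi> 0 = pi/2 \<and>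
     (\<forall>x\<in>{0..1}. sin (\<psi> x) \<noteq> 0) \<and>
     (\<forall>x\<in>{0<..1}. (\<psi> has_real_derivative - 2*pi + cot (\<psi> x) / x) (at x within {0..1})) \<and>
     \<tau> 0 = \<tau>0 \<and>
     (\<forall>x\<in>{0..1}. (\<tau> has_real_derivative 2*pi * (\<tau> x * cot (\<psi> x) - 1)) (at x within {0..1}))"

definition curve :: "(real \<Rightarrow> real) \<Rightarrow> real \<Rightarrow> plane" where
  "curve \<tau> x = (cos (2*pi*x) - \<tau> x * sin (2*pi*x), - sin (2*pi*x) - \<tau> x * cos (2*pi*x))"

definition inspection_feasible :: "real set" where
  "inspection_feasible =
     {\<tau>0. \<tau>0 \<ge> 0 \<and>
        (\<exists>\<psi> \<tau>. Sys \<tau>0 \<psi> \<tau> \<and> (\<forall>x\<in>{0..1}. norm (curve \<tau> x) > 1) \<and>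
               (\<exists>\<xi>\<in>{0<..1}. fst (curve \<tau> \<xi>) = 1))}"

definition deployment_param :: "(real \<Rightarrow> real) \<Rightarrow> real" where
  "deployment_param \<tau> = (LEAST \<xi>. 0 < \<xi> \<and> \<xi> \<le> 1 \<and> fst (curve \<tau> \<xi>) = 1)"

definition total_cost :: "real \<Rightarrow> (real \<Rightarrow> real) \<Rightarrow> (real \<Rightarrow> real) \<Rightarrow> real" where
  "total_cost \<xi> \<psi> \<tau> =
     1 / (2*pi) * ln ((1 + sin (\<xi>*pi)) / (1 - sin (\<xi>*pi)))
     + \<xi> / cos ((1 - \<xi>)*pi)
     + 2*pi * integral {0..\<xi>} (\<lambda>x. x * \<tau> x / sin (\<psi> x))"

end

theory Submission
  imports Defs
begin

text \<open>Let \<open>x\<close> be the fraction of the circle that is not yet inspected. The extremals of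
  \<open>\<integral> x |dA|\<close> form a field whose direction \<open>\<psi>\<close> does not depend on \<open>\<tau>\<close>, so the value function of
  the inspection phase is affine in the position: with \<open>W' = P / sin \<psi>\<close>, where \<open>P x\<close> is the point
  inspected at parameter \<open>x\<close>, one has \<open>|W x| = x\<close>, and the remaining cost at \<open>A\<close> is
  \<open>K x - A \<bullet> W x\<close>. This function calibrates the problem: along any trajectory outside the
  disk that inspects on one side, it decreases at most at rate \<open>x\<close>, and at rate \<open>x\<close> only if the
  trajectory follows the field.

  A trajectory may also alternate between the two ends of the inspected arc. The potential
  \<open>Phi\<close> uses the end on whose side of the symmetry axis the point is. It fails only at the tips,
  the common points of the two tangent lines, where going straight on is better than the field
  as long as the half-angle is below the minimizer of the total cost \<open>phase_cost\<close>; the term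
  \<open>surplus\<close> accounts for that. The resulting energy is monotone, and for an optimal trajectory
  constant, which leaves only the field line and its mirror image. The transversality condition
  at the minimizer, \<open>3 \<theta> = \<pi>/2 + \<psi>(\<xi>)\<close>, gives \<open>\<tau> > 0\<close> beyond \<open>\<xi>\<close> and the minimality of \<open>\<xi>\<close>.\<close>

section \<open>The direction field\<close>

text \<open>A point of the path counts with weight \<open>x\<close> because, by a layer-cake
  argument, the average cost is at least \<open>deployment_cost \<theta>\<close> plus the time
  integral of the uninspected fraction after the deployment. The obstacle is regularity. A
  competitor is merely 1-Lipschitz, and the ends of the inspected arc are running maxima, which need
  not be differentiable. The calibration is therefore applied as a one-sided Dini estimate: the
  change of the potential caused by the shrinking fraction is a product of two small increments,
  since every newly inspected point lies on a tangent touched within the same short time. At a tip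
  an outward step moves both ends of the arc at once, so a potential that follows one end is not
  enough. Tips are compared with each other directly, through the radius, which there determines the
  half-angle. For rigidity the same estimates are read backwards: constant energy keeps a step of
  length d within o(d) of the field direction. So the path turns out to be differentiable, and only
  this makes the differential equation for the tangent length available.\<close>

lemma last_below:
  fixes f :: "real \<Rightarrow> real"
  assumes cont: "continuous_on {a..b} f" and ab: "a \<le> b" and fa: "f a \<le> k" and fb: "k < f b"
  obtains x where "a \<le> x" "x < b" "f x \<le> k" "\<And>y. x < y \<Longrightarrow> y \<le> b \<Longrightarrow> k < f y"
proof -
  let ?S = "{y \<in> {a..b}. f y \<le> k}"
  have cl: "closed ?S"
    by (intro continuous_on_closed_Collect_le cont continuous_on_const closed_real_atLeastAtMost)
  have bdd: "bdd_above ?S" by (auto simp: bdd_above_def)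
  have ne: "?S \<noteq> {}" using ab fa by auto
  have x: "Sup ?S \<in> {a..b}" "f (Sup ?S) \<le> k"
    using closed_contains_Sup[OF ne bdd cl] by auto
  have above: "k < f y" if "Sup ?S < y" "y \<le> b" for y
    using cSup_upper[OF _ bdd, of y] that x by force
  have "Sup ?S \<noteq> b" using x fb by auto
  with x above that[of "Sup ?S"] show thesis by auto
qed

text \<open>The equation \<open>(x * c)' = x * f c\<close> is singular at 0. Integrating it and
  substituting \<open>y = s * x\<close> gives this fixed-point form, in which the singularity is
  gone. The map is a contraction for the supremum norm weighted by
  \<open>exp (- k * x)\<close>.\<close>

lemma averaging_fixpoint:
  fixes f :: "real \<Rightarrow> real"
  assumes lip: "\<And>a b. \<bar>f a - f b\<bar> \<le> \<Lambda> * \<bar>a - b\<bar>" and \<Lambda>: "\<Lambda> > 0" and bd: "\<And>a. \<bar>f a\<bar> \<le> B"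
  shows "\<exists>c. continuous_on {0..1} c \<and>
           (\<forall>x\<in>{0..1}. c x = x * integral {0..1} (\<lambda>s. s * f (c (s * x))))"
proof -
  \<comment> \<open>With this weight the contraction factor is at most
    \<open>\<Lambda> / k = 1/2\<close>.\<close>
  define k where "k = 2 * \<Lambda>"
  have k: "k > 0" using \<Lambda> by (simp add: k_def)
  have contf: "continuous_on UNIV f"
    by (rule lipschitz_on_continuous_on[of \<Lambda>]) (use lip \<Lambda> in \<open>auto simp: lipschitz_on_def dist_real_def\<close>)
  \<comment> \<open>Clamping the argument lets the operator act on bounded continuous functions on
    the whole line, a complete space that is available as a type.\<close>
  define cl where "cl y = max 0 (min 1 y)" for y :: real
  have cl: "0 \<le> cl y" "cl y \<le> 1" for y by (auto simp: cl_def)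
  define q where "q g x s = s * f (exp (k * s * x) * g (s * x))" for g :: "real \<Rightarrow> real" and x s
  define T where "T g y = cl y * exp (- k * cl y) * integral {0..1} (q g (cl y))" for g y
  have contq: "continuous_on UNIV (\<lambda>(x, s). q g x s)" if "continuous_on UNIV g" for g
    unfolding q_def split_def
    by (intro continuous_intros continuous_on_compose2[OF contf] continuous_on_compose2[OF that]) auto
  have intq: "q g x integrable_on {0..1}" if "continuous_on UNIV g" for g x
    unfolding q_def
    by (intro integrable_continuous_interval continuous_intros continuous_on_compose2[OF contf]
        continuous_on_compose2[OF that]) auto
  have contT: "continuous_on UNIV (T g)" if g: "continuous_on UNIV g" for g
  proof -
    have "continuous_on UNIV (\<lambda>x. integral (cbox 0 1) (q g x))"
      by (rule integral_continuous_on_param) (use contq[OF g] continuous_on_subset in auto)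
    then have "continuous_on UNIV (\<lambda>y. integral {0..1} (q g (cl y)))"
      unfolding cl_def by (auto intro!: continuous_on_compose2[of UNIV "\<lambda>x. integral {0..1} (q g x)"] continuous_intros)
    then show ?thesis
      unfolding T_def by (intro continuous_intros) (auto simp: cl_def intro!: continuous_intros)
  qed
  have bdq: "\<bar>integral {0..1} (q g x)\<bar> \<le> B" if "continuous_on UNIV g" for g x
  proof -
    have "norm (integral {0..1} (q g x)) \<le> B * (1 - 0)"
    proof (rule integral_bound)
      show "continuous_on {0..1} (q g x)"
        unfolding q_def
        by (intro continuous_intros continuous_on_compose2[OF contf] continuous_on_compose2[OF that]) auto
      fix s :: real assume "s \<in> {0..1}"
      then have "\<bar>s\<bar> * \<bar>f (exp (k * s * x) * g (s * x))\<bar> \<le> 1 * B"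
        by (intro mult_mono bd) auto
      then show "norm (q g x s) \<le> B" by (simp add: q_def abs_mult)
    qed simp
    then show ?thesis by simp
  qed
  have bddT: "\<bar>T g y\<bar> \<le> B" if "continuous_on UNIV g" for g y
  proof -
    have B: "B \<ge> 0" using bd[of 0] by linarith
    have "cl y * exp (- k * cl y) \<le> 1 * 1"
      using cl[of y] k by (intro mult_mono) auto
    then have "\<bar>cl y * exp (- k * cl y)\<bar> * \<bar>integral {0..1} (q g (cl y))\<bar> \<le> 1 * B"
      using cl[of y] by (intro mult_mono bdq that) auto
    then show ?thesis by (simp add: T_def abs_mult)
  qed
  have bc: "T g \<in> bcontfun" if "continuous_on UNIV g" for g
    unfolding bcontfun_def using contT[OF that] bddT[OF that]
    by (auto simp: bounded_iff)
  define TT where "TT g = Bcontfun (T (apply_bcontfun g))" for g :: "real \<Rightarrow>\<^sub>C real"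
  have ca: "continuous_on UNIV (apply_bcontfun g)" for g :: "real \<Rightarrow>\<^sub>C real"
    using apply_bcontfun[of g] by (simp add: bcontfun_def)
  have TT: "apply_bcontfun (TT g) = T (apply_bcontfun g)" for g
    unfolding TT_def by (rule Bcontfun_inverse) (rule bc[OF ca])
  have contr: "dist (TT g) (TT h) \<le> (1/2) * dist g h" for g h
  proof (rule dist_bound)
    fix y
    let ?x = "cl y" and ?d = "dist g h"
    \<comment> \<open>The factor \<open>?x\<close> in front of the average is kept inside, so that
      the antiderivative has \<open>k\<close> and not \<open>k * ?x\<close> in the denominator and
      \<open>?x = 0\<close> is no special case.\<close>
    have e: "((\<lambda>s. ?x * exp (k * ?x * (s - 1))) has_integral (exp (k * ?x * (1 - 1)) / k - exp (k * ?x * (0 - 1)) / k)) {0..1}"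
    proof (rule fundamental_theorem_of_calculus)
      fix s :: real
      show "((\<lambda>s. exp (k * ?x * (s - 1)) / k) has_vector_derivative ?x * exp (k * ?x * (s - 1))) (at s within {0..1})"
        using k by (auto simp flip: has_real_derivative_iff_has_vector_derivative intro!: derivative_eq_intros)
    qed simp
    have "\<bar>integral {0..1} (\<lambda>s. q (apply_bcontfun g) ?x s - q (apply_bcontfun h) ?x s)\<bar> * (?x * exp (- k * ?x))
        = norm (integral {0..1} (\<lambda>s. (?x * exp (- k * ?x)) * (q (apply_bcontfun g) ?x s - q (apply_bcontfun h) ?x s)))"
      using cl[of y] by (simp add: abs_mult)
    also have "\<dots> \<le> integral {0..1} (\<lambda>s. \<Lambda> * ?d * (?x * exp (k * ?x * (s - 1))))"
    proof (rule integral_norm_bound_integral)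
      fix s :: real assume s: "s \<in> {0..1}"
      let ?a = "exp (k * s * ?x) * apply_bcontfun g (s * ?x)" and ?b = "exp (k * s * ?x) * apply_bcontfun h (s * ?x)"
      have "\<bar>f ?a - f ?b\<bar> \<le> \<Lambda> * \<bar>?a - ?b\<bar>" by (rule lip)
      also have "\<bar>?a - ?b\<bar> = exp (k * s * ?x) * dist (apply_bcontfun g (s * ?x)) (apply_bcontfun h (s * ?x))"
        by (simp add: dist_real_def abs_mult flip: right_diff_distrib)
      also have "\<dots> \<le> exp (k * s * ?x) * ?d"
        by (intro mult_left_mono dist_bounded) auto
      finally have 1: "\<bar>f ?a - f ?b\<bar> \<le> \<Lambda> * (exp (k * s * ?x) * ?d)" using \<Lambda> by (simp add: mult_left_mono)
      have "s * \<bar>f ?a - f ?b\<bar> \<le> 1 * (\<Lambda> * (exp (k * s * ?x) * ?d))"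
        using s by (intro mult_mono 1) auto
      then have "(?x * exp (- k * ?x)) * (s * \<bar>f ?a - f ?b\<bar>) \<le> (?x * exp (- k * ?x)) * (\<Lambda> * (exp (k * s * ?x) * ?d))"
        using cl[of y] by (intro mult_left_mono) auto
      also have "\<dots> = \<Lambda> * ?d * (?x * (exp (- k * ?x) * exp (k * s * ?x)))" by (simp add: algebra_simps)
      also have "exp (- k * ?x) * exp (k * s * ?x) = exp (k * ?x * (s - 1))"
        by (simp add: algebra_simps flip: exp_add)
      finally show "norm ((?x * exp (- k * ?x)) * (q (apply_bcontfun g) ?x s - q (apply_bcontfun h) ?x s)) \<le> \<Lambda> * ?d * (?x * exp (k * ?x * (s - 1)))"
        using s cl[of y] by (simp add: q_def abs_mult flip: right_diff_distrib)
    next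
      show "(\<lambda>s. (?x * exp (- k * ?x)) * (q (apply_bcontfun g) ?x s - q (apply_bcontfun h) ?x s)) integrable_on {0..1}"
        by (intro integrable_on_mult_right integrable_diff intq ca)
      show "(\<lambda>s. \<Lambda> * ?d * (?x * exp (k * ?x * (s - 1)))) integrable_on {0..1}"
        using has_integral_integrable[OF e] by (rule integrable_on_mult_right)
    qed
    also have "\<dots> = \<Lambda> * ?d * ((1 - exp (- k * ?x)) / k)"
      using integral_unique[OF e] by (simp add: diff_divide_distrib)
    also have "\<dots> \<le> \<Lambda> * ?d * (1 / k)"
      using \<Lambda> k by (intro mult_left_mono divide_right_mono) auto
    also have "\<dots> = 1/2 * ?d" using \<Lambda> by (simp add: k_def)
    finally have *: "\<bar>integral {0..1} (\<lambda>s. q (apply_bcontfun g) ?x s - q (apply_bcontfun h) ?x s)\<bar> * (?x * exp (- k * ?x)) \<le> 1/2 * ?d" .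
    have "\<bar>T (apply_bcontfun g) y - T (apply_bcontfun h) y\<bar>
        = \<bar>integral {0..1} (\<lambda>s. q (apply_bcontfun g) ?x s - q (apply_bcontfun h) ?x s)\<bar> * (?x * exp (- k * ?x))"
      using cl[of y] by (simp add: T_def integral_diff intq ca abs_mult flip: right_diff_distrib)
    with * show "dist (apply_bcontfun (TT g) y) (apply_bcontfun (TT h) y) \<le> 1/2 * ?d"
      by (simp add: TT dist_real_def)
  qed
  obtain g where g: "TT g = g"
    using banach_fix_type[of "1/2" TT] contr by auto
  then have gT: "T (apply_bcontfun g) y = apply_bcontfun g y" for y using TT by metis
  define c where "c x = exp (k * x) * apply_bcontfun g x" for x
  show ?thesis
  proof (intro exI[of _ c] conjI ballI)
    show "continuous_on {0..1} c"
      unfolding c_def by (intro continuous_intros continuous_on_subset[OF ca]) auto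
    fix x :: real assume "x \<in> {0..1}"
    then have clx: "cl x = x" by (auto simp: cl_def)
    have "c x = exp (k * x) * T (apply_bcontfun g) x" by (simp add: c_def gT)
    also have "\<dots> = exp (k * x) * exp (- k * x) * (x * integral {0..1} (q (apply_bcontfun g) x))"
      by (simp add: T_def clx)
    also have "exp (k * x) * exp (- k * x) = 1" by (simp flip: exp_add)
    finally show "c x = x * integral {0..1} (\<lambda>s. s * f (c (s * x)))"
      by (simp add: q_def[abs_def] c_def mult.assoc)
  qed
qed

text \<open>Away from 0 the substitution can be undone, and the fixed-point form becomes a primitive
  divided by its argument, to which the quotient rule applies.\<close>

lemma averaging_fixpoint_derivative:
  fixes f c :: "real \<Rightarrow> real"
  assumes contc: "continuous_on {0..1} c" and contf: "continuous_on UNIV f"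
    and fp: "\<And>x. x \<in> {0..1} \<Longrightarrow> c x = x * integral {0..1} (\<lambda>s. s * f (c (s * x)))"
    and x: "x \<in> {0<..1}"
  shows "(c has_real_derivative f (c x) - c x / x) (at x within {0..1})"
proof -
  have cont: "continuous_on {0..1} (\<lambda>y. y * f (c y))"
    by (intro continuous_intros continuous_on_compose2[OF contf] contc) auto
  have eq: "c y = integral {0..y} (\<lambda>y. y * f (c y)) / y" if y: "y \<in> {0<..1}" for y
  proof -
    have "((\<lambda>y. y * f (c y)) has_integral integral {0..y} (\<lambda>y. y * f (c y))) {0..y}"
      using continuous_on_subset[OF cont, of "{0..y}"] y
      by (auto intro!: integrable_integral integrable_continuous_interval)
    from has_integral_stretch_real[OF this, of y]
    have "((\<lambda>x. (y * x) * f (c (y * x))) has_integral (1 / y) * integral {0..y} (\<lambda>y. y * f (c y))) ((\<lambda>x. x / y) ` {0..y})"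
      using y by simp
    moreover have "(\<lambda>x. x / y) ` {0..y} = {0..1}"
    proof (intro equalityI subsetI)
      fix z :: real assume "z \<in> {0..1}"
      then have "z * y \<in> {0..y}" using y by (auto intro: mult_left_le_one_le)
      moreover have "z = z * y / y" using y by simp
      ultimately show "z \<in> (\<lambda>x. x / y) ` {0..y}" by blast
    qed (use y in auto)
    ultimately have "integral {0..1} (\<lambda>x. y * (x * f (c (x * y)))) = (1 / y) * integral {0..y} (\<lambda>y. y * f (c y))"
      by (simp add: integral_unique mult_ac)
    with fp[of y] y show ?thesis by simp
  qed
  have "((\<lambda>y. integral {0..y} (\<lambda>y. y * f (c y))) has_real_derivative x * f (c x)) (at x within {0..1})"
    by (rule integral_has_real_derivative[OF cont]) (use x in auto)
  then have "((\<lambda>y. integral {0..y} (\<lambda>y. y * f (c y)) / y) has_real_derivative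
      (x * f (c x) * x - integral {0..x} (\<lambda>y. y * f (c y)) * 1) / (x * x)) (at x within {0..1})"
    using x by (auto intro!: derivative_eq_intros)
  also have "(x * f (c x) * x - integral {0..x} (\<lambda>y. y * f (c y)) * 1) / (x * x) = f (c x) - c x / x"
    using x eq[OF x] by (simp add: field_simps)
  finally show ?thesis
    using x eq
    by (elim has_field_derivative_transform_within[of _ _ _ _ x]) (auto simp: dist_real_def)
qed

text \<open>With \<open>c = cos \<psi>\<close> the singular equation for \<open>\<psi>\<close> reads \<open>(x c)' = 2 \<pi> x sqrt (1 - c\<^sup>2)\<close>.
  The root is replaced by a Lipschitz function that agrees with it below the equilibrium
  value \<open>2 \<pi> / sqrt (1 + 4 \<pi>\<^sup>2)\<close>, which the solution cannot exceed.\<close>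

lemma direction_angle_exists:
  "\<exists>\<psi>. continuous_on {0..1} \<psi> \<and> \<psi> 0 = pi/2 \<and> (\<forall>x\<in>{0..1}. 0 < \<psi> x \<and> \<psi> x \<le> pi/2) \<and>
     (\<forall>x\<in>{0<..1}. (\<psi> has_real_derivative - 2*pi + cot (\<psi> x) / x) (at x within {0..1}))"
proof -
  define m where "m = 2*pi / sqrt (1 + 4*pi^2)"
  \<comment> \<open>\<open>l\<close> is \<open>sqrt (1 - m^2)\<close>, a lower bound for the
    truncated root. Dividing by it turns the estimate for the squares into a Lipschitz bound for the
    roots, with constant \<open>m / l = 2 * pi\<close>.\<close>
  define l where "l = 1 / sqrt (1 + 4*pi^2)"
  have pos: "1 + 4*pi^2 > 0" by (simp add: add_pos_nonneg)
  have m0: "m > 0" and l0: "l > 0" using pos by (auto simp: m_def l_def)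
  have ml: "m = 2 * pi * l" by (simp add: m_def l_def)
  have ml2: "m^2 + l^2 = 1"
    using pos by (simp add: m_def l_def power_divide power_mult_distrib flip: add_divide_distrib)
  have m1: "m < 1" 
  proof -
    have "m^2 < 1" using ml2 zero_less_power[OF l0, of 2] by linarith
    then show ?thesis by (intro power2_less_imp_less[of m 1]) auto
  qed
  define cp where "cp v = max 0 (min v m)" for v :: real
  have cp: "0 \<le> cp v" "cp v \<le> m" for v using m0 by (auto simp: cp_def)
  define f where "f v = 2*pi * sqrt (1 - (cp v)^2)" for v
  have cp2: "(cp v)^2 \<le> m^2" for v using cp[of v] by (simp add: power_mono)
  have root: "sqrt (1 - (cp v)^2) \<ge> l" for v
  proof -
    have "l^2 \<le> 1 - (cp v)^2" using cp2[of v] ml2 by linarith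
    then show ?thesis using l0 real_le_rsqrt by blast
  qed
  have liproot: "\<bar>sqrt (1 - (cp a)^2) - sqrt (1 - (cp b)^2)\<bar> \<le> 2*pi * \<bar>a - b\<bar>" for a b
  proof -
    let ?A = "sqrt (1 - (cp a)^2)" and ?B = "sqrt (1 - (cp b)^2)"
    have "m\<^sup>2 \<le> 1" using ml2 by (smt (verit) zero_le_power2)
    then have "?A^2 = 1 - (cp a)^2" "?B^2 = 1 - (cp b)^2" using cp2[of a] cp2[of b] by auto
    then have "(?A - ?B) * (?A + ?B) = (cp b - cp a) * (cp b + cp a)"
      by (simp add: algebra_simps power2_eq_square)
    then have "\<bar>?A - ?B\<bar> * \<bar>?A + ?B\<bar> = \<bar>cp b - cp a\<bar> * \<bar>cp b + cp a\<bar>"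
      by (simp flip: abs_mult)
    then have "\<bar>?A - ?B\<bar> * (?A + ?B) = \<bar>cp a - cp b\<bar> * (cp b + cp a)"
      using cp[of a] cp[of b] root[of a] root[of b] l0 by (simp add: abs_minus_commute)
    moreover have "\<bar>?A - ?B\<bar> * (2 * l) \<le> \<bar>?A - ?B\<bar> * (?A + ?B)"
      using root[of a] root[of b] by (intro mult_left_mono) auto
    moreover have "\<bar>cp a - cp b\<bar> * (cp b + cp a) \<le> \<bar>a - b\<bar> * (2 * m)"
      using cp[of a] cp[of b] by (intro mult_mono) (auto simp: cp_def)
    ultimately have "(2 * l) * \<bar>?A - ?B\<bar> \<le> (2 * l) * (2 * pi * \<bar>a - b\<bar>)"
      by (simp add: ml algebra_simps)
    then show ?thesis using l0 by simp
  qed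
  have lip: "\<bar>f a - f b\<bar> \<le> (4*pi^2) * \<bar>a - b\<bar>" for a b
  proof -
    have "\<bar>f a - f b\<bar> = 2*pi * \<bar>sqrt (1 - (cp a)^2) - sqrt (1 - (cp b)^2)\<bar>"
      by (simp add: f_def abs_mult flip: right_diff_distrib)
    also have "\<dots> \<le> 2*pi * (2*pi * \<bar>a - b\<bar>)"
      by (intro mult_left_mono liproot) auto
    finally show ?thesis by (simp add: power2_eq_square mult.assoc)
  qed
  have bd: "\<bar>f a\<bar> \<le> 2*pi" for a
  proof -
    have "2*pi * sqrt (1 - (cp a)^2) \<le> 2*pi * 1" by (intro mult_left_mono) auto
    moreover have "0 \<le> 2*pi * sqrt (1 - (cp a)^2)" 
      using order_trans[OF less_imp_le[OF l0] root[of a]] by (intro mult_nonneg_nonneg) auto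
    ultimately show ?thesis unfolding f_def by linarith
  qed
  have contf: "continuous_on UNIV f"
    unfolding f_def cp_def by (intro continuous_intros)
  obtain c where contc: "continuous_on {0..1} c"
    and fp: "\<And>x. x \<in> {0..1} \<Longrightarrow> c x = x * integral {0..1} (\<lambda>s. s * f (c (s * x)))"
    using averaging_fixpoint[of f "4*pi^2" "2*pi", OF lip _ bd] by auto
  have dc: "(c has_real_derivative f (c x) - c x / x) (at x within {0..1})" if "x \<in> {0<..1}" for x
    using averaging_fixpoint_derivative[OF contc contf fp that] .
  have c0: "c 0 = 0" using fp[of 0] by simp
  have cnn: "c x \<ge> 0" if "x \<in> {0..1}" for x
    unfolding fp[OF that] using that
    by (intro mult_nonneg_nonneg Henstock_Kurzweil_Integration.integral_nonneg integrable_continuous_interval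
        continuous_intros continuous_on_compose2[OF contf] continuous_on_compose2[OF contc])
      (auto simp: f_def mult_le_one intro!: mult_nonneg_nonneg order_trans[OF _ root] less_imp_le[OF l0])
  \<comment> \<open>Above \<open>m\<close> the truncated right-hand side is
    \<open>m - c z / z\<close>, negative because \<open>z < 1\<close>. So \<open>c\<close> cannot
    have grown after the last time at which it was at most \<open>m\<close>.\<close>
  have cm: "c x \<le> m" if x: "x \<in> {0..1}" for x
  proof (rule ccontr)
    assume "\<not> c x \<le> m"
    then have cx: "c x > m" by simp
    obtain x0 where x0: "0 \<le> x0" "x0 < x" "c x0 \<le> m" and above: "\<And>y. x0 < y \<Longrightarrow> y \<le> x \<Longrightarrow> m < c y"
      using last_below[of 0 x c m] continuous_on_subset[OF contc, of "{0..x}"] x cx c0 m0 by auto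
    obtain z where z: "x0 < z" "z < x" and eq: "c x - c x0 = (x - x0) * (f (c z) - c z / z)"
    proof (rule mvt[OF x0(2), of c "\<lambda>z h. (f (c z) - c z / z) * h"])
      show "continuous_on {x0..x} c" using x x0 by (intro continuous_on_subset[OF contc]) auto
      fix z assume z: "x0 < z" "z < x"
      then have "(c has_real_derivative f (c z) - c z / z) (at z within {0..1})" using x x0 by (intro dc) auto
      moreover have "at z within {0..1} = at z" using z x x0 by (intro at_within_interior) auto
      ultimately show "(c has_derivative (\<lambda>h. (f (c z) - c z / z) * h)) (at z)"
        by (simp add: has_field_derivative_def)
    qed (auto simp: mult.commute)
    have cz: "c z > m" using above z by simp
    then have "cp (c z) = m" using m0 by (auto simp: cp_def)
    moreover have "1 - m^2 = l^2" using ml2 by simp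
    ultimately have "f (c z) = 2 * pi * sqrt (l^2)" by (simp only: f_def)
    then have "f (c z) = m" using l0 ml by simp
    moreover have "c z / z \<ge> c z" using z x x0 cz m0 by (simp add: field_simps)
    ultimately have "f (c z) - c z / z < 0" using cz by simp
    then have "c x - c x0 < 0" unfolding eq using x0 by (simp add: mult_pos_neg)
    then show False using cx x0 by simp
  qed
  have ceq: "f (c x) = 2 * pi * sqrt (1 - (c x)^2)" if "x \<in> {0..1}" for x
    using cnn[OF that] cm[OF that] by (simp add: f_def cp_def)
  show ?thesis
  proof (intro exI[of _ "\<lambda>x. arccos (c x)"] conjI ballI)
    have rng: "-1 \<le> c x \<and> c x \<le> 1" if "x \<in> {0..1}" for x using cnn[OF that] cm[OF that] m1 by auto
    show "continuous_on {0..1} (\<lambda>x. arccos (c x))"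
      by (intro continuous_on_arccos contc ballI rng)
    show "arccos (c 0) = pi/2" by (simp add: c0)
    fix x :: real
    assume x: "x \<in> {0..1}"
    show "0 < arccos (c x)" using cnn[OF x] cm[OF x] m1 by (intro arccos_lt_bounded[THEN conjunct1] | simp)+
    show "arccos (c x) \<le> pi/2" using cnn[OF x] cm[OF x] m1 by (intro arccos_le_pi2) auto
  next
    fix x :: real
    assume x: "x \<in> {0<..1}"
    then have x': "x \<in> {0..1}" by auto
    have r: "-1 < c x" "c x < 1" using cnn[OF x'] cm[OF x'] m1 by auto
    define S where "S = sqrt (1 - (c x)^2)"
    have S: "S > 0" using r by (simp add: S_def abs_square_less_1 abs_less_iff)
    have "((\<lambda>x. arccos (c x)) has_real_derivative (f (c x) - c x / x) * inverse (- S)) (at x within {0..1})"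
      unfolding S_def using DERIV_chain2[OF DERIV_arccos[OF r] dc[OF x]] by (simp add: mult.commute)
    moreover have "(f (c x) - c x / x) * inverse (- S) = - 2 * pi + cot (arccos (c x)) / x"
      using S x r by (simp add: cot_def sin_arccos S_def[symmetric] ceq[OF x'] field_simps)
    ultimately show "((\<lambda>x. arccos (c x)) has_real_derivative - 2 * pi + cot (arccos (c x)) / x) (at x within {0..1})"
      by simp
  qed
qed

section \<open>Properties of the direction angle\<close>

definition unit_vec :: "real \<Rightarrow> plane" where
  "unit_vec \<phi> = (cos \<phi>, sin \<phi>)"

lemma norm_unit_vec [simp]: "norm (unit_vec \<phi>) = 1"
  by (simp add: unit_vec_def norm_Pair)

lemma inner_unit_vec: "unit_vec \<alpha> \<bullet> unit_vec \<beta> = cos (\<alpha> - \<beta>)"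
  by (simp add: unit_vec_def cos_diff)

lemma unit_vec_periodic [simp]:
  "unit_vec (\<phi> + 2 * pi) = unit_vec \<phi>" "unit_vec (\<phi> - 2 * pi) = unit_vec \<phi>"
  by (simp_all add: unit_vec_def cos_diff sin_diff)

lemma continuous_on_unit_vec [continuous_intros]:
  fixes f :: "real \<Rightarrow> real"
  shows "continuous_on S f \<Longrightarrow> continuous_on S (\<lambda>x. unit_vec (f x))"
  unfolding unit_vec_def by (intro continuous_intros)

lemma cos_le_cos_outside:
  assumes "0 \<le> \<beta>" "\<beta> \<le> x" "x \<le> 2 * pi - \<beta>"
  shows "cos x \<le> cos \<beta>"
proof (cases "x \<le> pi")
  case True
  then show ?thesis using assms by (intro cos_monotone_0_pi_le) auto
next
  case False
  have "cos (2 * pi - x) \<le> cos \<beta>" using assms False by (intro cos_monotone_0_pi_le) auto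
  then show ?thesis by simp
qed

text \<open>\<open>Sys\<close> only asks for \<open>sin (\<psi> x) \<noteq> 0\<close>; the range of
  \<psi> comes from the existence statement. Results carry over to every solution of
  \<open>Sys\<close> because the equation for \<tau> sees only \<open>cot (\<psi> x)\<close>, and
  that is unique by \<open>Sys_cot_unique\<close>.\<close>

locale steering_angle =
  fixes \<psi> :: "real \<Rightarrow> real"
  assumes cont_\<psi>: "continuous_on {0..1} \<psi>"
    and \<psi>_0: "\<psi> 0 = pi/2"
    and \<psi>_bounds: "\<And>x. x \<in> {0..1} \<Longrightarrow> 0 < \<psi> x \<and> \<psi> x \<le> pi/2"
    and deriv_\<psi>: "\<And>x. x \<in> {0<..1} \<Longrightarrow>
      (\<psi> has_real_derivative - 2*pi + cot (\<psi> x) / x) (at x within {0..1})"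
begin

lemma sin_\<psi>: "x \<in> {0..1} \<Longrightarrow> 0 < sin (\<psi> x)"
  using \<psi>_bounds[of x] by (intro sin_gt_zero) auto

lemma cos_\<psi>: "x \<in> {0..1} \<Longrightarrow> 0 \<le> cos (\<psi> x)"
  using \<psi>_bounds[of x] by (intro cos_ge_zero) auto

lemma cot_\<psi>: "x \<in> {0..1} \<Longrightarrow> 0 \<le> cot (\<psi> x)"
  using sin_\<psi>[of x] cos_\<psi>[of x] by (simp add: cot_def)

lemma deriv_\<psi>_at:
  assumes "0 < x" "x < 1"
  shows "(\<psi> has_real_derivative - 2*pi + cot (\<psi> x) / x) (at x)"
proof -
  have "at x within {0..1} = at x" using assms by (intro at_within_interior) auto
  then show ?thesis using deriv_\<psi>[of x] assms by auto
qed

lemma cont_cot: "continuous_on {0..1} (\<lambda>x. cot (\<psi> x))"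
  unfolding cot_def using sin_\<psi> by (intro continuous_intros cont_\<psi>) force

lemma cot_mono_rev:
  assumes "0 < b" "b \<le> a" "a \<le> pi/2"
  shows "cot a \<le> cot b"
proof -
  have "sin a > 0" "sin b > 0" using assms by (auto intro!: sin_gt_zero)
  moreover have "sin (a - b) \<ge> 0" using assms by (intro sin_ge_zero) auto
  ultimately show ?thesis by (simp add: cot_def sin_diff field_simps)
qed

text \<open>A barrier argument: where \<open>cot (\<psi> y) > 2 * pi * y\<close>, the equation makes
  \<psi> increase, so \<open>cot (\<psi> y)\<close> falls while \<open>2 * pi * y\<close> rises, and
  the excess cannot have built up. The bound says that the right-hand side of the equation for
  \<psi> is nonpositive, which gives \<open>\<psi>_antimono\<close>.\<close>

lemma cot_\<psi>_le:
  assumes x: "x \<in> {0..1}"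
  shows "cot (\<psi> x) \<le> 2 * pi * x"
proof (rule ccontr)
  assume "\<not> cot (\<psi> x) \<le> 2 * pi * x"
  then have gt: "cot (\<psi> x) - 2 * pi * x > 0" by simp
  have "cot (\<psi> 0) = 0" by (simp add: \<psi>_0 cot_def)
  note cot0 = this
  obtain x0 where x0: "0 \<le> x0" "x0 < x" "cot (\<psi> x0) - 2 * pi * x0 \<le> 0"
    and above: "\<And>y. x0 < y \<Longrightarrow> y \<le> x \<Longrightarrow> 0 < cot (\<psi> y) - 2 * pi * y"
  proof (rule last_below[of 0 x "\<lambda>y. cot (\<psi> y) - 2 * pi * y" 0])
    show "continuous_on {0..x} (\<lambda>y. cot (\<psi> y) - 2 * pi * y)"
      by (intro continuous_intros continuous_on_subset[OF cont_cot]) (use x in auto)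
  qed (use x gt cot0 in auto)
  have "\<psi> x0 < \<psi> x"
  proof (rule DERIV_pos_imp_increasing_open[OF x0(2)])
    fix y assume y: "x0 < y" "y < x"
    then have "2 * pi < cot (\<psi> y) / y" using above[of y] x0 by (simp add: field_simps)
    then show "\<exists>z. (\<psi> has_real_derivative z) (at y) \<and> 0 < z"
      using deriv_\<psi>_at[of y] y x x0 by (intro exI[of _ "- 2*pi + cot (\<psi> y) / y"]) auto
  qed (use x x0 in \<open>auto intro: continuous_on_subset[OF cont_\<psi>]\<close>)
  then have "cot (\<psi> x) \<le> cot (\<psi> x0)"
    using \<psi>_bounds[of x0] \<psi>_bounds[of x] x x0 by (intro cot_mono_rev) auto
  moreover have "2 * pi * x0 < 2 * pi * x" using x0 by simp
  ultimately show False using x0 gt by linarith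
qed

lemma \<psi>_antimono:
  assumes "0 \<le> x" "x \<le> y" "y \<le> 1"
  shows "\<psi> y \<le> \<psi> x"
proof (cases "x = y")
  case False
  with assms have xy: "x < y" by simp
  show ?thesis
  proof (rule DERIV_nonpos_imp_decreasing_open[OF assms(2)])
    fix z assume z: "x < z" "z < y"
    then have "cot (\<psi> z) / z \<le> 2 * pi" using cot_\<psi>_le[of z] assms by (simp add: field_simps)
    then show "\<exists>d. (\<psi> has_real_derivative d) (at z) \<and> d \<le> 0"
      using deriv_\<psi>_at[of z] z assms by (intro exI[of _ "- 2*pi + cot (\<psi> z) / z"]) auto
  qed (use assms in \<open>auto intro: continuous_on_subset[OF cont_\<psi>]\<close>)
qed simp

text \<open>From \<open>cot \<psi> \<le> 2 * pi\<close> and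
  \<open>1 \<le> sin \<psi> + cos \<psi>\<close>. This uniform bound is the origin of the constant
  \<open>1 + 2 * pi\<close> in the error term of \<open>Phi_plus_step\<close>.\<close>

lemma csc_\<psi>_le:
  assumes x: "x \<in> {0..1}"
  shows "1 / sin (\<psi> x) \<le> 1 + 2 * pi"
proof -
  let ?s = "sin (\<psi> x)" and ?c = "cos (\<psi> x)"
  have s: "?s > 0" by (rule sin_\<psi>[OF x])
  have "2 * pi * x \<le> 2 * pi * 1" using x by (intro mult_left_mono) auto
  then have "cot (\<psi> x) \<le> 2 * pi" using cot_\<psi>_le[OF x] by linarith
  then have c: "?c \<le> 2 * pi * ?s" using s by (simp add: cot_def field_simps)
  have "0 \<le> 2 * (?s * ?c)" using s cos_\<psi>[OF x] by simp
  then have "1^2 \<le> (?s + ?c)^2"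
    using sin_cos_squared_add[of "\<psi> x"] by (simp only: power2_eq_square distrib_left distrib_right) simp
  then have "1 \<le> ?s + ?c" by (rule power2_le_imp_le) (use s cos_\<psi>[OF x] in simp)
  then have "1 \<le> (1 + 2 * pi) * ?s" using c by (simp add: algebra_simps)
  then show ?thesis using s by (simp add: field_simps)
qed

text \<open>Multiplication by \<open>x\<close> removes the singular term: the two occurrences of
  \<open>cos (\<psi> x)\<close> in the derivative cancel.\<close>

lemma deriv_x_cos:
  assumes "x \<in> {0<..1}"
  shows "((\<lambda>x. x * cos (\<psi> x)) has_real_derivative 2 * pi * x * sin (\<psi> x)) (at x within {0..1})"
proof -
  have s: "sin (\<psi> x) > 0" using assms by (intro sin_\<psi>) auto
  show ?thesis
    by (rule derivative_eq_intros refl deriv_\<psi>[OF assms])+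
      (use s assms in \<open>simp add: cot_def field_simps\<close>)
qed

lemma deriv_x_sin:
  assumes "x \<in> {0<..1}"
  shows "((\<lambda>x. x * sin (\<psi> x)) has_real_derivative 1 / sin (\<psi> x) - 2 * pi * (x * cos (\<psi> x))) (at x within {0..1})"
proof -
  have s: "sin (\<psi> x) > 0" using assms by (intro sin_\<psi>) auto
  have "sin (\<psi> x) * sin (\<psi> x) + cos (\<psi> x) * cos (\<psi> x) = 1"
    using sin_cos_squared_add[of "\<psi> x"] by (simp add: power2_eq_square)
  then have cc: "cos (\<psi> x) * cos (\<psi> x) = 1 - sin (\<psi> x) * sin (\<psi> x)" by simp
  have "cos (\<psi> x) * (- 2 * pi + cot (\<psi> x) / x) * x = cos (\<psi> x) * cos (\<psi> x) / sin (\<psi> x) - 2 * pi * (x * cos (\<psi> x))"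
    using s assms by (simp add: cot_def field_simps)
  also have "\<dots> = 1 / sin (\<psi> x) - sin (\<psi> x) - 2 * pi * (x * cos (\<psi> x))"
    unfolding cc using s by (simp add: diff_divide_distrib)
  finally have *: "sin (\<psi> x) + x * (cos (\<psi> x) * (- 2 * pi + cot (\<psi> x) / x)) = 1 / sin (\<psi> x) - 2 * pi * (x * cos (\<psi> x))"
    by (simp add: mult_ac)
  show ?thesis
    by (rule derivative_eq_intros refl deriv_\<psi>[OF assms])+ (use * in \<open>simp add: mult_ac\<close>)
qed

text \<open>If \<psi> exceeded pi/4 at \<open>x\<close>, it would by monotonicity do so on all of
  [0, x], and \<open>x * cos (\<psi> x)\<close> would grow at rate at least
  \<open>sqrt 2 * pi * x\<close>. This gives \<open>cos (\<psi> x) \<ge> pi * x / sqrt 2\<close>,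
  which is more than 1 from \<open>x = 1/2\<close> on.\<close>

lemma \<psi>_le_pi4:
  assumes x: "1/2 \<le> x" "x \<le> 1"
  shows "\<psi> x \<le> pi/4"
proof (rule ccontr)
  assume "\<not> \<psi> x \<le> pi/4"
  then have gt: "\<psi> x > pi/4" by simp
  let ?f = "\<lambda>y. y * cos (\<psi> y) - pi / sqrt 2 * y^2"
  have "?f 0 \<le> ?f x"
  proof (rule DERIV_nonneg_imp_increasing_open[of 0 x ?f])
    show "continuous_on {0..x} ?f"
      using x by (intro continuous_intros continuous_on_subset[OF cont_\<psi>]) auto
    fix y assume y: "0 < y" "y < x"
    then have "\<psi> y > pi/4" using \<psi>_antimono[of y x] gt x by auto
    then have "sin (pi/4) \<le> sin (\<psi> y)"
      using \<psi>_bounds[of y] y x by (intro sin_monotone_2pi_le) auto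
    moreover have "1 / sqrt 2 = sqrt 2 / 2" by (simp add: real_div_sqrt field_simps)
    ultimately have "1 / sqrt 2 \<le> sin (\<psi> y)" by (simp add: sin_45)
    then have le: "2 * pi * y * (1 / sqrt 2) \<le> 2 * pi * y * sin (\<psi> y)"
      using y by (intro mult_left_mono) auto
    have "at y within {0..1} = at y" using y x by (intro at_within_interior) auto
    then have "((\<lambda>x. x * cos (\<psi> x)) has_real_derivative 2 * pi * y * sin (\<psi> y)) (at y)"
      using deriv_x_cos[of y] y x by auto
    moreover have "((\<lambda>y. pi / sqrt 2 * y^2) has_real_derivative 2 * pi * y * (1 / sqrt 2)) (at y)"
    proof -
      have "((\<lambda>y. y^2) has_real_derivative 2 * y) (at y)" by (auto intro!: derivative_eq_intros)
      from DERIV_cmult[OF this, of "pi / sqrt 2"] show ?thesis by (simp add: mult_ac)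
    qed
    ultimately have "(?f has_real_derivative 2 * pi * y * sin (\<psi> y) - 2 * pi * y * (1 / sqrt 2)) (at y)"
      by (rule DERIV_diff)
    moreover note le
    ultimately show "\<exists>z. (?f has_real_derivative z) (at y) \<and> 0 \<le> z" by force
  qed (use x in simp)
  then have "x * (pi / sqrt 2 * x) \<le> x * cos (\<psi> x)" by (simp add: power2_eq_square mult_ac)
  then have "pi / sqrt 2 * x \<le> cos (\<psi> x)" by (rule mult_left_le_imp_le) (use x in simp)
  then have "pi / sqrt 2 * x \<le> 1" using cos_le_one[of "\<psi> x"] by linarith
  then have "pi * x \<le> sqrt 2" by (simp add: field_simps)
  moreover have "pi * (1/2) \<le> pi * x" using x by (intro mult_left_mono) auto
  ultimately have "pi \<le> 2 * sqrt 2" by linarith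
  moreover have "sqrt 2 \<le> 1.5" by (rule real_le_lsqrt) (auto simp: power2_eq_square)
  ultimately show False using pi_gt3 by linarith
qed

section \<open>The value function of the inspection phase and the tangent length\<close>

definition K :: "real \<Rightarrow> real" where
  "K x = integral {0..x} (\<lambda>y. 1 / sin (\<psi> y))"

lemma cont_csc: "continuous_on {0..1} (\<lambda>y. 1 / sin (\<psi> y))"
  using sin_\<psi> by (intro continuous_intros cont_\<psi>) force

lemma deriv_K: "x \<in> {0..1} \<Longrightarrow> (K has_real_derivative 1 / sin (\<psi> x)) (at x within {0..1})"
  unfolding K_def[abs_def] by (rule integral_has_real_derivative[OF cont_csc])

lemma cont_K: "continuous_on {0..1} K"
  by (rule DERIV_continuous_on) (use deriv_K in blast)

lemma K_0 [simp]: "K 0 = 0" by (simp add: K_def)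

text \<open>The covector of the calibration: \<open>W m x\<close> has length \<open>x\<close> and points along the optimal
  direction of motion when the fraction \<open>x\<close> of the circle, ending at angle \<open>m\<close>, is left.\<close>

definition W :: "real \<Rightarrow> real \<Rightarrow> plane" where
  "W m x = x *\<^sub>R unit_vec (m - 2 * pi * x + pi/2 - \<psi> x)"

lemma norm_W: "0 \<le> x \<Longrightarrow> norm (W m x) = x"
  by (simp add: W_def)

lemma cont_W: "continuous_on {0..1} (W m)"
  unfolding W_def by (intro continuous_intros cont_\<psi>)

text \<open>The angle of \<open>W\<close> turns at rate \<open>- cot (\<psi> x) / x\<close>, and
  this combines with the growing length to the single vector P / sin \<psi>, where P is the moving
  end of the uninspected arc. Since \<open>K\<close> has derivative
  \<open>1 / sin (\<psi> x)\<close>, the derivative of \<open>K x - A \<bullet> W m x\<close> is (1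
  - A \<bullet> P) / sin \<psi>. It vanishes when A is on the tangent at P, that is, while the path
  is just inspecting P.\<close>

lemma deriv_inner_W:
  assumes x: "x \<in> {0<..1}"
  shows "((\<lambda>x. A \<bullet> W m x) has_real_derivative (A \<bullet> unit_vec (m - 2 * pi * x)) / sin (\<psi> x)) (at x within {0..1})"
proof -
  have s: "sin (\<psi> x) > 0" using x by (intro sin_\<psi>) auto
  let ?a = "\<lambda>x. m - 2 * pi * x + pi/2 - \<psi> x"
  have eq: "A \<bullet> W m x = fst A * (x * cos (?a x)) + snd A * (x * sin (?a x))" for x
    by (cases A) (simp add: W_def unit_vec_def)
  have da: "(?a has_real_derivative - cot (\<psi> x) / x) (at x within {0..1})"
    by (rule derivative_eq_intros refl deriv_\<psi>[OF x])+ simp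
  have 1: "cos (?a x) + sin (?a x) * cot (\<psi> x) = cos (m - 2 * pi * x) / sin (\<psi> x)"
  proof -
    have "cos (?a x) * sin (\<psi> x) + sin (?a x) * cos (\<psi> x) = sin (?a x + \<psi> x)"
      unfolding sin_add by (rule add.commute)
    also have "\<dots> = cos (m - 2 * pi * x)" by (simp add: sin_add)
    finally show ?thesis using s by (simp add: cot_def field_simps)
  qed
  have 2: "sin (?a x) - cos (?a x) * cot (\<psi> x) = sin (m - 2 * pi * x) / sin (\<psi> x)"
  proof -
    have "sin (?a x) * sin (\<psi> x) - cos (?a x) * cos (\<psi> x) = - cos (?a x + \<psi> x)"
      unfolding cos_add by simp
    also have "\<dots> = sin (m - 2 * pi * x)" by (simp add: cos_add)
    finally show ?thesis using s by (simp add: cot_def field_simps)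
  qed
  have "((\<lambda>x. fst A * (x * cos (?a x)) + snd A * (x * sin (?a x))) has_real_derivative
      fst A * (cos (?a x) + sin (?a x) * cot (\<psi> x)) + snd A * (sin (?a x) - cos (?a x) * cot (\<psi> x))) (at x within {0..1})"
    by (rule derivative_eq_intros refl da)+ (use x in \<open>simp add: field_simps\<close>)
  then show ?thesis
    unfolding eq 1 2 by (cases A) (simp add: unit_vec_def add_divide_distrib)
qed

text \<open>\<open>exp (- acc x)\<close> is the integrating factor of the linear equation for
  \<tau>.\<close>

definition acc :: "real \<Rightarrow> real" where
  "acc x = integral {0..x} (\<lambda>y. 2 * pi * cot (\<psi> y))"

lemma deriv_acc: "x \<in> {0..1} \<Longrightarrow> (acc has_real_derivative 2 * pi * cot (\<psi> x)) (at x within {0..1})"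
  unfolding acc_def[abs_def] by (rule integral_has_real_derivative) (intro continuous_intros cont_cot)

lemma cont_acc: "continuous_on {0..1} acc"
  by (rule DERIV_continuous_on) (use deriv_acc in blast)

text \<open>Variation of constants with the value prescribed at \<xi>. To the left of \<xi> both
  summands have the right sign, so \<tau> is positive there; to the right positivity is a matter of
  \<open>tangent_length_stays_positive\<close>.\<close>

lemma tangent_length_exists:
  assumes \<xi>: "\<xi> \<in> {0..1}" and c: "c > 0"
  shows "\<exists>\<tau>. (\<forall>x\<in>{0..1}. (\<tau> has_real_derivative 2*pi * (\<tau> x * cot (\<psi> x) - 1)) (at x within {0..1})) \<and>
    \<tau> \<xi> = c \<and> (\<forall>x\<in>{0..\<xi>}. \<tau> x > 0)"
proof -
  define B where "B x = integral {0..x} (\<lambda>y. exp (- acc y))" for x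
  have contB: "continuous_on {0..1} (\<lambda>y. exp (- acc y))" by (intro continuous_intros cont_acc)
  have dB: "(B has_real_derivative exp (- acc x)) (at x within {0..1})" if "x \<in> {0..1}" for x
    unfolding B_def[abs_def] by (rule integral_has_real_derivative[OF contB that])
  define \<tau> where "\<tau> x = exp (acc x) * (exp (- acc \<xi>) * c + 2 * pi * (B \<xi> - B x))" for x
  show ?thesis
  proof (intro exI[of _ \<tau>] conjI ballI)
    fix x :: real assume x: "x \<in> {0..1}"
    have e: "exp (acc x) * exp (- acc x) = 1" by (simp flip: exp_add)
    have "(\<tau> has_real_derivative 2 * pi * cot (\<psi> x) * \<tau> x - 2 * pi * (exp (acc x) * exp (- acc x))) (at x within {0..1})"
      unfolding \<tau>_def
      by (rule derivative_eq_intros refl deriv_acc[OF x] dB[OF x])+ (simp add: algebra_simps)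
    then show "(\<tau> has_real_derivative 2*pi * (\<tau> x * cot (\<psi> x) - 1)) (at x within {0..1})"
      unfolding e by (simp add: algebra_simps)
  next
    show "\<tau> \<xi> = c" by (simp add: \<tau>_def flip: exp_add mult.assoc)
    fix x assume x: "x \<in> {0..\<xi>}"
    have "B x \<le> B \<xi>"
      unfolding B_def using x \<xi>
      by (intro integral_subset_le integrable_continuous_interval continuous_on_subset[OF contB]) auto
    then show "\<tau> x > 0" using c by (simp add: \<tau>_def add_pos_nonneg)
  qed
qed

end

section \<open>Deployment cost and inspection cost\<close>

lemma deriv_ln_sin:
  assumes "\<bar>h\<bar> < pi/2"
  shows "((\<lambda>h. ln ((1 + sin h) / (1 - sin h))) has_real_derivative 2 / cos h) (at h)"
proof -
  have c: "cos h > 0" using assms by (intro cos_gt_zero_pi) auto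
  have sc: "(1 + sin h) * (1 - sin h) = cos h * cos h"
    using sin_cos_squared_add[of h] by (simp add: algebra_simps power2_eq_square)
  have "\<bar>sin h\<bar> \<noteq> 1" using sc c by (auto simp: abs_if split: if_splits)
  then have s: "1 - sin h > 0" "1 + sin h > 0"
    using abs_sin_le_one[of h] by linarith+
  have "((\<lambda>h. ln ((1 + sin h) / (1 - sin h))) has_real_derivative
      (cos h * (1 - sin h) - (1 + sin h) * (- cos h)) / ((1 - sin h) * (1 - sin h)) / ((1 + sin h) / (1 - sin h))) (at h)"
    using s by (auto intro!: derivative_eq_intros simp: divide_pos_pos)
  moreover have "(cos h * (1 - sin h) - (1 + sin h) * (- cos h)) / ((1 - sin h) * (1 - sin h)) / ((1 + sin h) / (1 - sin h))
      = 2 * cos h / ((1 + sin h) * (1 - sin h))"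
  proof -
    have "cos h * (1 - sin h) - (1 + sin h) * (- cos h) = 2 * cos h" by (simp add: algebra_simps)
    moreover have "x / (b * b) / (a / b) = x / (a * b)" if "b \<noteq> 0" for x a b :: real
      using that by simp
    ultimately show ?thesis using s by simp
  qed
  ultimately show ?thesis using c unfolding sc by simp
qed

text \<open>\<open>h\<close> is the half-angle of the arc inspected from the end of the segment.
  With \<open>\<xi> = 1 - h/pi\<close> these are the first two summands of
  \<open>total_cost\<close>: the logarithm accounts for the points seen during the deployment, the
  quotient charges its duration to all the others.\<close>

definition deployment_cost :: "real \<Rightarrow> real" where
  "deployment_cost h = 1 / (2*pi) * ln ((1 + sin h) / (1 - sin h)) + (1 - h/pi) / cos h"

lemma deriv_deployment_cost:
  assumes "0 \<le> h" "h < pi/2"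
  shows "(deployment_cost has_real_derivative (1 - h/pi) * sin h / (cos h)\<^sup>2) (at h)"
proof -
  have c: "cos h > 0" using assms by (intro cos_gt_zero_pi) auto
  have 1: "((\<lambda>h. ln ((1 + sin h) / (1 - sin h))) has_real_derivative 2 / cos h) (at h)"
    using assms by (intro deriv_ln_sin) auto
  have 2: "((\<lambda>h. (1 - h/pi) / cos h) has_real_derivative
      ((- 1/pi) * cos h - (1 - h/pi) * (- sin h)) / (cos h * cos h)) (at h)"
    using c by (auto intro!: derivative_eq_intros)
  have "1 / (2*pi) * (2 / cos h) + ((- 1/pi) * cos h - (1 - h/pi) * (- sin h)) / (cos h * cos h)
      = (1 - h/pi) * sin h / (cos h)\<^sup>2"
    using c by (simp add: field_simps power2_eq_square)
  with DERIV_add[OF DERIV_cmult[OF 1, of "1/(2*pi)"] 2] show ?thesis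
    unfolding deployment_cost_def[abs_def] by simp
qed

lemma deriv_sec:
  assumes "0 \<le> h" "h < pi/2"
  shows "((\<lambda>h. 1 / cos h) has_real_derivative sin h / (cos h)\<^sup>2) (at h)"
proof -
  have c: "cos h > 0" using assms by (intro cos_gt_zero_pi) auto
  show ?thesis using c by (auto intro!: derivative_eq_intros simp: power2_eq_square)
qed

text \<open>The derivative of \<open>deployment_cost\<close> is that of the secant times the weight
  \<open>1 - y/pi\<close>, which is largest at the left end. So lengthening the segment costs at
  most its extra length times the fraction uninspected before.\<close>

lemma deployment_cost_diff_le:
  assumes h: "0 \<le> h" "h \<le> h'" "h' < pi/2"
  shows "deployment_cost h' - deployment_cost h \<le> (1 - h/pi) * (1 / cos h' - 1 / cos h)"
proof -
  let ?f = "\<lambda>y. (1 - h/pi) * (1 / cos y) - deployment_cost y"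
  have "?f h \<le> ?f h'"
  proof (rule DERIV_nonneg_imp_nondecreasing[OF h(2)])
    fix y assume y: "h \<le> y" "y \<le> h'"
    define X where "X = sin y / (cos y)\<^sup>2"
    have d: "(?f has_real_derivative (1 - h/pi) * X - (1 - y/pi) * X) (at y)"
      using DERIV_diff[OF DERIV_cmult[OF deriv_sec[of y]] deriv_deployment_cost[of y]] y h by (simp add: X_def)
    have "0 \<le> sin y" using y h by (intro sin_ge_zero) auto
    then have "0 \<le> (y/pi - h/pi) * X"
      using y by (intro mult_nonneg_nonneg) (auto simp: divide_right_mono X_def)
    then have "0 \<le> (1 - h/pi) * X - (1 - y/pi) * X"
      by (simp add: algebra_simps)
    with d show "\<exists>z. (?f has_real_derivative z) (at y) \<and> 0 \<le> z" by blast
  qed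
  then show ?thesis by (simp add: algebra_simps)
qed

context steering_angle
begin

text \<open>The value function of the inspection phase, at the common point of the two tangent lines
  that bound the inspected arc of half-angle \<open>h\<close>.\<close>

definition inspection_cost :: "real \<Rightarrow> real" where
  "inspection_cost h = (1 - h/pi) * cos (\<psi> (1 - h/pi)) * tan h
     + 2*pi * integral {0..1 - h/pi} (\<lambda>x. x * cos (\<psi> x))"

definition phase_cost :: "real \<Rightarrow> real" where
  "phase_cost h = deployment_cost h + inspection_cost h"

lemma cont_x_cos: "continuous_on {0..1} (\<lambda>x. x * cos (\<psi> x))"
  by (intro continuous_intros cont_\<psi>)

lemma deriv_x_cos_at:
  assumes "0 < x" "x < 1"
  shows "((\<lambda>x. x * cos (\<psi> x)) has_real_derivative 2 * pi * x * sin (\<psi> x)) (at x)"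
proof -
  have "at x within {0..1} = at x" using assms by (intro at_within_interior) auto
  then show ?thesis using deriv_x_cos[of x] assms by auto
qed

lemma deriv_integral_x_cos_at:
  assumes "0 < x" "x < 1"
  shows "((\<lambda>x. integral {0..x} (\<lambda>x. x * cos (\<psi> x))) has_real_derivative x * cos (\<psi> x)) (at x)"
proof -
  have "at x within {0..1} = at x" using assms by (intro at_within_interior) auto
  then show ?thesis using integral_has_real_derivative[OF cont_x_cos, of x] assms by auto
qed

lemma K_minus_x_sin:
  assumes x: "x \<in> {0..1}"
  shows "K x - x * sin (\<psi> x) = 2*pi * integral {0..x} (\<lambda>x. x * cos (\<psi> x))"
proof -
  let ?f = "\<lambda>x. K x - x * sin (\<psi> x) - 2*pi * integral {0..x} (\<lambda>x. x * cos (\<psi> x))"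
  have "continuous_on {0..1} (\<lambda>x. integral {0..x} (\<lambda>x. x * cos (\<psi> x)))"
    by (intro indefinite_integral_continuous_1 integrable_continuous_interval cont_x_cos)
  then have "continuous_on {0..1} ?f"
    by (intro continuous_intros cont_K cont_\<psi>)
  moreover have "(?f has_real_derivative 0) (at y)" if y: "0 < y" "y < 1" for y
  proof -
    have e: "at y within {0..1} = at y" using y by (intro at_within_interior) auto
    have 1: "(K has_real_derivative 1 / sin (\<psi> y)) (at y)" using deriv_K[of y] y e by auto
    have 2: "((\<lambda>x. x * sin (\<psi> x)) has_real_derivative 1 / sin (\<psi> y) - 2 * pi * (y * cos (\<psi> y))) (at y)"
      using deriv_x_sin[of y] y e by auto
    show ?thesis
      using DERIV_diff[OF DERIV_diff[OF 1 2] DERIV_cmult[OF deriv_integral_x_cos_at[OF y], of "2*pi"]] by simp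
  qed
  ultimately have "?f x = ?f 0"
    using DERIV_isconst2[of 0 1 ?f x] x by auto
  then show ?thesis by simp
qed

text \<open>The right-hand side is \<open>K - A \<bullet> W\<close> at a tip, in the shape that
  \<open>Phi\<close> takes there; the definition has the shape that matches
  \<open>total_cost\<close>.\<close>

lemma inspection_cost_alt:
  assumes "0 \<le> h" "h < pi/2"
  shows "inspection_cost h = K (1 - h/pi) - (1 - h/pi) / cos h * sin (\<psi> (1 - h/pi) - h)"
proof -
  have c: "cos h > 0" using assms by (intro cos_gt_zero_pi) auto
  have "1 - h/pi \<in> {0..1}" using assms by (auto simp: field_simps)
  note K_minus_x_sin[OF this]
  moreover have "(1 - h/pi) / cos h * sin (\<psi> (1 - h/pi) - h)
      = (1 - h/pi) * sin (\<psi> (1 - h/pi)) - (1 - h/pi) * cos (\<psi> (1 - h/pi)) * tan h"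
    using c by (simp add: sin_diff tan_def field_simps)
  ultimately show ?thesis unfolding inspection_cost_def by linarith
qed

text \<open>Only the last factor can change sign. It compares \<open>pi/2 - h\<close> with the
  absolute value of \<open>2 * h - \<psi>\<close>, and this is where the condition
  \<open>3 * h = pi/2 + \<psi>\<close> for the minimizer comes from.\<close>

lemma deriv_phase_cost:
  assumes h: "0 < h" "h < pi/2"
  shows "(phase_cost has_real_derivative
    (1 - h/pi) / (cos h)\<^sup>2 * (sin h - cos (2 * h - \<psi> (1 - h/pi)))) (at h)"
proof -
  let ?u = "1 - h/pi"
  have c: "cos h > 0" using h by (intro cos_gt_zero_pi) auto
  have u: "0 < ?u" "?u < 1" using h by (auto simp: field_simps)
  have du: "((\<lambda>h. 1 - h/pi) has_real_derivative - 1/pi) (at h)"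
    by (auto intro!: derivative_eq_intros)
  have 1: "((\<lambda>h. (1 - h/pi) * cos (\<psi> (1 - h/pi))) has_real_derivative 2 * pi * ?u * sin (\<psi> ?u) * (- 1/pi)) (at h)"
    using DERIV_chain2[OF deriv_x_cos_at[OF u] du] .
  have 2: "((\<lambda>h. integral {0..1 - h/pi} (\<lambda>x. x * cos (\<psi> x))) has_real_derivative ?u * cos (\<psi> ?u) * (- 1/pi)) (at h)"
    using DERIV_chain2[OF deriv_integral_x_cos_at[OF u] du] .
  have 3: "(tan has_real_derivative inverse ((cos h)\<^sup>2)) (at h)"
    using c by (intro DERIV_tan) auto
  have "(phase_cost has_real_derivative (1 - h/pi) * sin h / (cos h)\<^sup>2 +
      ((2 * pi * ?u * sin (\<psi> ?u) * (- 1/pi)) * tan h + inverse ((cos h)\<^sup>2) * (?u * cos (\<psi> ?u))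
       + 2*pi * (?u * cos (\<psi> ?u) * (- 1/pi)))) (at h)"
    unfolding phase_cost_def[abs_def] inspection_cost_def
    using h by (intro DERIV_add DERIV_mult DERIV_cmult 1 2 3 deriv_deployment_cost) auto
  also have "(1 - h/pi) * sin h / (cos h)\<^sup>2 +
      ((2 * pi * ?u * sin (\<psi> ?u) * (- 1/pi)) * tan h + inverse ((cos h)\<^sup>2) * (?u * cos (\<psi> ?u))
       + 2*pi * (?u * cos (\<psi> ?u) * (- 1/pi)))
     = ?u / (cos h)\<^sup>2 * (sin h - 2 * sin (\<psi> ?u) * sin h * cos h + cos (\<psi> ?u) - 2 * cos (\<psi> ?u) * (cos h)\<^sup>2)"
  proof -
    define v where "v = ?u"
    show ?thesis unfolding v_def[symmetric] tan_def using c
      by (simp add: field_simps power2_eq_square)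
  qed
  also have "sin h - 2 * sin (\<psi> ?u) * sin h * cos h + cos (\<psi> ?u) - 2 * cos (\<psi> ?u) * (cos h)\<^sup>2
      = sin h - cos (2 * h - \<psi> ?u)"
    unfolding cos_diff sin_double cos_double_cos by (simp add: algebra_simps)
  finally show ?thesis .
qed

lemma cont_phase_cost: "0 < a \<Longrightarrow> b < pi/2 \<Longrightarrow> continuous_on {a..b} phase_cost"
  by (intro continuous_at_imp_continuous_on ballI DERIV_isCont[OF deriv_phase_cost]) auto

text \<open>The derivative of \<open>phase_cost\<close> has the sign of \<open>?g\<close>, and
  \<open>?g\<close> is strictly increasing because its derivative is
  \<open>1 + cot \<psi> / (pi * u)\<close> with \<open>u = 1 - h/pi\<close>. Hence the cost
  decreases up to the zero of \<open>?g\<close> and increases beyond it. The bound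
  \<open>pi/6\<close> comes from \<psi> > 0.\<close>

lemma optimal_half_angle_exists:
  obtains hs where "pi/6 \<le> hs" "hs < pi/2" "3 * hs = pi/2 + \<psi> (1 - hs/pi)"
    "\<And>a b. 0 < a \<Longrightarrow> a < b \<Longrightarrow> b \<le> hs \<Longrightarrow> phase_cost b < phase_cost a"
    "\<And>a b. hs \<le> a \<Longrightarrow> a < b \<Longrightarrow> b < pi/2 \<Longrightarrow> phase_cost a < phase_cost b"
proof -
  let ?g = "\<lambda>h. 3 * h - pi/2 - \<psi> (1 - h/pi)"
  have cont: "continuous_on {0..pi/2} ?g"
    by (intro continuous_intros continuous_on_compose2[OF cont_\<psi>]) (auto simp: field_simps)
  have g0: "?g 0 \<le> 0" using \<psi>_bounds[of 1] by (simp add: add_increasing)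
  have g1: "0 < ?g (pi/2)" using \<psi>_bounds[of "1/2"] pi_gt_zero by (simp add: field_simps; linarith)
  obtain hs where hs: "0 \<le> hs" "hs \<le> pi/2" "?g hs = 0"
    using IVT'[of ?g 0 0 "pi/2", OF g0 less_imp_le[OF g1] _ cont] by auto
  have hs2: "hs < pi/2" using g1 hs by (cases "hs = pi/2") auto
  have u: "1 - hs/pi \<in> {0..1}" using hs by (auto simp: field_simps)
  have hs6: "pi/6 \<le> hs" using hs(3) \<psi>_bounds[OF u] by simp
  have mono: "?g a < ?g b" if "0 \<le> a" "a < b" "b \<le> pi/2" for a b
  proof (rule DERIV_pos_imp_increasing_open[OF that(2)])
    fix h assume h: "a < h" "h < b"
    let ?u = "1 - h/pi"
    have u: "0 < ?u" "?u < 1" using h that by (auto simp: field_simps)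
    have d: "(?g has_real_derivative 3 - (- 2*pi + cot (\<psi> ?u) / ?u) * (- 1/pi)) (at h)"
    proof -
      have "((\<lambda>h. 1 - h/pi) has_real_derivative - 1/pi) (at h)" by (auto intro!: derivative_eq_intros)
      note d\<psi> = DERIV_chain2[where g = "\<lambda>h. 1 - h/pi", OF deriv_\<psi>_at[OF u] this]
      have "((\<lambda>h. 3 * h - pi/2) has_real_derivative 3) (at h)" by (auto intro!: derivative_eq_intros)
      from DERIV_diff[OF this d\<psi>] show ?thesis .
    qed
    define Y where "Y = cot (\<psi> ?u) / ?u"
    have "0 \<le> Y" unfolding Y_def using cot_\<psi>[of ?u] u by (intro divide_nonneg_pos) auto
    moreover have "3 - (- 2*pi + Y) * (- 1/pi) = 1 + Y/pi" by (simp add: field_simps)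
    moreover have "0 < 1 + Y/pi" using \<open>0 \<le> Y\<close> by (simp add: add_pos_nonneg)
    ultimately have "0 < 3 - (- 2*pi + cot (\<psi> ?u) / ?u) * (- 1/pi)"
      unfolding Y_def[symmetric] by linarith
    with d show "\<exists>z. (?g has_real_derivative z) (at h) \<and> 0 < z" by blast
  qed (use that in \<open>auto intro: continuous_on_subset[OF cont]\<close>)
  have pos: "0 < (1 - h/pi) / (cos h)\<^sup>2" if "0 < h" "h < pi/2" for h
  proof -
    have "cos h > 0" using that by (intro cos_gt_zero_pi) auto
    then show ?thesis using that by (intro divide_pos_pos) (auto simp: field_simps)
  qed
  have \<psi>u: "0 < \<psi> (1 - h/pi)" "\<psi> (1 - h/pi) \<le> pi/2" if "0 < h" "h < pi/2" for h
    using \<psi>_bounds[of "1 - h/pi"] that by (auto simp: field_simps)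
  show thesis
  proof (rule that[OF hs6 hs2])
    show "3 * hs = pi/2 + \<psi> (1 - hs/pi)" using hs by simp
    fix a b :: real
    {
      assume ab: "0 < a" "a < b" "b \<le> hs"
      show "phase_cost b < phase_cost a"
      proof (rule DERIV_neg_imp_decreasing_open[OF ab(2)])
        fix h assume h: "a < h" "h < b"
        have "?g h < 0" using mono[of h hs] h ab hs by auto
        then have "\<bar>2 * h - \<psi> (1 - h/pi)\<bar> < pi/2 - h"
          using \<psi>u[of h] h ab hs2 by (auto simp: abs_if)
        then have "cos (pi/2 - h) < cos \<bar>2 * h - \<psi> (1 - h/pi)\<bar>"
          using h ab hs2 by (intro cos_monotone_0_pi) auto
        then have "sin h - cos (2 * h - \<psi> (1 - h/pi)) < 0" by (simp add: sin_cos_eq[of h])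
        then show "\<exists>y. (phase_cost has_real_derivative y) (at h) \<and> y < 0"
          using deriv_phase_cost[of h] pos[of h] h ab hs2 by (meson mult_pos_neg order.strict_trans order.strict_trans2)
      next
        show "continuous_on {a..b} phase_cost"
          using ab hs2 by (intro cont_phase_cost) auto
      qed
    next
      assume ab: "hs \<le> a" "a < b" "b < pi/2"
      have a0: "0 < a" using ab hs6 pi_gt_zero by linarith
      show "phase_cost a < phase_cost b"
      proof (rule DERIV_pos_imp_increasing_open[OF ab(2)])
        fix h assume h: "a < h" "h < b"
        have "0 < ?g h" using mono[of hs h] h ab hs by auto
        then have "cos (2 * h - \<psi> (1 - h/pi)) < cos (pi/2 - h)"
          using \<psi>u[of h] h ab a0 by (intro cos_monotone_0_pi) auto
        then have "0 < sin h - cos (2 * h - \<psi> (1 - h/pi))" by (simp add: sin_cos_eq[of h])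
        then show "\<exists>y. (phase_cost has_real_derivative y) (at h) \<and> y > 0"
          using deriv_phase_cost[of h] pos[of h] h ab a0 by (meson mult_pos_pos order.strict_trans)
      next
        show "continuous_on {a..b} phase_cost"
          using ab a0 by (intro cont_phase_cost) auto
      qed
    }
  qed
qed

text \<open>The integrand of \<open>total_cost\<close> has an explicit antiderivative,
  \<open>x * cos (\<psi> x) * \<tau> x\<close> plus a term without \<tau>. So \<tau> enters only
  through its end value \<open>tan \<theta>\<close>, and the cost becomes a function of one
  angle.\<close>

lemma total_cost_eq_phase_cost:
  assumes \<theta>: "0 < \<theta>" "\<theta> < pi/2"
    and \<tau>: "\<And>x. x \<in> {0..1} \<Longrightarrow> (\<tau> has_real_derivative 2*pi * (\<tau> x * cot (\<psi> x) - 1)) (at x within {0..1})"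
    and end_value: "\<tau> (1 - \<theta>/pi) = tan \<theta>"
  shows "total_cost (1 - \<theta>/pi) \<psi> \<tau> = phase_cost \<theta>"
proof -
  let ?\<xi> = "1 - \<theta>/pi"
  have \<xi>: "0 < ?\<xi>" "?\<xi> < 1" using \<theta> by (auto simp: field_simps)
  let ?I = "\<lambda>x. integral {0..x} (\<lambda>x. x * cos (\<psi> x))"
  let ?f = "\<lambda>x. x * cos (\<psi> x) * \<tau> x + 2*pi * ?I x"
  have cont\<tau>: "continuous_on {0..1} \<tau>" by (rule DERIV_continuous_on) (use \<tau> in blast)
  have "((\<lambda>x. 2*pi * (x * \<tau> x / sin (\<psi> x))) has_integral ?f ?\<xi> - ?f 0) {0..?\<xi>}"
  proof (rule fundamental_theorem_of_calculus_interior)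
    have "continuous_on {0..1} ?I"
      by (intro indefinite_integral_continuous_1 integrable_continuous_interval cont_x_cos)
    then have "continuous_on {0..1} ?f" by (intro continuous_intros cont_\<psi> cont\<tau>)
    then show "continuous_on {0..?\<xi>} ?f" by (rule continuous_on_subset) (use \<xi> in auto)
    fix x assume "x \<in> {0<..<?\<xi>}"
    then have x: "0 < x" "x < 1" using \<xi> by auto
    have e: "at x within {0..1} = at x" using x by (intro at_within_interior) auto
    have s: "sin (\<psi> x) > 0" using x by (intro sin_\<psi>) auto
    have sc: "cos (\<psi> x) * cos (\<psi> x) = 1 - sin (\<psi> x) * sin (\<psi> x)"
      using sin_cos_squared_add[of "\<psi> x"] by (simp add: power2_eq_square)
    have d\<tau>: "(\<tau> has_real_derivative 2*pi * (\<tau> x * cot (\<psi> x) - 1)) (at x)" using \<tau>[of x] x e by auto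
    have "(?f has_real_derivative 2 * pi * x * sin (\<psi> x) * \<tau> x + 2*pi * (\<tau> x * cot (\<psi> x) - 1) * (x * cos (\<psi> x))
       + 2*pi * (x * cos (\<psi> x))) (at x)"
      by (intro DERIV_add DERIV_mult DERIV_cmult deriv_x_cos_at deriv_integral_x_cos_at x d\<tau>)
    also have "2 * pi * x * sin (\<psi> x) * \<tau> x + 2*pi * (\<tau> x * cot (\<psi> x) - 1) * (x * cos (\<psi> x)) + 2*pi * (x * cos (\<psi> x))
        = 2 * pi * x * \<tau> x * (sin (\<psi> x) * sin (\<psi> x) + cos (\<psi> x) * cos (\<psi> x)) / sin (\<psi> x)"
    proof -
      define S C where "S = sin (\<psi> x)" and "C = cos (\<psi> x)"
      have "S > 0" using s by (simp add: S_def)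
      then show ?thesis
        unfolding cot_def S_def[symmetric] C_def[symmetric] by (simp add: field_simps)
    qed
    also have "\<dots> = 2*pi * (x * \<tau> x / sin (\<psi> x))" unfolding sc by simp
    finally show "(?f has_vector_derivative 2*pi * (x * \<tau> x / sin (\<psi> x))) (at x)"
      by (simp add: has_real_derivative_iff_has_vector_derivative)
  qed (use \<xi> in auto)
  then have "integral {0..?\<xi>} (\<lambda>x. 2*pi * (x * \<tau> x / sin (\<psi> x))) = inspection_cost \<theta>"
    by (simp add: integral_unique inspection_cost_def end_value)
  then have "2*pi * integral {0..?\<xi>} (\<lambda>x. x * \<tau> x / sin (\<psi> x)) = inspection_cost \<theta>" by (simp only: integral_mult_right)
  moreover have "sin (?\<xi> * pi) = sin \<theta>" "cos ((1 - ?\<xi>) * pi) = cos \<theta>"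
    by (simp_all add: algebra_simps)
  ultimately show ?thesis by (simp add: total_cost_def phase_cost_def deployment_cost_def)
qed

end

section \<open>Inspection times and the average cost\<close>

text \<open>On the way from P to A the norm drops to first order as soon as
  \<open>A \<bullet> P < 1\<close>. Inspecting P therefore means lying on or beyond the tangent line
  at P, a linear condition on A.\<close>

lemma inspects_iff:
  assumes P: "norm P = 1"
  shows "inspects A P \<longleftrightarrow> 1 \<le> A \<bullet> P"
proof
  assume ins: "inspects A P"
  show "1 \<le> A \<bullet> P"
  proof (rule ccontr)
    assume "\<not> 1 \<le> A \<bullet> P"
    then have d: "0 < 1 - A \<bullet> P" by simp
    have PP: "P \<bullet> P = 1" using P by (simp add: dot_square_norm)
    have AP: "A \<noteq> P" using d PP by auto
    define n where "n = (norm (A - P))\<^sup>2"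
    have n: "n > 0" using AP by (simp add: n_def)
    \<comment> \<open>Small enough for the quadratic term to consume at most half of the linear
      decrease.\<close>
    define l where "l = min 1 ((1 - A \<bullet> P) / n)"
    have l: "0 < l" "l \<le> 1" "l * n \<le> 1 - A \<bullet> P" using d n by (auto simp: l_def min_def field_simps)
    have "l *\<^sub>R A + (1 - l) *\<^sub>R P = P + l *\<^sub>R (A - P)" by (simp add: algebra_simps)
    then have "(norm (l *\<^sub>R A + (1 - l) *\<^sub>R P))\<^sup>2 = 1 - 2 * l * (1 - A \<bullet> P) + l * (l * n)"
      by (simp add: power2_norm_eq_inner n_def inner_add_left inner_add_right inner_diff_left inner_diff_right
          PP inner_commute algebra_simps)
    also have "\<dots> \<le> 1 - 2 * l * (1 - A \<bullet> P) + l * (1 - A \<bullet> P)"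
      using l by (intro add_left_mono mult_left_mono) auto
    also have "\<dots> < 1" using l d by (simp add: algebra_simps)
    finally have "norm (l *\<^sub>R A + (1 - l) *\<^sub>R P) < 1"
      by (metis norm_ge_zero one_power2 power2_less_imp_less zero_le_one)
    moreover have "1 \<le> norm (l *\<^sub>R A + (1 - l) *\<^sub>R P)" using ins l by (auto simp: inspects_def)
    ultimately show False by simp
  qed
next
  assume AP: "1 \<le> A \<bullet> P"
  show "inspects A P"
    unfolding inspects_def
  proof
    fix l :: real assume l: "l \<in> {0..1}"
    have "1 = l * 1 + (1 - l) * (P \<bullet> P)" using P by (simp add: dot_square_norm)
    also have "\<dots> \<le> l * (A \<bullet> P) + (1 - l) * (P \<bullet> P)" using AP l by (intro add_right_mono mult_left_mono) auto
    also have "\<dots> = (l *\<^sub>R A + (1 - l) *\<^sub>R P) \<bullet> P" by (simp add: inner_add_left)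
    also have "\<dots> \<le> norm (l *\<^sub>R A + (1 - l) *\<^sub>R P) * norm P" by (rule norm_cauchy_schwarz)
    finally show "1 \<le> norm (l *\<^sub>R A + (1 - l) *\<^sub>R P)" using P by simp
  qed
qed

text \<open>Together with \<open>inspects_iff\<close>: the hull contains the disk exactly when every
  point of the circle is inspected from the set. For the converse, a point of the disk outside the
  hull is separated from it, and the unit vector opposite to the normal \<open>a\<close> is
  tested.\<close>

lemma cball_subset_hull_iff:
  fixes K :: "plane set"
  assumes "compact K"
  shows "cball 0 1 \<subseteq> convex hull K \<longleftrightarrow> (\<forall>P. norm P = 1 \<longrightarrow> (\<exists>x\<in>K. 1 \<le> x \<bullet> P))"
proof (intro iffI allI impI)
  fix P :: plane
  assume sub: "cball 0 1 \<subseteq> convex hull K" and P: "norm P = 1"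
  show "\<exists>x\<in>K. 1 \<le> x \<bullet> P"
  proof (rule ccontr)
    assume "\<not> (\<exists>x\<in>K. 1 \<le> x \<bullet> P)"
    then have "K \<subseteq> {x. P \<bullet> x < 1}" by (auto simp: inner_commute not_le)
    then have "convex hull K \<subseteq> {x. P \<bullet> x < 1}" by (rule hull_minimal) (rule convex_halfspace_lt)
    moreover have "P \<in> convex hull K" using sub P by auto
    ultimately show False using P by (auto simp: dot_square_norm)
  qed
next
  assume cover: "\<forall>P. norm P = 1 \<longrightarrow> (\<exists>x\<in>K. 1 \<le> x \<bullet> P)"
  show "cball 0 1 \<subseteq> convex hull K"
  proof (rule ccontr)
    assume "\<not> cball 0 1 \<subseteq> convex hull K"
    then obtain z where "z \<in> cball 0 1" and zK: "z \<notin> convex hull K" by blast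
    then have z: "norm z \<le> 1" by simp
    obtain a b where ab: "a \<bullet> z < b" "\<And>x. x \<in> convex hull K \<Longrightarrow> b < a \<bullet> x"
      using separating_hyperplane_closed_point[OF convex_convex_hull, of K z] zK
        compact_imp_closed[OF compact_convex_hull[OF assms]] by blast
    obtain x0 where "x0 \<in> K" using cover[rule_format, of "unit_vec 0"] by auto
    then have a: "a \<noteq> 0" using ab(1) ab(2)[of x0] by (auto simp: hull_inc)
    obtain x where x: "x \<in> K" "1 \<le> x \<bullet> (- a /\<^sub>R norm a)"
      using cover[rule_format, of "- a /\<^sub>R norm a"] a by auto
    then have "norm a \<le> - (a \<bullet> x)" using a by (simp add: inner_commute field_simps)
    moreover have "- (norm a * norm z) \<le> a \<bullet> z" using Cauchy_Schwarz_ineq2[of a z] by linarith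
    moreover have "norm a * norm z \<le> norm a * 1" using z by (intro mult_left_mono) auto
    ultimately show False using ab(1) ab(2)[of x] x(1) by (auto simp: hull_inc)
  qed
qed

lemma inspective_continuous: "inspective_trajectory \<gamma> L \<Longrightarrow> continuous_on {0..L} \<gamma>"
  by (simp add: inspective_trajectory_def piecewise_differentiable_on_def)

text \<open>The lower bound uses the unit speed only through this estimate. Finitely many
  exceptional times affect neither the fundamental theorem nor the norm bound.\<close>

lemma inspective_lipschitz:
  assumes ins: "inspective_trajectory \<gamma> L" and st: "s \<in> {0..L}" "t \<in> {0..L}"
  shows "norm (\<gamma> t - \<gamma> s) \<le> \<bar>t - s\<bar>"
proof -
  obtain S1 where S1: "finite S1" "\<And>x. x \<in> {0..L} - S1 \<Longrightarrow> \<gamma> differentiable (at x within {0..L})"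
    using ins unfolding inspective_trajectory_def piecewise_differentiable_on_def by auto
  obtain S2 where S2: "finite S2"
    "\<And>x. x \<in> {0..L} - S2 \<Longrightarrow> norm (vector_derivative \<gamma> (at x within {0..L})) = 1"
    using ins unfolding inspective_trajectory_def by auto
  have *: "norm (\<gamma> t - \<gamma> s) \<le> t - s" if "0 \<le> s" "s \<le> t" "t \<le> L" for s t
  proof -
    let ?g = "\<lambda>x. vector_derivative \<gamma> (at x within {0..L})"
    have "(?g has_integral \<gamma> t - \<gamma> s) {s..t}"
    proof (rule fundamental_theorem_of_calculus_interior_strong[OF S1(1) that(2)])
      fix x assume x: "x \<in> {s<..<t} - S1"
      then have "(\<gamma> has_vector_derivative ?g x) (at x within {0..L})"
        using S1(2)[of x] that by (auto simp: vector_derivative_works)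
      moreover have "at x within {0..L} = at x" using x that by (intro at_within_interior) auto
      ultimately show "(\<gamma> has_vector_derivative ?g x) (at x)" by simp
    qed (use that in \<open>auto intro: continuous_on_subset[OF inspective_continuous[OF ins]]\<close>)
    then have "(?g has_integral \<gamma> t - \<gamma> s) (cbox s t)" by simp
    from has_integral_bound_spike_finite[OF zero_le_one S2(1) this]
    show ?thesis using S2(2) that by auto
  qed
  show ?thesis
    using *[of s t] *[of t s] st by (cases "s \<le> t") (auto simp: norm_minus_commute)
qed

lemma inspective_covers:
  assumes "inspective_trajectory \<gamma> L" "norm P = 1"
  shows "\<exists>t\<in>{0..L}. 1 \<le> \<gamma> t \<bullet> P"
proof -
  have "compact (\<gamma> ` {0..L})" by (intro compact_continuous_image inspective_continuous[OF assms(1)]) auto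
  moreover have "cball 0 1 \<subseteq> convex hull (\<gamma> ` {0..L})"
    using assms(1) by (simp add: inspective_trajectory_def)
  ultimately show ?thesis using cball_subset_hull_iff[of "\<gamma> ` {0..L}"] assms(2) by blast
qed

text \<open>The pairs of a time and a point inspected at that time form a closed set, and its
  projection along a compact interval is closed. The sublevel sets of \<open>inspection_time\<close>
  are made of such sets.\<close>

lemma closed_inspected_by:
  fixes \<gamma> :: "real \<Rightarrow> plane"
  assumes cont: "continuous_on {0..L} \<gamma>" and a: "a \<le> L"
  shows "closed {P. \<exists>t\<in>{0..a}. inspects (\<gamma> t) P}"
proof -
  have c: "continuous_on ({0..a} \<times> UNIV) (\<lambda>z. \<gamma> (fst z))"
    by (rule continuous_on_compose2[OF cont]) (use a in \<open>auto intro!: continuous_intros\<close>)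
  have "closed {z \<in> {0..a} \<times> (UNIV :: plane set). 1 \<le> norm (l *\<^sub>R \<gamma> (fst z) + (1 - l) *\<^sub>R snd z)}" for l
    by (intro continuous_on_closed_Collect_le continuous_intros c closed_Times)
  then have "closed (({0..a} \<times> (UNIV :: plane set)) \<inter>
      (\<Inter>l\<in>{0..1}. {z \<in> {0..a} \<times> (UNIV :: plane set). 1 \<le> norm (l *\<^sub>R \<gamma> (fst z) + (1 - l) *\<^sub>R snd z)}))"
    by (intro closed_Int closed_INT closed_Times) auto
  also have "({0..a} \<times> (UNIV :: plane set)) \<inter>
      (\<Inter>l\<in>{0..1}. {z \<in> {0..a} \<times> (UNIV :: plane set). 1 \<le> norm (l *\<^sub>R \<gamma> (fst z) + (1 - l) *\<^sub>R snd z)})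
    = {z. fst z \<in> {0..a} \<and> inspects (\<gamma> (fst z)) (snd z)}"
    by (auto simp: inspects_def)
  finally have "closed {P. \<exists>t. t \<in> {0..a} \<and> (t, P) \<in> {z. fst z \<in> {0..a} \<and> inspects (\<gamma> (fst z)) (snd z)}}"
    by (intro closed_compact_projection) auto
  moreover have "{P. \<exists>t. t \<in> {0..a} \<and> (t, P) \<in> {z. fst z \<in> {0..a} \<and> inspects (\<gamma> (fst z)) (snd z)}}
      = {P. \<exists>t\<in>{0..a}. inspects (\<gamma> t) P}" by auto
  ultimately show ?thesis by simp
qed

lemma closed_inspection_times:
  fixes \<gamma> :: "real \<Rightarrow> plane"
  assumes cont: "continuous_on {0..L} \<gamma>"
  shows "closed {t \<in> {0..L}. inspects (\<gamma> t) P}"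
proof -
  have "closed {t \<in> {0..L}. 1 \<le> norm (l *\<^sub>R \<gamma> t + (1 - l) *\<^sub>R P)}" for l
    by (intro continuous_on_closed_Collect_le continuous_intros cont)
  then have "closed ({0..L} \<inter> (\<Inter>l\<in>{0..1}. {t \<in> {0..L}. 1 \<le> norm (l *\<^sub>R \<gamma> t + (1 - l) *\<^sub>R P)}))"
    by (intro closed_Int closed_INT) auto
  also have "{0..L} \<inter> (\<Inter>l\<in>{0..1}. {t \<in> {0..L}. 1 \<le> norm (l *\<^sub>R \<gamma> t + (1 - l) *\<^sub>R P)})
      = {t \<in> {0..L}. inspects (\<gamma> t) P}" by (auto simp: inspects_def)
  finally show ?thesis .
qed

lemma inspection_time_attained:
  fixes \<gamma> :: "real \<Rightarrow> plane"
  assumes cont: "continuous_on {0..L} \<gamma>" and ex: "\<exists>t\<in>{0..L}. inspects (\<gamma> t) P"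
  shows "inspection_time \<gamma> L P \<in> {0..L}" "inspects (\<gamma> (inspection_time \<gamma> L P)) P"
proof -
  have "inspection_time \<gamma> L P \<in> {t \<in> {0..L}. inspects (\<gamma> t) P}"
    unfolding inspection_time_def
    by (rule closed_contains_Inf[OF _ _ closed_inspection_times[OF cont]]) (use ex in \<open>auto simp: bdd_below_def\<close>)
  then show "inspection_time \<gamma> L P \<in> {0..L}" "inspects (\<gamma> (inspection_time \<gamma> L P)) P" by auto
qed

lemma inspection_time_le: "t \<in> {0..L} \<Longrightarrow> inspects (\<gamma> t) P \<Longrightarrow> inspection_time \<gamma> L P \<le> t"
  unfolding inspection_time_def by (intro cInf_lower) (auto simp: bdd_below_def)

text \<open>Without measurability the Bochner integral in the cost would be \<open>0\<close>.\<close>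

lemma borel_measurable_inspection_time:
  fixes \<gamma> :: "real \<Rightarrow> plane"
  assumes cont: "continuous_on {0..L} \<gamma>"
  shows "inspection_time \<gamma> L \<in> borel_measurable borel"
proof (rule borel_measurableI_le)
  fix a :: real
  let ?Q = "\<lambda>b. {P. \<exists>t\<in>{0..b}. inspects (\<gamma> t) P}"
  \<comment> \<open>At points that are never inspected the infimum of the empty set is some fixed
    real number; the second alternative covers this default.\<close>
  have "inspection_time \<gamma> L P \<le> a \<longleftrightarrow> P \<in> ?Q (min a L) \<or> (P \<notin> ?Q L \<and> Inf {} \<le> a)" for P
  proof (cases "P \<in> ?Q L")
    case True
    then have ex: "\<exists>t\<in>{0..L}. inspects (\<gamma> t) P" by simp
    show ?thesis
    proof
      assume "inspection_time \<gamma> L P \<le> a"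
      then show "P \<in> ?Q (min a L) \<or> (P \<notin> ?Q L \<and> Inf {} \<le> a)"
        using inspection_time_attained[OF cont ex] by auto
    next
      assume "P \<in> ?Q (min a L) \<or> (P \<notin> ?Q L \<and> Inf {} \<le> a)"
      then obtain t where "t \<in> {0..min a L}" "inspects (\<gamma> t) P" using True by auto
      then show "inspection_time \<gamma> L P \<le> a" using inspection_time_le[of t L \<gamma> P] by auto
    qed
  next
    case False
    then have "{t \<in> {0..L}. inspects (\<gamma> t) P} = {}" by auto
    then have "inspection_time \<gamma> L P = Inf {}" by (simp only: inspection_time_def)
    then show ?thesis using False by auto
  qed
  then have "{P \<in> space borel. inspection_time \<gamma> L P \<le> a} = ?Q (min a L) \<union> (if Inf {} \<le> a then - ?Q L else {})"
    by auto
  moreover have "?Q (min a L) \<in> sets borel" "- ?Q L \<in> sets borel"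
    using closed_inspected_by[OF cont, of "min a L"] closed_inspected_by[OF cont, of L] by auto
  ultimately show "{P \<in> space borel. inspection_time \<gamma> L P \<le> a} \<in> sets borel" by auto
qed

lemma borel_measurable_unit_vec [measurable]: "unit_vec \<in> borel_measurable borel"
  by (intro borel_measurable_continuous_onI continuous_intros)

lemma avg_cost_eq_integral:
  assumes ins: "inspective_trajectory \<gamma> L"
  shows "(\<lambda>\<phi>. inspection_time \<gamma> L (unit_vec \<phi>)) integrable_on {0..2*pi}"
    and "avg_cost \<gamma> L = 1 / (2*pi) * integral {0..2*pi} (\<lambda>\<phi>. inspection_time \<gamma> L (unit_vec \<phi>))"
proof -
  let ?I = "inspection_time \<gamma> L" and ?A = "{0..2*pi}"
  note cont = inspective_continuous[OF ins]
  note meas [measurable] = borel_measurable_inspection_time[OF cont]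
  have rng: "?I (unit_vec \<phi>) \<in> {0..L}" for \<phi>
    using inspection_time_attained[OF cont] inspective_covers[OF ins] by (simp add: inspects_iff)
  have int: "set_integrable lborel ?A (\<lambda>\<phi>. ?I (unit_vec \<phi>))"
    unfolding set_integrable_def
  proof (rule Bochner_Integration.integrable_bound[where f = "\<lambda>\<phi>. indicator ?A \<phi> *\<^sub>R L"])
    show "integrable lborel (\<lambda>\<phi>. indicator ?A \<phi> *\<^sub>R L)"
      by (intro integrable_scaleR_left impI integrable_real_indicator) auto
    show "AE \<phi> in lborel. norm (indicator ?A \<phi> *\<^sub>R ?I (unit_vec \<phi>)) \<le> norm (indicator ?A \<phi> *\<^sub>R L)"
    proof (intro AE_I2)
      fix \<phi> show "norm (indicator ?A \<phi> *\<^sub>R ?I (unit_vec \<phi>)) \<le> norm (indicator ?A \<phi> *\<^sub>R L)"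
        using rng[of \<phi>] by (auto simp: indicator_def)
    qed
  qed measurable
  show "(\<lambda>\<phi>. ?I (unit_vec \<phi>)) integrable_on ?A"
    by (rule set_borel_integral_eq_integral(1)[OF int])
  have "uniform_measure lborel ?A = density lborel (\<lambda>x. ennreal (indicator ?A x / (2*pi)))"
    unfolding uniform_measure_def
  proof (intro arg_cong2[where f = density] ext refl)
    fix x :: real
    have "emeasure lborel ?A = ennreal (2*pi)" by simp
    then show "indicator ?A x / emeasure lborel ?A = ennreal (indicator ?A x / (2*pi))"
      by (cases "x \<in> ?A") (simp_all add: divide_ennreal flip: ennreal_1)
  qed
  then have "avg_cost \<gamma> L = (LINT \<phi>|density lborel (\<lambda>x. ennreal (indicator ?A x / (2*pi))). ?I (unit_vec \<phi>))"
    unfolding avg_cost_def uniform_circle_def unit_vec_def[symmetric]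
    by (subst integral_distr) auto
  also have "\<dots> = (LINT \<phi>|lborel. (indicator ?A \<phi> / (2*pi)) *\<^sub>R ?I (unit_vec \<phi>))"
    by (rule integral_density) auto
  also have "\<dots> = (LINT \<phi>|lborel. (1 / (2*pi)) * (indicator ?A \<phi> *\<^sub>R ?I (unit_vec \<phi>)))"
    by (intro Bochner_Integration.integral_cong) auto
  also have "\<dots> = 1 / (2*pi) * (LINT \<phi>:?A|lborel. ?I (unit_vec \<phi>))"
    unfolding set_lebesgue_integral_def by (rule integral_mult_right_zero)
  also have "(LINT \<phi>:?A|lborel. ?I (unit_vec \<phi>)) = integral ?A (\<lambda>\<phi>. ?I (unit_vec \<phi>))"
    by (rule set_borel_integral_eq_integral(2)[OF int])
  finally show "avg_cost \<gamma> L = 1 / (2*pi) * integral ?A (\<lambda>\<phi>. ?I (unit_vec \<phi>))" .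
qed

lemma inspection_time_nonneg:
  assumes ins: "inspective_trajectory \<gamma> L"
  shows "0 \<le> inspection_time \<gamma> L (unit_vec \<phi>)"
  using inspection_time_attained[OF inspective_continuous[OF ins], of "unit_vec \<phi>"]
    inspective_covers[OF ins] by (simp add: inspects_iff)

lemma avg_cost_nonneg:
  assumes ins: "inspective_trajectory \<gamma> L"
  shows "0 \<le> avg_cost \<gamma> L"
  unfolding avg_cost_eq_integral(2)[OF ins]
  using inspection_time_nonneg[OF ins] avg_cost_eq_integral(1)[OF ins]
  by (intro mult_nonneg_nonneg Henstock_Kurzweil_Integration.integral_nonneg) auto

lemma optimal_cost_le: "inspective_trajectory \<gamma> L \<Longrightarrow> optimal_cost \<le> avg_cost \<gamma> L"
  unfolding optimal_cost_def
  by (intro cInf_lower) (use avg_cost_nonneg in \<open>auto simp: bdd_below_def\<close>)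

lemma optimal_cost_eq: "optimal_trajectory \<gamma> L \<Longrightarrow> optimal_cost = avg_cost \<gamma> L"
  unfolding optimal_cost_def optimal_trajectory_def by (intro cInf_eq_minimum) auto

section \<open>Candidate trajectories\<close>

lemma has_integral_sec:
  assumes h: "0 < h" "h < pi/2"
  shows "((\<lambda>\<phi>. 1 / cos (\<phi> - h)) has_integral ln ((1 + sin h) / (1 - sin h))) {0..2*h}"
proof -
  let ?F = "\<lambda>\<phi>. ln ((1 + sin (\<phi> - h)) / (1 - sin (\<phi> - h))) / 2"
  have "((\<lambda>\<phi>. 1 / cos (\<phi> - h)) has_integral ?F (2*h) - ?F 0) {0..2*h}"
  proof (rule fundamental_theorem_of_calculus)
    fix \<phi> assume "\<phi> \<in> {0..2*h}"
    then have small: "\<bar>\<phi> - h\<bar> < pi/2" unfolding abs_less_iff using h by auto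
    have "((\<lambda>\<phi>. \<phi> - h) has_real_derivative 1) (at \<phi>)" by (auto intro!: derivative_eq_intros)
    from DERIV_chain2[where g = "\<lambda>\<phi>. \<phi> - h", OF deriv_ln_sin[OF small] this]
    have "((\<lambda>\<phi>. ln ((1 + sin (\<phi> - h)) / (1 - sin (\<phi> - h)))) has_real_derivative 2 / cos (\<phi> - h)) (at \<phi>)"
      by (simp only: mult_1_right)
    from DERIV_cdivide[OF this, of 2]
    have "(?F has_real_derivative (2 / cos (\<phi> - h)) / 2) (at \<phi>)" .
    moreover have "(2 / cos (\<phi> - h)) / 2 = 1 / cos (\<phi> - h)" by simp
    ultimately have "(?F has_real_derivative 1 / cos (\<phi> - h)) (at \<phi>)" by (simp only:)
    then show "(?F has_vector_derivative 1 / cos (\<phi> - h)) (at \<phi> within {0..2*h})"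
      unfolding has_real_derivative_iff_has_vector_derivative by (rule has_vector_derivative_at_within)
  qed (use h in auto)
  moreover have "?F (2*h) - ?F 0 = ln ((1 + sin h) / (1 - sin h))"
  proof -
    have "sin h > 0" using h by (intro sin_gt_zero) auto
    moreover have "sin h < 1"
      using sin_monotone_2pi[of h "pi/2"] h by simp
    ultimately have "ln ((1 - sin h) / (1 + sin h)) = - ln ((1 + sin h) / (1 - sin h))"
      by (simp add: ln_div)
    then show ?thesis by simp
  qed
  ultimately show ?thesis by simp
qed

text \<open>Half-angle formulas split off the factor \<open>sin (pi * x)\<close>, whose zeros are
  the ends of the interval.\<close>

lemma fst_curve_eq_1_iff:
  assumes "0 < x" "x < 1"
  shows "fst (curve \<tau> x) = 1 \<longleftrightarrow> sin (pi * x) + \<tau> x * cos (pi * x) = 0"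
proof -
  have s: "sin (pi * x) > 0" using assms by (intro sin_gt_zero) auto
  have "cos (2 * pi * x) = 1 - 2 * (sin (pi * x))\<^sup>2" "sin (2 * pi * x) = 2 * sin (pi * x) * cos (pi * x)"
    using cos_double_sin[of "pi * x"] sin_double[of "pi * x"] by (simp_all add: mult.assoc)
  then have "fst (curve \<tau> x) - 1 = - 2 * sin (pi * x) * (sin (pi * x) + \<tau> x * cos (pi * x))"
    by (simp add: curve_def power2_eq_square algebra_simps)
  then show ?thesis using s by (metis diff_eq_diff_eq diff_self mult_eq_0_iff neg_equal_0_iff_equal order_less_irrefl zero_neq_numeral)
qed

lemma curve_at_deployment:
  assumes \<theta>: "0 < \<theta>" "\<theta> < pi/2" and end_value: "\<tau> (1 - \<theta>/pi) = tan \<theta>"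
  shows "curve \<tau> (1 - \<theta>/pi) = (1, tan \<theta>)" "curve \<tau> (1 - \<theta>/pi) = (1 / cos \<theta>) *\<^sub>R unit_vec \<theta>"
proof -
  have c: "cos \<theta> > 0" using \<theta> by (intro cos_gt_zero_pi) auto
  have e: "2 * pi * (1 - \<theta>/pi) = 2*pi - 2*\<theta>" by (simp add: field_simps)
  have co: "cos (2*pi - 2*\<theta>) = 2 * (cos \<theta>)\<^sup>2 - 1"
    by (simp add: cos_diff cos_double_cos)
  have si: "sin (2*pi - 2*\<theta>) = - (2 * sin \<theta> * cos \<theta>)"
    by (simp add: sin_diff sin_double)
  have ss: "sin \<theta> * sin \<theta> = 1 - cos \<theta> * cos \<theta>"
    using sin_cos_squared_add[of \<theta>] by (simp add: power2_eq_square)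
  have "2 * (cos \<theta>)\<^sup>2 - 1 + tan \<theta> * (2 * sin \<theta> * cos \<theta>) = 2 * (cos \<theta>)\<^sup>2 - 1 + 2 * (sin \<theta> * sin \<theta>)"
    using c by (simp add: tan_def)
  also have "\<dots> = 1" unfolding ss by (simp add: power2_eq_square)
  finally have 1: "cos (2*pi - 2*\<theta>) - tan \<theta> * sin (2*pi - 2*\<theta>) = 1" unfolding co si by simp
  have 2: "- sin (2*pi - 2*\<theta>) - tan \<theta> * cos (2*pi - 2*\<theta>) = tan \<theta>"
    unfolding co si using c by (simp add: tan_def field_simps power2_eq_square)
  show "curve \<tau> (1 - \<theta>/pi) = (1, tan \<theta>)"
    unfolding curve_def end_value e using 1 2 by simp
  then show "curve \<tau> (1 - \<theta>/pi) = (1 / cos \<theta>) *\<^sub>R unit_vec \<theta>"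
    using c by (simp add: unit_vec_def tan_def)
qed

text \<open>The point lies on the tangent at the angle \<open>2 * pi * (1 - x)\<close>, at distance
  \<bar>\<tau> x\<bar> from the point of contact: \<tau> is a tangent length, and on the curve
  \<open>x\<close> is the uninspected fraction.\<close>

lemma curve_on_tangent:
  "curve \<tau> x \<bullet> unit_vec (2 * pi * (1 - x)) = 1"
proof -
  have "2 * pi * (1 - x) = 2 * pi - 2 * pi * x" by (simp add: algebra_simps)
  then have u: "unit_vec (2 * pi * (1 - x)) = (cos (2 * pi * x), - sin (2 * pi * x))"
    by (simp add: unit_vec_def cos_diff sin_diff)
  show ?thesis
    unfolding u curve_def using sin_cos_squared_add[of "2 * pi * x"]
    by (simp add: algebra_simps power2_eq_square)
qed

text \<open>The equation for \<tau> says that the velocity makes the angle \<open>p\<close> with the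
  tangent line. Traversed with decreasing \<open>x\<close> the direction is the opposite one, which
  is that of \<open>W 0 x\<close> when \<open>p = \<psi> x\<close>.\<close>

lemma deriv_curve:
  assumes \<tau>: "(\<tau> has_real_derivative 2*pi * (\<tau> x * cot p - 1)) (at x)" and p: "sin p \<noteq> 0"
  shows "(curve \<tau> has_vector_derivative (2*pi * \<tau> x / sin p) *\<^sub>R unit_vec (3*pi/2 - 2*pi*x - p)) (at x)"
proof -
  have three: "cos (3*pi/2) = 0" "sin (3*pi/2) = -1"
    using cos_3over2_pi sin_3over2_pi by simp_all
  let ?s = "sin (2*pi*x)" and ?c = "cos (2*pi*x)" and ?v = "2*pi * \<tau> x / sin p"
  have "((\<lambda>x. cos (2*pi*x) - \<tau> x * sin (2*pi*x)) has_real_derivative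
      - (2*pi * ?s) - (2*pi * (\<tau> x * cot p - 1) * ?s + \<tau> x * (2*pi * ?c))) (at x)"
    by (rule derivative_eq_intros refl \<tau>)+ (simp add: algebra_simps)
  also have "- (2*pi * ?s) - (2*pi * (\<tau> x * cot p - 1) * ?s + \<tau> x * (2*pi * ?c)) = ?v * (- sin (2*pi*x + p))"
    using p by (simp add: cot_def sin_add field_simps)
  also have "- sin (2*pi*x + p) = cos (3*pi/2 - (2*pi*x + p))"
    by (simp add: cos_diff three)
  finally have 1: "((\<lambda>x. cos (2*pi*x) - \<tau> x * sin (2*pi*x)) has_vector_derivative ?v * cos (3*pi/2 - (2*pi*x + p))) (at x)"
    by (simp add: has_real_derivative_iff_has_vector_derivative)
  have "((\<lambda>x. - sin (2*pi*x) - \<tau> x * cos (2*pi*x)) has_real_derivative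
      - (2*pi * ?c) - (2*pi * (\<tau> x * cot p - 1) * ?c + \<tau> x * (- (2*pi * ?s)))) (at x)"
    by (rule derivative_eq_intros refl \<tau>)+ (simp add: algebra_simps)
  also have "- (2*pi * ?c) - (2*pi * (\<tau> x * cot p - 1) * ?c + \<tau> x * (- (2*pi * ?s))) = ?v * (- cos (2*pi*x + p))"
    using p by (simp add: cot_def cos_add field_simps)
  also have "- cos (2*pi*x + p) = sin (3*pi/2 - (2*pi*x + p))"
    by (simp add: sin_diff three)
  finally have 2: "((\<lambda>x. - sin (2*pi*x) - \<tau> x * cos (2*pi*x)) has_vector_derivative ?v * sin (3*pi/2 - (2*pi*x + p))) (at x)"
    by (simp add: has_real_derivative_iff_has_vector_derivative)
  from has_vector_derivative_Pair[OF 1 2] show ?thesis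
    by (simp add: curve_def[abs_def] unit_vec_def diff_diff_eq)
qed

text \<open>The candidate goes straight to \<open>(1, tan \<theta>)\<close> and then backwards along the curve, at unit
  speed: \<open>G\<close> is arc length along the curve, measured from parameter \<open>0\<close>.\<close>

lemma optimal_cost_le_total_cost:
  fixes \<psi> \<tau> :: "real \<Rightarrow> real"
  assumes \<theta>: "0 < \<theta>" "\<theta> < pi/2"
    and cont\<psi>: "continuous_on {0..1} \<psi>" and sin\<psi>: "\<And>x. x \<in> {0..1} \<Longrightarrow> 0 < sin (\<psi> x)"
    and \<tau>: "\<And>x. x \<in> {0..1} \<Longrightarrow> (\<tau> has_real_derivative 2*pi * (\<tau> x * cot (\<psi> x) - 1)) (at x within {0..1})"
    and pos: "\<And>x. x \<in> {0..1 - \<theta>/pi} \<Longrightarrow> 0 < \<tau> x"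
    and end_value: "\<tau> (1 - \<theta>/pi) = tan \<theta>"
  shows "optimal_cost \<le> total_cost (1 - \<theta>/pi) \<psi> \<tau>"
proof -
  define \<xi> where "\<xi> = 1 - \<theta>/pi"
  have \<xi>: "0 < \<xi>" "\<xi> < 1" using \<theta> by (auto simp: \<xi>_def field_simps)
  have \<theta>\<xi>: "\<theta> = (1 - \<xi>) * pi" by (simp add: \<xi>_def)
  have c: "cos \<theta> > 0" using \<theta> by (intro cos_gt_zero_pi) auto
  define t0 where "t0 = 1 / cos \<theta>"
  have t0: "t0 > 0" using c by (simp add: t0_def)
  have sub: "{0..\<xi>} \<subseteq> {0..1}" using \<xi> by auto
  have cont\<tau>: "continuous_on {0..1} \<tau>" by (rule DERIV_continuous_on) (use \<tau> in blast)
  define v where "v x = 2*pi * \<tau> x / sin (\<psi> x)" for x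
  have contv: "continuous_on {0..\<xi>} v"
    unfolding v_def using sin\<psi> sub
    by (intro continuous_intros continuous_on_subset[OF cont\<psi> sub] continuous_on_subset[OF cont\<tau> sub]) force
  have v: "v x > 0" if "x \<in> {0..\<xi>}" for x
  proof -
    have "x \<in> {0..1}" using that sub by blast
    then show ?thesis using pos[of x] sin\<psi>[of x] that by (simp add: v_def \<xi>_def)
  qed
  define G where "G x = integral {0..x} v" for x
  have dG: "(G has_real_derivative v x) (at x)" if "0 < x" "x < \<xi>" for x
  proof -
    have "(G has_real_derivative v x) (at x within {0..\<xi>})"
      unfolding G_def[abs_def] by (rule integral_has_real_derivative[OF contv]) (use that in auto)
    moreover have "at x within {0..\<xi>} = at x" using that by (intro at_within_interior) auto
    ultimately show ?thesis by simp
  qed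
  have contG: "continuous_on {0..\<xi>} G"
    unfolding G_def by (intro indefinite_integral_continuous_1 integrable_continuous_interval contv)
  have Gmono: "G x < G y" if "0 \<le> x" "x < y" "y \<le> \<xi>" for x y
  proof (rule DERIV_pos_imp_increasing_open[OF that(2)])
    fix z assume "x < z" "z < y"
    then show "\<exists>d. (G has_real_derivative d) (at z) \<and> 0 < d"
      using that dG[of z] v[of z] by (intro exI[of _ "v z"]) auto
  qed (use that in \<open>auto intro: continuous_on_subset[OF contG]\<close>)
  have injG: "inj_on G {0..\<xi>}"
    by (rule linorder_inj_onI) (use Gmono in force)+
  define l where "l = G \<xi>"
  have G0: "G 0 = 0" by (simp add: G_def)
  have l: "l > 0" using Gmono[of 0 \<xi>] \<xi> G0 by (simp add: l_def)
  have Gle: "0 \<le> G x" "G x \<le> l" if "x \<in> {0..\<xi>}" for x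
    using Gmono[of 0 x] Gmono[of x \<xi>] that G0 by (force simp: l_def le_less)+
  have imG: "G ` {0..\<xi>} = {0..l}"
  proof
    show "G ` {0..\<xi>} \<subseteq> {0..l}" using Gle by auto
    show "{0..l} \<subseteq> G ` {0..\<xi>}"
    proof
      fix y assume "y \<in> {0..l}"
      then obtain x where "0 \<le> x" "x \<le> \<xi>" "G x = y"
        using IVT'[of G 0 y \<xi>, OF _ _ _ contG] G0 \<xi> by (auto simp: l_def)
      then show "y \<in> G ` {0..\<xi>}" by auto
    qed
  qed
  define H where "H = the_inv_into {0..\<xi>} G"
  have HG: "H (G x) = x" if "x \<in> {0..\<xi>}" for x
    unfolding H_def by (rule the_inv_into_f_f[OF injG that])
  have GH: "G (H y) = y" "H y \<in> {0..\<xi>}" if "y \<in> {0..l}" for y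
    using f_the_inv_into_f[OF injG, of y] the_inv_into_into[OF injG, of y "{0..\<xi>}"] that imG
    by (auto simp: H_def)
  have contH: "continuous_on {0..l} H"
    using continuous_on_inv[OF contG compact_Icc, of H] HG imG by auto
  have Hin: "0 < H y" "H y < \<xi>" if "0 < y" "y < l" for y
    using GH[of y] that G0 by (force simp: l_def le_less)+
  have dH: "(H has_real_derivative inverse (v (H y))) (at y)" if y: "0 < y" "y < l" for y
  proof (rule DERIV_inverse_function[where f = G and a = 0 and b = l])
    show "(G has_real_derivative v (H y)) (at (H y))" using dG Hin[OF y] by auto
    show "v (H y) \<noteq> 0" using v[of "H y"] Hin[OF y] by auto
    show "isCont H y" using continuous_on_interior[OF contH, of y] y by auto
  qed (use y GH in auto)
  define L where "L = t0 + l"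
  define \<gamma> where "\<gamma> t = (if t \<le> t0 then t *\<^sub>R unit_vec \<theta> else curve \<tau> (H (L - t)))" for t
  have join: "curve \<tau> (H (L - t0)) = t0 *\<^sub>R unit_vec \<theta>"
    using curve_at_deployment(2)[where \<tau> = \<tau>, OF \<theta> end_value] HG[of \<xi>] \<xi> by (simp add: L_def l_def t0_def \<xi>_def)
  have cont_curve: "continuous_on {0..\<xi>} (curve \<tau>)"
    unfolding curve_def[abs_def] by (intro continuous_intros continuous_on_subset[OF cont\<tau> sub])
  have cont_arc: "continuous_on {t0..L} (\<lambda>t. curve \<tau> (H (L - t)))"
  proof (rule continuous_on_compose2[OF cont_curve])
    show "continuous_on {t0..L} (\<lambda>t. H (L - t))"
      by (rule continuous_on_compose2[OF contH]) (auto intro!: continuous_intros simp: L_def)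
  qed (use GH in \<open>auto simp: L_def\<close>)
  have cont\<gamma>: "continuous_on {0..L} \<gamma>"
    unfolding \<gamma>_def
  proof (rule continuous_on_cases_1)
    show "continuous_on {t \<in> {0..L}. t \<le> t0} (\<lambda>t. t *\<^sub>R unit_vec \<theta>)" by (intro continuous_intros)
    show "continuous_on {t \<in> {0..L}. t0 \<le> t} (\<lambda>t. curve \<tau> (H (L - t)))"
      by (rule continuous_on_subset[OF cont_arc]) auto
  qed (use join in simp)
  have d\<gamma>: "\<exists>w. (\<gamma> has_vector_derivative w) (at t within {0..L}) \<and> norm w = 1"
    if t: "t \<in> {0..L} - {0, t0, L}" for t
  proof (cases "t < t0")
    case True
    have "((\<lambda>t. t *\<^sub>R unit_vec \<theta>) has_vector_derivative unit_vec \<theta>) (at t)"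
      by (auto intro!: derivative_eq_intros)
    then have "(\<gamma> has_vector_derivative unit_vec \<theta>) (at t)"
      by (rule has_vector_derivative_transform_within_open[of _ _ _ "{..<t0}"]) (use True in \<open>auto simp: \<gamma>_def\<close>)
    then show ?thesis using has_vector_derivative_at_within norm_unit_vec by blast
  next
    case False
    then have t': "t0 < t" "t < L" using t by auto
    define x where "x = H (L - t)"
    have x: "0 < x" "x < \<xi>" unfolding x_def using Hin[of "L - t"] t' by (auto simp: L_def)
    have vx: "v x > 0" using v x by auto
    have "(H has_real_derivative inverse (v x)) (at (L - t))"
      unfolding x_def using t' by (intro dH) (auto simp: L_def)
    moreover have "((\<lambda>t. L - t) has_real_derivative -1) (at t)" by (auto intro!: derivative_eq_intros)
    ultimately have "((\<lambda>t. H (L - t)) has_real_derivative inverse (v x) * (-1)) (at t)"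
      by (rule DERIV_chain2)
    then have 1: "((\<lambda>t. H (L - t)) has_vector_derivative - inverse (v x)) (at t)"
      by (simp add: has_real_derivative_iff_has_vector_derivative)
    have "at x within {0..1} = at x" using x \<xi> by (intro at_within_interior) auto
    then have "(\<tau> has_real_derivative 2*pi * (\<tau> x * cot (\<psi> x) - 1)) (at x)" using \<tau>[of x] x \<xi> by auto
    from deriv_curve[OF this] have 2: "(curve \<tau> has_vector_derivative v x *\<^sub>R unit_vec (3*pi/2 - 2*pi*x - \<psi> x)) (at (H (L - t)))"
      using sin\<psi>[of x] x \<xi> by (auto simp: v_def x_def)
    have "((\<lambda>t. curve \<tau> (H (L - t))) has_vector_derivative
        (- inverse (v x)) *\<^sub>R v x *\<^sub>R unit_vec (3*pi/2 - 2*pi*x - \<psi> x)) (at t)"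
      using vector_diff_chain_at[OF 1 2] by (simp add: o_def)
    then have "(\<gamma> has_vector_derivative (- inverse (v x)) *\<^sub>R v x *\<^sub>R unit_vec (3*pi/2 - 2*pi*x - \<psi> x)) (at t)"
      by (rule has_vector_derivative_transform_within_open[of _ _ _ "{t0<..}"]) (use t' in \<open>auto simp: \<gamma>_def\<close>)
    moreover have "norm ((- inverse (v x)) *\<^sub>R v x *\<^sub>R unit_vec (3*pi/2 - 2*pi*x - \<psi> x)) = 1"
      using vx by simp
    ultimately show ?thesis using has_vector_derivative_at_within by blast
  qed
  have L0: "L > 0" using t0 l by (simp add: L_def)
  \<comment> \<open>Points at angles in [0, 2 * \<theta>] are seen from the segment, the others from
    the curve. The times given need not be the first ones, since an upper bound for the inspection
    time is enough.\<close>
  have seen1: "\<exists>t\<in>{0..L}. t = 1 / cos (\<phi> - \<theta>) \<and> 1 \<le> \<gamma> t \<bullet> unit_vec \<phi>" if \<phi>: "\<phi> \<in> {0..2*\<theta>}" for \<phi>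
  proof -
    have "cos \<theta> \<le> cos \<bar>\<phi> - \<theta>\<bar>" using \<phi> \<theta> by (intro cos_monotone_0_pi_le) auto
    then have c': "cos \<theta> \<le> cos (\<phi> - \<theta>)" by simp
    then have "1 / cos (\<phi> - \<theta>) \<le> t0" "0 < cos (\<phi> - \<theta>)" using c by (auto simp: t0_def frac_le)
    moreover have "cos (\<theta> - \<phi>) = cos (\<phi> - \<theta>)" by (metis cos_minus minus_diff_eq)
    ultimately show ?thesis using l by (auto simp: \<gamma>_def inner_unit_vec L_def)
  qed
  have seen2: "\<exists>t\<in>{0..L}. t = L - G (1 - \<phi>/(2*pi)) \<and> 1 \<le> \<gamma> t \<bullet> unit_vec \<phi>" if \<phi>: "\<phi> \<in> {2*\<theta>..2*pi}" for \<phi>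
  proof -
    define x where "x = 1 - \<phi>/(2*pi)"
    have x: "x \<in> {0..\<xi>}" using \<phi> by (auto simp: x_def \<xi>_def field_simps)
    have \<phi>x: "\<phi> = 2 * pi * (1 - x)" by (simp add: x_def)
    have "\<gamma> (L - G x) = curve \<tau> x"
    proof (cases "L - G x \<le> t0")
      case True
      then have "G x = l" using Gle[OF x] by (simp add: L_def)
      then have "L - G x = t0" "L - t0 = G x" by (simp_all add: L_def)
      then show ?thesis using join HG[OF x] by (simp only: \<gamma>_def order_refl if_True)
    next
      case False
      then show ?thesis using HG[OF x] by (simp add: \<gamma>_def)
    qed
    moreover have "curve \<tau> x \<bullet> unit_vec \<phi> = 1" unfolding \<phi>x by (rule curve_on_tangent)
    moreover have "L - G x \<in> {0..L}" using Gle[OF x] t0 by (auto simp: L_def)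
    ultimately show ?thesis by (auto simp: x_def)
  qed
  have ins: "inspective_trajectory \<gamma> L"
    unfolding inspective_trajectory_def
  proof (intro conjI)
    show "0 \<le> L" using L0 by simp
    show "\<gamma> 0 = 0" using t0 by (simp add: \<gamma>_def)
    show "\<gamma> piecewise_differentiable_on {0..L}"
      unfolding piecewise_differentiable_on_def
    proof (intro conjI cont\<gamma> exI[of _ "{0, t0, L}"] ballI)
      fix t assume "t \<in> {0..L} - {0, t0, L}"
      from d\<gamma>[OF this] show "\<gamma> differentiable at t within {0..L}" by (blast intro: differentiableI_vector)
    qed simp
    show "\<exists>S. finite S \<and> (\<forall>t\<in>{0..L} - S. norm (vector_derivative \<gamma> (at t within {0..L})) = 1)"
    proof (intro exI[of _ "{0, t0, L}"] conjI ballI)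
      fix t assume t: "t \<in> {0..L} - {0, t0, L}"
      obtain w where w: "(\<gamma> has_vector_derivative w) (at t within {0..L})" "norm w = 1" using d\<gamma>[OF t] by auto
      moreover have "vector_derivative \<gamma> (at t within {0..L}) = w"
        using L0 t w(1) by (intro vector_derivative_within_cbox[of 0 L, simplified]) auto
      ultimately show "norm (vector_derivative \<gamma> (at t within {0..L})) = 1" by simp
    qed simp
    show "cball 0 1 \<subseteq> convex hull (\<gamma> ` {0..L})"
    proof (subst cball_subset_hull_iff)
      show "compact (\<gamma> ` {0..L})" by (intro compact_continuous_image cont\<gamma>) auto
      show "\<forall>P. norm P = 1 \<longrightarrow> (\<exists>x\<in>\<gamma> ` {0..L}. 1 \<le> x \<bullet> P)"
      proof (intro allI impI)
        fix P :: plane assume P: "norm P = 1"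
        then have "(fst P)\<^sup>2 + (snd P)\<^sup>2 = 1" by (cases P) (simp add: norm_Pair)
        then obtain \<phi> where \<phi>: "0 \<le> \<phi>" "\<phi> < 2*pi" "fst P = cos \<phi>" "snd P = sin \<phi>"
          by (rule sincos_total_2pi)
        then have "P = unit_vec \<phi>" by (simp add: unit_vec_def prod_eq_iff)
        then show "\<exists>x\<in>\<gamma> ` {0..L}. 1 \<le> x \<bullet> P"
          using seen1[of \<phi>] seen2[of \<phi>] \<phi> by (cases "\<phi> \<le> 2*\<theta>") auto
      qed
    qed
  qed
  let ?I = "\<lambda>\<phi>. inspection_time \<gamma> L (unit_vec \<phi>)"
  note int = avg_cost_eq_integral[OF ins]
  have le: "?I \<phi> \<le> t" if "t \<in> {0..L}" "1 \<le> \<gamma> t \<bullet> unit_vec \<phi>" for t \<phi>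
    using that by (intro inspection_time_le) (auto simp: inspects_iff)
  have I1: "integral {0..2*\<theta>} ?I \<le> ln ((1 + sin \<theta>) / (1 - sin \<theta>))"
  proof (rule has_integral_le)
    show "(?I has_integral integral {0..2*\<theta>} ?I) {0..2*\<theta>}"
      using \<theta> by (intro integrable_integral integrable_subinterval_real[OF int(1)]) auto
    show "((\<lambda>\<phi>. 1 / cos (\<phi> - \<theta>)) has_integral ln ((1 + sin \<theta>) / (1 - sin \<theta>))) {0..2*\<theta>}"
      by (rule has_integral_sec[OF \<theta>])
    fix \<phi> assume "\<phi> \<in> {0..2*\<theta>}"
    then show "?I \<phi> \<le> 1 / cos (\<phi> - \<theta>)" using seen1[of \<phi>] le by auto
  qed
  \<comment> \<open>An antiderivative of \<open>L - G x\<close>, found by parts: the terms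
    \<open>x * v x\<close> cancel. It brings in the weighted arc length that appears in
    \<open>total_cost\<close>.\<close>
  define J where "J x = x * (L - G x) + integral {0..x} (\<lambda>y. y * v y)" for x
  have I2: "integral {2*\<theta>..2*pi} ?I \<le> (- 2*pi * J (1 - 2*pi/(2*pi))) - (- 2*pi * J (1 - 2*\<theta>/(2*pi)))"
  proof (rule has_integral_le)
    show "(?I has_integral integral {2*\<theta>..2*pi} ?I) {2*\<theta>..2*pi}"
      using \<theta> by (intro integrable_integral integrable_subinterval_real[OF int(1)]) auto
    have contxv: "continuous_on {0..\<xi>} (\<lambda>y. y * v y)" by (intro continuous_intros contv)
    have "continuous_on {0..\<xi>} J"
      unfolding J_def by (intro continuous_intros contG indefinite_integral_continuous_1 integrable_continuous_interval contxv)
    then have "continuous_on {2*\<theta>..2*pi} (\<lambda>\<phi>. J (1 - \<phi>/(2*pi)))"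
    proof (rule continuous_on_compose2)
      show "(\<lambda>\<phi>. 1 - \<phi>/(2*pi)) ` {2*\<theta>..2*pi} \<subseteq> {0..\<xi>}"
        by (auto simp: \<xi>_def field_simps)
    qed (intro continuous_intros; simp)
    then have contJ: "continuous_on {2*\<theta>..2*pi} (\<lambda>\<phi>. - 2*pi * J (1 - \<phi>/(2*pi)))"
      by (intro continuous_on_mult_left)
    show "((\<lambda>\<phi>. L - G (1 - \<phi>/(2*pi))) has_integral
        (- 2*pi * J (1 - 2*pi/(2*pi))) - (- 2*pi * J (1 - 2*\<theta>/(2*pi)))) {2*\<theta>..2*pi}"
    proof (rule fundamental_theorem_of_calculus_interior[OF _ contJ])
      fix \<phi> assume \<phi>: "\<phi> \<in> {2*\<theta><..<2*pi}"
      define x where "x = 1 - \<phi>/(2*pi)"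
      have x: "0 < x" "x < \<xi>" using \<phi> by (auto simp: x_def \<xi>_def field_simps)
      have "((\<lambda>x. integral {0..x} (\<lambda>y. y * v y)) has_real_derivative x * v x) (at x within {0..\<xi>})"
        by (rule integral_has_real_derivative[OF contxv]) (use x in auto)
      moreover have "at x within {0..\<xi>} = at x" using x by (intro at_within_interior) auto
      ultimately have d1: "((\<lambda>x. integral {0..x} (\<lambda>y. y * v y)) has_real_derivative x * v x) (at x)" by simp
      have "(J has_real_derivative (1 * (L - G x) + (0 - v x) * x) + x * v x) (at x)"
        unfolding J_def[abs_def] by (intro DERIV_add DERIV_mult DERIV_diff DERIV_const DERIV_ident dG x d1)
      then have dJ: "(J has_real_derivative L - G x) (at (1 - \<phi>/(2*pi)))" by (simp add: x_def)
      have "((\<lambda>\<phi>. 1 - \<phi>/(2*pi)) has_real_derivative - 1/(2*pi)) (at \<phi>)"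
        by (auto intro!: derivative_eq_intros)
      from DERIV_cmult[OF DERIV_chain2[where f = J, OF dJ this], of "- 2*pi"]
      show "((\<lambda>\<phi>. - 2*pi * J (1 - \<phi>/(2*pi))) has_vector_derivative L - G (1 - \<phi>/(2*pi))) (at \<phi>)"
        by (simp add: has_real_derivative_iff_has_vector_derivative x_def)
    qed (use \<theta> in auto)
    fix \<phi> assume "\<phi> \<in> {2*\<theta>..2*pi}"
    then show "?I \<phi> \<le> L - G (1 - \<phi>/(2*pi))" using seen2[of \<phi>] le by auto
  qed
  have "(- 2*pi * J (1 - 2*pi/(2*pi))) - (- 2*pi * J (1 - 2*\<theta>/(2*pi))) = 2*pi * J \<xi>"
    by (simp add: \<xi>_def J_def)
  also have "J \<xi> = \<xi> * t0 + integral {0..\<xi>} (\<lambda>y. y * v y)" by (simp add: J_def L_def l_def)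
  finally have I2': "integral {2*\<theta>..2*pi} ?I \<le> 2*pi * (\<xi> * t0 + integral {0..\<xi>} (\<lambda>y. y * v y))"
    using I2 by simp
  have "integral {0..2*pi} ?I = integral {0..2*\<theta>} ?I + integral {2*\<theta>..2*pi} ?I"
    using \<theta> by (intro Henstock_Kurzweil_Integration.integral_combine[symmetric] int(1)) auto
  then have "avg_cost \<gamma> L \<le> 1 / (2*pi) * (ln ((1 + sin \<theta>) / (1 - sin \<theta>)) + 2*pi * (\<xi> * t0 + integral {0..\<xi>} (\<lambda>y. y * v y)))"
    unfolding int(2) using I1 I2' by (intro mult_left_mono) auto
  also have "\<dots> = total_cost \<xi> \<psi> \<tau>"
  proof -
    have "integral {0..\<xi>} (\<lambda>y. y * v y) = integral {0..\<xi>} (\<lambda>x. 2*pi * (x * \<tau> x / sin (\<psi> x)))"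
      by (intro integral_cong) (simp add: v_def)
    also have "\<dots> = 2*pi * integral {0..\<xi>} (\<lambda>x. x * \<tau> x / sin (\<psi> x))" by (rule integral_mult_right)
    finally have 1: "integral {0..\<xi>} (\<lambda>y. y * v y) = 2*pi * integral {0..\<xi>} (\<lambda>x. x * \<tau> x / sin (\<psi> x))" .
    have 2: "sin (\<xi> * pi) = sin \<theta>" "cos ((1 - \<xi>) * pi) = cos \<theta>"
      by (simp_all add: \<xi>_def algebra_simps)
    show ?thesis
      unfolding total_cost_def 1 2 by (simp add: t0_def distrib_left)
  qed
  finally show ?thesis
    using optimal_cost_le[OF ins] by (simp add: \<xi>_def)
qed

section \<open>Paths outside the disk\<close>

text \<open>If \<open>f\<close> lost more than \<open>k * (s - p)\<close>, the last point at which
  the loss is within this bound would contradict the Dini estimate there. The estimate is asked for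
  on the open interval only; continuity adds the left end.\<close>

lemma dini_nondecreasing:
  fixes f :: "real \<Rightarrow> real"
  assumes ab: "a \<le> b" and cont: "continuous_on {a..b} f"
    and dini: "\<And>t e. a < t \<Longrightarrow> t < b \<Longrightarrow> 0 < e \<Longrightarrow>
      \<exists>d>0. \<forall>s. t < s \<and> s < t + d \<and> s \<le> b \<longrightarrow> - (e * (s - t)) \<le> f s - f t"
  shows "f a \<le> f b"
proof -
  have inner: "f p \<le> f b" if p: "a < p" "p \<le> b" for p
  proof (rule field_le_epsilon)
    fix e :: real assume e: "0 < e"
    define k where "k = e / (b - p + 1)"
    have k: "k > 0" "k * (b - p) \<le> e" using e p by (auto simp: k_def field_simps)
    let ?g = "\<lambda>s. f p - f s - k * (s - p)"
    have "?g b \<le> 0"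
    proof (rule ccontr)
      assume "\<not> ?g b \<le> 0"
      then have gb: "0 < ?g b" by simp
      have "continuous_on {p..b} ?g"
        using p by (intro continuous_intros continuous_on_subset[OF cont]) auto
      from last_below[OF this p(2) _ gb] obtain x where x: "p \<le> x" "x < b" "?g x \<le> 0"
        and above: "\<And>y. x < y \<Longrightarrow> y \<le> b \<Longrightarrow> 0 < ?g y" by auto
      obtain d where d: "d > 0" "\<And>s. x < s \<Longrightarrow> s < x + d \<Longrightarrow> s \<le> b \<Longrightarrow> - (k * (s - x)) \<le> f s - f x"
        using dini[of x k] x p k by auto
      define s where "s = min b (x + d/2)"
      have s: "x < s" "s < x + d" "s \<le> b" using x d by (auto simp: s_def)
      have "?g s \<le> ?g x" using d(2)[OF s] by (simp add: algebra_simps)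
      then show False using above[OF s(1,3)] x by simp
    qed
    then show "f p \<le> f b + e" using k by linarith
  qed
  show ?thesis
  proof (cases "a = b")
    case False
    with ab have ab': "a < b" by simp
    show ?thesis
    proof (rule ccontr)
      assume "\<not> f a \<le> f b"
      then have pos: "0 < f a - f b" by simp
      obtain d where d: "d > 0" "\<And>x. x \<in> {a..b} \<Longrightarrow> dist x a < d \<Longrightarrow> dist (f x) (f a) < f a - f b"
        using cont[unfolded continuous_on_iff, rule_format, of a "f a - f b"] ab pos by auto
      define x where "x = min b (a + d/2)"
      have x: "a < x" "x \<le> b" "dist x a < d" using ab' d by (auto simp: x_def dist_real_def)
      then show False using d(2)[of x] inner[of x] by (auto simp: dist_real_def)
    qed
  qed simp
qed

section \<open>Running maxima\<close>

definition run_max :: "(real \<Rightarrow> real) \<Rightarrow> real \<Rightarrow> real \<Rightarrow> real" where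
  "run_max f a t = Sup (f ` {a..t})"

context
  fixes f :: "real \<Rightarrow> real" and a b :: real
  assumes cont: "continuous_on {a..b} f"
begin

lemma run_max_bdd: "t \<le> b \<Longrightarrow> bdd_above (f ` {a..t})"
  by (intro bounded_imp_bdd_above compact_imp_bounded compact_continuous_image
      continuous_on_subset[OF cont]) auto

lemma run_max_ge: "s \<in> {a..t} \<Longrightarrow> t \<le> b \<Longrightarrow> f s \<le> run_max f a t"
  unfolding run_max_def by (intro cSup_upper run_max_bdd) auto

lemma run_max_attained:
  assumes "t \<in> {a..b}"
  obtains s where "s \<in> {a..t}" "run_max f a t = f s"
proof -
  have "run_max f a t \<in> f ` {a..t}"
    unfolding run_max_def
    by (intro closed_contains_Sup run_max_bdd compact_imp_closed compact_continuous_image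
        continuous_on_subset[OF cont]) (use assms in auto)
  then show thesis using that by auto
qed

lemma run_max_le: "t \<in> {a..b} \<Longrightarrow> (\<And>s. s \<in> {a..t} \<Longrightarrow> f s \<le> c) \<Longrightarrow> run_max f a t \<le> c"
  by (metis run_max_attained)

lemma run_max_mono: "a \<le> s \<Longrightarrow> s \<le> t \<Longrightarrow> t \<le> b \<Longrightarrow> run_max f a s \<le> run_max f a t"
  by (intro run_max_le run_max_ge) auto

lemma run_max_const:
  assumes "a \<le> s" "s \<le> t" "t \<le> b" and le: "\<And>x. x \<in> {s..t} \<Longrightarrow> f x \<le> run_max f a s"
  shows "run_max f a t = run_max f a s"
proof (rule antisym)
  show "run_max f a t \<le> run_max f a s"
  proof (rule run_max_le)
    fix x assume "x \<in> {a..t}"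
    then show "f x \<le> run_max f a s" using le[of x] run_max_ge[of x s] assms by (cases "x \<le> s") auto
  qed (use assms in auto)
qed (use assms in \<open>auto intro: run_max_mono\<close>)

text \<open>A new value of the running maximum is taken by \<open>f\<close> itself, and not before
  \<open>s\<close>. For the end of the inspected arc: a direction newly inspected between
  \<open>s\<close> and \<open>t\<close> has its tangent touched at a time in
  \<open>{s..t}\<close>.\<close>

lemma run_max_ivt:
  assumes st: "a \<le> s" "s \<le> t" "t \<le> b" and y: "run_max f a s < y" "y \<le> run_max f a t"
  obtains x where "x \<in> {s..t}" "f x = y"
proof -
  obtain z where z: "z \<in> {a..t}" "run_max f a t = f z" using run_max_attained[of t] st by auto
  have sz: "s < z" using run_max_ge[of z s] y z st by (cases "z \<le> s") auto
  have "f s \<le> y" using run_max_ge[of s s] y st by auto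
  then obtain x where "s \<le> x" "x \<le> z" "f x = y"
    using IVT'[of f s y z] y z sz st continuous_on_subset[OF cont, of "{s..z}"] by auto
  then show thesis using that[of x] z by auto
qed

lemma continuous_on_run_max: "continuous_on {a..b} (run_max f a)"
  unfolding continuous_on_iff
proof (intro ballI allI impI)
  fix t e :: real assume t: "t \<in> {a..b}" and e: "0 < e"
  have "uniformly_continuous_on {a..b} f"
    by (intro compact_uniformly_continuous cont compact_Icc)
  then obtain d where d: "d > 0" "\<And>x y. x \<in> {a..b} \<Longrightarrow> y \<in> {a..b} \<Longrightarrow> dist y x < d \<Longrightarrow> dist (f y) (f x) < e"
    using e unfolding uniformly_continuous_on_def by blast
  have *: "run_max f a y < run_max f a x + e" if xy: "x \<in> {a..b}" "y \<in> {a..b}" "x \<le> y" "y - x < d" for x y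
  proof -
    obtain z where z: "z \<in> {a..y}" "run_max f a y = f z" using run_max_attained[of y] xy by auto
    show ?thesis
    proof (cases "z \<le> x")
      case True
      then show ?thesis using z run_max_ge[of z x] xy e by auto
    next
      case False
      then have "dist (f z) (f x) < e" using z xy by (intro d(2)) (auto simp: dist_real_def)
      then show ?thesis using z run_max_ge[of x x] xy by (auto simp: dist_real_def)
    qed
  qed
  show "\<exists>d>0. \<forall>x'\<in>{a..b}. dist x' t < d \<longrightarrow> dist (run_max f a x') (run_max f a t) < e"
  proof (intro exI[of _ d] conjI ballI impI d(1))
    fix x assume x: "x \<in> {a..b}" "dist x t < d"
    show "dist (run_max f a x) (run_max f a t) < e"
    proof (cases "x \<le> t")
      case True
      then show ?thesis using *[of x t] run_max_mono[of x t] x t by (auto simp: dist_real_def)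
    next
      case False
      then show ?thesis using *[of t x] run_max_mono[of t x] x t by (auto simp: dist_real_def)
    qed
  qed
qed

end

lemma run_max_start [simp]: "run_max f a a = f a"
  by (simp add: run_max_def)

context steering_angle
begin

definition optimal_half_angle :: real where
  "optimal_half_angle = (SOME hs. pi/6 \<le> hs \<and> hs < pi/2 \<and> 3 * hs = pi/2 + \<psi> (1 - hs/pi) \<and>
    (\<forall>a b. 0 < a \<longrightarrow> a < b \<longrightarrow> b \<le> hs \<longrightarrow> phase_cost b < phase_cost a) \<and>
    (\<forall>a b. hs \<le> a \<longrightarrow> a < b \<longrightarrow> b < pi/2 \<longrightarrow> phase_cost a < phase_cost b))"

lemma optimal_half_angle:
  shows "pi/6 \<le> optimal_half_angle" "optimal_half_angle < pi/2"
    and "3 * optimal_half_angle = pi/2 + \<psi> (1 - optimal_half_angle/pi)"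
    and phase_cost_decreasing: "\<And>a b. 0 < a \<Longrightarrow> a < b \<Longrightarrow> b \<le> optimal_half_angle \<Longrightarrow> phase_cost b < phase_cost a"
    and phase_cost_increasing: "\<And>a b. optimal_half_angle \<le> a \<Longrightarrow> a < b \<Longrightarrow> b < pi/2 \<Longrightarrow> phase_cost a < phase_cost b"
proof -
  have "\<exists>hs. pi/6 \<le> hs \<and> hs < pi/2 \<and> 3 * hs = pi/2 + \<psi> (1 - hs/pi) \<and>
    (\<forall>a b. 0 < a \<longrightarrow> a < b \<longrightarrow> b \<le> hs \<longrightarrow> phase_cost b < phase_cost a) \<and>
    (\<forall>a b. hs \<le> a \<longrightarrow> a < b \<longrightarrow> b < pi/2 \<longrightarrow> phase_cost a < phase_cost b)"
    using optimal_half_angle_exists by metis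
  note someI_ex[OF this, folded optimal_half_angle_def]
  then show "pi/6 \<le> optimal_half_angle" "optimal_half_angle < pi/2"
    "3 * optimal_half_angle = pi/2 + \<psi> (1 - optimal_half_angle/pi)"
    "\<And>a b. 0 < a \<Longrightarrow> a < b \<Longrightarrow> b \<le> optimal_half_angle \<Longrightarrow> phase_cost b < phase_cost a"
    "\<And>a b. optimal_half_angle \<le> a \<Longrightarrow> a < b \<Longrightarrow> b < pi/2 \<Longrightarrow> phase_cost a < phase_cost b"
    by blast+
qed

text \<open>What can still be gained, at half-angle \<open>h\<close>, by prolonging the deployment.\<close>

definition surplus :: "real \<Rightarrow> real" where
  "surplus h = phase_cost (min h optimal_half_angle) - phase_cost optimal_half_angle"

lemma surplus_antimono: "0 < a \<Longrightarrow> a \<le> b \<Longrightarrow> surplus b \<le> surplus a"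
  unfolding surplus_def
  using phase_cost_decreasing[of "min a optimal_half_angle" "min b optimal_half_angle"] optimal_half_angle(1) pi_gt_zero
  by (cases "min a optimal_half_angle = min b optimal_half_angle") (auto simp: min_def split: if_splits)

lemma surplus_strict: "0 < a \<Longrightarrow> a < optimal_half_angle \<Longrightarrow> a < b \<Longrightarrow> surplus b < surplus a"
  unfolding surplus_def
  using phase_cost_decreasing[of "min a optimal_half_angle" "min b optimal_half_angle"] optimal_half_angle(1) pi_gt_zero
  by (auto simp: min_def split: if_splits)

text \<open>The reason for the form of \<open>surplus\<close>: subtracting it replaces
  \<open>phase_cost\<close> by a function that is constant up to the minimizer and increasing
  beyond, hence monotone in the half-angle.\<close>

lemma phase_cost_minus_surplus: "phase_cost h - surplus h = phase_cost (max h optimal_half_angle)"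
  by (auto simp: surplus_def min_def max_def)

lemma phase_cost_max_mono:
  assumes "a \<le> b" "b < pi/2"
  shows "phase_cost (max a optimal_half_angle) \<le> phase_cost (max b optimal_half_angle)"
  using phase_cost_increasing[of "max a optimal_half_angle" "max b optimal_half_angle"] assms optimal_half_angle(2)
  by (cases "max a optimal_half_angle = max b optimal_half_angle") (auto simp: max_def split: if_splits)

end

text \<open>The inspection phase in polar coordinates, angle 0 being the deployment direction. From
  (r, al) one inspects the directions within \<open>arccos (1 / r)\<close> of \<open>al\<close>, so
  the running maxima give the two ends of the inspected arc, the lower one with reversed sign. They
  may start at \<open>t0\<close> because the end of the segment sees all that the segment has
  seen.\<close>

locale outer_path = steering_angle +
  fixes t0 T \<theta> :: real and al r :: "real \<Rightarrow> real"
  assumes \<theta>: "0 < \<theta>" "\<theta> < pi/2" and t0: "t0 = 1 / cos \<theta>" and t0T: "t0 < T"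
    and cont_al: "continuous_on {t0..T} al" and cont_r: "continuous_on {t0..T} r"
    and r_gt: "\<And>t. t \<in> {t0..T} \<Longrightarrow> 1 < r t"
    and al_start: "al t0 = 0" and r_start: "r t0 = t0"
    and lipschitz: "\<And>s t. s \<in> {t0..T} \<Longrightarrow> t \<in> {t0..T} \<Longrightarrow>
      norm (r t *\<^sub>R unit_vec (al t) - r s *\<^sub>R unit_vec (al s)) \<le> \<bar>t - s\<bar>"
    and incomplete: "\<And>t. t0 \<le> t \<Longrightarrow> t < T \<Longrightarrow>
      run_max (\<lambda>s. al s + arccos (1 / r s)) t0 t + run_max (\<lambda>s. - al s + arccos (1 / r s)) t0 t < 2 * pi"
    and complete:
      "run_max (\<lambda>s. al s + arccos (1 / r s)) t0 T + run_max (\<lambda>s. - al s + arccos (1 / r s)) t0 T = 2 * pi"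
begin

text \<open>\<open>bet\<close> is the half-angle of the arc visible from \<open>pos\<close>;
  \<open>lo\<close> and \<open>hi\<close> are the ends of the inspected arc, \<open>half\<close> is
  its half-angle and \<open>u\<close> the uninspected fraction. \<open>off\<close> is the signed
  angle between \<open>pos\<close> and the axis of the inspected arc. At a tip the whole inspected
  arc is visible at once.\<close>

definition pos :: "real \<Rightarrow> plane" where "pos t = r t *\<^sub>R unit_vec (al t)"
definition bet :: "real \<Rightarrow> real" where "bet t = arccos (1 / r t)"
definition hi :: "real \<Rightarrow> real" where "hi t = run_max (\<lambda>s. al s + arccos (1 / r s)) t0 t"
definition lo :: "real \<Rightarrow> real" where "lo t = - run_max (\<lambda>s. - al s + arccos (1 / r s)) t0 t"
definition half :: "real \<Rightarrow> real" where "half t = (hi t - lo t) / 2"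
definition u :: "real \<Rightarrow> real" where "u t = 1 - half t / pi"
definition off :: "real \<Rightarrow> real" where "off t = al t - (hi t + lo t) / 2"
definition tip :: "real \<Rightarrow> bool" where "tip t \<longleftrightarrow> bet t = half t"

text \<open>Reflection in the deployment line exchanges \<open>hi\<close> and \<open>- lo\<close>,
  so every estimate for the upper side gives the one for the lower side.\<close>

lemma mirror: "outer_path \<psi> t0 T \<theta> (\<lambda>t. - al t) r"
proof (unfold_locales)
  show "continuous_on {t0..T} (\<lambda>t. - al t)" by (intro continuous_intros cont_al)
  fix s t assume "s \<in> {t0..T}" "t \<in> {t0..T}"
  then have "norm (r t *\<^sub>R unit_vec (al t) - r s *\<^sub>R unit_vec (al s)) \<le> \<bar>t - s\<bar>" by (rule lipschitz)
  moreover have "norm (r t *\<^sub>R unit_vec (- al t) - r s *\<^sub>R unit_vec (- al s)) = norm (r t *\<^sub>R unit_vec (al t) - r s *\<^sub>R unit_vec (al s))"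
    by (simp add: unit_vec_def norm_Pair power2_commute)
  ultimately show "norm (r t *\<^sub>R unit_vec (- al t) - r s *\<^sub>R unit_vec (- al s)) \<le> \<bar>t - s\<bar>" by simp
qed (use \<theta> t0 t0T cont_r r_gt al_start r_start incomplete complete in \<open>simp_all add: add.commute\<close>)

lemma t0_le: "t0 \<le> T" using t0T by simp

lemma t0_pos: "0 < t0"
proof -
  have "cos \<theta> > 0" using \<theta> by (intro cos_gt_zero_pi) auto
  then show ?thesis by (simp add: t0)
qed

lemma bet_bounds:
  assumes "t \<in> {t0..T}"
  shows "0 < bet t" "bet t < pi/2" "cos (bet t) = 1 / r t" "r t * cos (bet t) = 1"
proof -
  have r: "1 < r t" by (rule r_gt[OF assms])
  then have b: "0 < 1 / r t" "1 / r t < 1" by auto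
  have "- 1 \<le> 1 / r t" "1 / r t \<le> 1" using b by linarith+
  then show c: "cos (bet t) = 1 / r t" unfolding bet_def by (rule cos_arccos)
  then show "r t * cos (bet t) = 1" using r by simp
  have "- 1 < 1 / r t" using b by linarith
  then show "0 < bet t" unfolding bet_def using b arccos_lt_bounded[of "1 / r t"] by blast
  have "arccos (1 / r t) < arccos 0" using b by (intro arccos_less_arccos) linarith+
  then show "bet t < pi/2" unfolding bet_def by simp
qed

lemma cont_bet: "continuous_on {t0..T} bet"
  unfolding bet_def
proof (intro continuous_on_arccos continuous_intros cont_r ballI)
  fix t assume "t \<in> {t0..T}"
  then have "1 < r t" by (rule r_gt)
  moreover from this have "0 < 1 / r t" "1 / r t < 1" by auto
  ultimately show "r t \<noteq> 0" "- 1 \<le> 1 / r t \<and> 1 / r t \<le> 1" by linarith+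
qed

lemma cont_upper: "continuous_on {t0..T} (\<lambda>s. al s + arccos (1 / r s))"
  using continuous_on_add[OF cont_al cont_bet] by (simp add: bet_def)

lemma cont_lower: "continuous_on {t0..T} (\<lambda>s. - al s + arccos (1 / r s))"
  using continuous_on_add[OF continuous_on_minus[OF cont_al] cont_bet] by (simp add: bet_def)

lemma cont_hi: "continuous_on {t0..T} hi"
  unfolding hi_def by (rule continuous_on_run_max[OF cont_upper])

lemma cont_lo: "continuous_on {t0..T} lo"
  unfolding lo_def by (intro continuous_intros continuous_on_run_max[OF cont_lower])

lemma cont_half: "continuous_on {t0..T} half"
  unfolding half_def by (intro continuous_intros cont_hi cont_lo) auto

lemma cont_u: "continuous_on {t0..T} u"
  unfolding u_def by (intro continuous_intros cont_half) auto

lemma cont_off: "continuous_on {t0..T} off"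
  unfolding off_def by (intro continuous_intros cont_hi cont_lo cont_al) auto

lemma cont_pos: "continuous_on {t0..T} pos"
  unfolding pos_def by (intro continuous_intros cont_al cont_r)

lemma hi_ge: "s \<in> {t0..t} \<Longrightarrow> t \<le> T \<Longrightarrow> al s + bet s \<le> hi t"
  unfolding hi_def bet_def by (rule run_max_ge[OF cont_upper])

lemma lo_le: "s \<in> {t0..t} \<Longrightarrow> t \<le> T \<Longrightarrow> lo t \<le> al s - bet s"
  unfolding lo_def bet_def using run_max_ge[OF cont_lower, of s t] by auto

lemma hi_mono: "t0 \<le> s \<Longrightarrow> s \<le> t \<Longrightarrow> t \<le> T \<Longrightarrow> hi s \<le> hi t"
  unfolding hi_def by (rule run_max_mono[OF cont_upper])

lemma lo_mono: "t0 \<le> s \<Longrightarrow> s \<le> t \<Longrightarrow> t \<le> T \<Longrightarrow> lo t \<le> lo s"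
  unfolding lo_def using run_max_mono[OF cont_lower, of s t] by simp

lemma half_mono: "t0 \<le> s \<Longrightarrow> s \<le> t \<Longrightarrow> t \<le> T \<Longrightarrow> half s \<le> half t"
  unfolding half_def using hi_mono[of s t] lo_mono[of s t] by simp

lemma u_antimono: "t0 \<le> s \<Longrightarrow> s \<le> t \<Longrightarrow> t \<le> T \<Longrightarrow> u t \<le> u s"
  unfolding u_def using half_mono[of s t] by (simp add: divide_right_mono)

lemma bet_start: "bet t0 = \<theta>"
  unfolding bet_def r_start using t0 \<theta> by (simp add: arccos_cos)

lemma hi_start: "hi t0 = \<theta>" and lo_start: "lo t0 = - \<theta>"
  using bet_start by (simp_all add: hi_def lo_def al_start bet_def)

lemma half_start: "half t0 = \<theta>"
  by (simp add: half_def hi_start lo_start)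

lemma tip_start: "tip t0"
  by (simp add: tip_def half_start bet_start)

lemma half_end: "half T = pi"
  using complete by (simp add: half_def hi_def lo_def)

lemma u_end: "u T = 0"
  by (simp add: u_def half_end)

lemma half_bounds: "t \<in> {t0..T} \<Longrightarrow> \<theta> \<le> half t \<and> half t \<le> pi"
  using half_mono[of t0 t] half_mono[of t T] by (auto simp: half_start half_end)

lemma half_less: "t0 \<le> t \<Longrightarrow> t < T \<Longrightarrow> half t < pi"
  using incomplete[of t] by (simp add: half_def hi_def lo_def)

lemma u_pos: "t0 \<le> t \<Longrightarrow> t < T \<Longrightarrow> 0 < u t"
  using half_less[of t] by (simp add: u_def)

lemma u_bounds: "t \<in> {t0..T} \<Longrightarrow> 0 \<le> u t \<and> u t \<le> 1"
  using half_bounds[of t] \<theta> by (auto simp: u_def)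

lemma u_in: "t \<in> {t0..T} \<Longrightarrow> u t \<in> {0..1}"
  using u_bounds[of t] by auto

lemma bet_le_half: "t \<in> {t0..T} \<Longrightarrow> bet t \<le> half t"
  using hi_ge[of t t] lo_le[of t t] by (simp add: half_def)

lemma pi_u: "pi * u t = pi - half t"
  by (simp add: u_def algebra_simps)

lemma hi_eq: "hi t = lo t + 2 * half t"
  by (simp add: half_def field_simps)

lemma inner_pos: "pos t \<bullet> unit_vec \<phi> = r t * cos (al t - \<phi>)"
  by (simp add: pos_def inner_unit_vec)

text \<open>The direction \<open>hi t\<close> is not in the interior of the visible arc, neither
  directly nor the other way round the circle, where \<open>half t \<le> pi\<close> is
  needed.\<close>

lemma not_beyond_hi:
  assumes t: "t \<in> {t0..T}"
  shows "pos t \<bullet> unit_vec (hi t) \<le> 1"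
proof -
  have "cos (hi t - al t) \<le> cos (bet t)"
  proof (rule cos_le_cos_outside)
    show "0 \<le> bet t" "bet t \<le> hi t - al t" using hi_ge[of t t] bet_bounds[OF t] t by auto
    show "hi t - al t \<le> 2 * pi - bet t" using lo_le[of t t] half_bounds[OF t] t by (auto simp: hi_eq)
  qed
  then have "r t * cos (hi t - al t) \<le> r t * cos (bet t)"
    using r_gt[OF t] by (intro mult_left_mono) auto
  moreover have "cos (al t - hi t) = cos (hi t - al t)" by (metis cos_minus minus_diff_eq)
  ultimately show ?thesis using bet_bounds[OF t] by (simp add: inner_pos)
qed

lemma pos_diff: "s \<in> {t0..T} \<Longrightarrow> t \<in> {t0..T} \<Longrightarrow> norm (pos t - pos s) \<le> \<bar>t - s\<bar>"
  unfolding pos_def by (rule lipschitz)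

lemma norm_pos: "t \<in> {t0..T} \<Longrightarrow> norm (pos t) = r t"
  using r_gt[of t] by (simp add: pos_def)

lemma r_diff: "s \<in> {t0..T} \<Longrightarrow> t \<in> {t0..T} \<Longrightarrow> \<bar>r t - r s\<bar> \<le> \<bar>t - s\<bar>"
  using norm_triangle_ineq3[of "pos t" "pos s"] pos_diff[of s t] by (simp add: norm_pos)

lemma tip_facts:
  assumes t: "t \<in> {t0..T}" and tip: "tip t"
  shows "off t = 0" "al t + bet t = hi t" "al t - bet t = lo t" "half t < pi/2" "r t = 1 / cos (half t)" "t < T"
proof -
  have 1: "al t + bet t \<le> hi t" "lo t \<le> al t - bet t" using hi_ge[of t t] lo_le[of t t] t by auto
  have 2: "2 * bet t = hi t - lo t" using tip by (simp add: tip_def half_def)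
  show "al t + bet t = hi t" "al t - bet t = lo t" using 1 2 by linarith+
  then show "off t = 0" by (simp add: off_def)
  show h: "half t < pi/2" using tip bet_bounds[OF t] by (simp add: tip_def)
  show "r t = 1 / cos (half t)" using tip bet_bounds[OF t] r_gt[OF t] by (simp add: tip_def)
  show "t < T" using h half_end t by (cases "t = T") auto
qed

definition dir_plus :: "real \<Rightarrow> plane" where
  "dir_plus t = unit_vec (hi t + pi/2 - \<psi> (u t))"

text \<open>The uninspected arc runs from \<open>hi t\<close> to \<open>lo t + 2 * pi\<close>. It is
  measured from its far end, which stays fixed while the path advances on the side of
  \<open>hi\<close>, so that only the second argument of \<open>W\<close> varies.\<close>

definition Phi_plus :: "real \<Rightarrow> real" where
  "Phi_plus t = K (u t) - pos t \<bullet> W (lo t) (u t)"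

text \<open>The potential: a lower bound for the remaining cost, obtained by continuing on the side of
  the symmetry axis of the inspected arc on which the point is.\<close>

definition Phi :: "real \<Rightarrow> real" where
  "Phi t = K (u t) - u t * r t * sin (\<psi> (u t) - half t + \<bar>off t\<bar>)"

lemma W_eq: "W (lo t) (u t) = u t *\<^sub>R dir_plus t"
proof -
  have "lo t - 2 * pi * u t = hi t - 2 * pi" by (simp add: hi_eq mult.assoc pi_u)
  then have "lo t - 2 * pi * u t + pi/2 - \<psi> (u t) = (hi t + pi/2 - \<psi> (u t)) - 2 * pi" by linarith
  then have "unit_vec (lo t - 2 * pi * u t + pi/2 - \<psi> (u t)) = unit_vec (hi t + pi/2 - \<psi> (u t))"
    by (simp only: unit_vec_periodic)
  then show ?thesis by (simp add: W_def dir_plus_def)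
qed

lemma Phi_plus_eq: "Phi_plus t = K (u t) - u t * r t * sin (\<psi> (u t) - half t + off t)"
proof -
  have "pos t \<bullet> dir_plus t = r t * cos (al t - (hi t + pi/2 - \<psi> (u t)))"
    unfolding dir_plus_def by (rule inner_pos)
  also have "al t - (hi t + pi/2 - \<psi> (u t)) = (\<psi> (u t) - half t + off t) - pi/2"
    by (simp add: off_def half_def field_simps)
  also have "cos \<dots> = sin (\<psi> (u t) - half t + off t)"
    by (simp add: cos_diff)
  finally show ?thesis by (simp add: Phi_plus_def W_eq)
qed

lemma Phi_eq_Phi_plus: "0 \<le> off t \<Longrightarrow> Phi t = Phi_plus t"
  by (simp add: Phi_def Phi_plus_eq)

lemma Phi_tip:
  assumes t: "t \<in> {t0..T}" and tip: "tip t"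
  shows "Phi t = inspection_cost (half t)"
  using tip_facts[OF t tip] half_bounds[OF t] \<theta>
  by (simp add: Phi_def inspection_cost_alt u_def)

lemma cont_comp_u: "continuous_on {0..1} f \<Longrightarrow> continuous_on {t0..T} (\<lambda>t. f (u t))"
  by (rule continuous_on_compose2[OF _ cont_u]) (use u_in in auto)

lemma cont_Phi: "continuous_on {t0..T} Phi"
  unfolding Phi_def
  by (intro continuous_intros cont_comp_u[OF cont_K] cont_comp_u[OF cont_\<psi>] cont_u cont_r cont_half cont_off)

lemma Phi_end: "Phi T = 0"
  by (simp add: Phi_def u_end)

lemma cont_surplus: "continuous_on {t0..T} (\<lambda>t. surplus (half t))"
proof -
  have "continuous_on {min \<theta> optimal_half_angle..optimal_half_angle} phase_cost"
    using \<theta> optimal_half_angle(1,2) pi_gt_zero by (intro cont_phase_cost) auto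
  then have "continuous_on {t0..T} (\<lambda>t. phase_cost (min (half t) optimal_half_angle))"
  proof (rule continuous_on_compose2)
    show "continuous_on {t0..T} (\<lambda>t. min (half t) optimal_half_angle)"
      by (intro continuous_on_min continuous_on_const cont_half)
    show "(\<lambda>t. min (half t) optimal_half_angle) ` {t0..T} \<subseteq> {min \<theta> optimal_half_angle..optimal_half_angle}"
    proof
      fix y assume "y \<in> (\<lambda>t. min (half t) optimal_half_angle) ` {t0..T}"
      then obtain t where "t \<in> {t0..T}" "y = min (half t) optimal_half_angle" by auto
      then show "y \<in> {min \<theta> optimal_half_angle..optimal_half_angle}" using half_bounds[of t] by auto
    qed
  qed
  then show ?thesis unfolding surplus_def by (intro continuous_intros)
qed

text \<open>The change of \<open>Phi_plus\<close> is split into moving the point with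
  \<open>W\<close> fixed and changing \<open>u\<close> with the point fixed. By the mean value
  theorem the second part is governed by 1 - pos t \<bullet> P for some intermediate end P. This P
  was inspected at a time z in \<open>{s..t}\<close>, where pos z \<bullet> P = 1, so that factor is
  at most \<open>t - s\<close>, and the error is of second order.\<close>

lemma Phi_plus_step:
  assumes st: "t0 \<le> s" "s \<le> t" "t \<le> T" and lo: "lo t = lo s"
  shows "- ((pos t - pos s) \<bullet> W (lo s) (u s)) - (1 + 2*pi) * (t - s) * (u s - u t) \<le> Phi_plus t - Phi_plus s"
proof -
  have us: "u t \<le> u s" using u_antimono[of s t] st by simp
  have ub: "u s \<in> {0..1}" "u t \<in> {0..1}" using u_in st by auto
  let ?y = "\<lambda>x. K x - pos t \<bullet> W (lo s) x"
  have "?y (u s) - ?y (u t) \<le> (1 + 2*pi) * (t - s) * (u s - u t)"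
  proof (cases "u t = u s")
    case False
    with us have less: "u t < u s" by simp
    have "continuous_on {u t..u s} ?y"
      by (intro continuous_intros continuous_on_subset[OF cont_K] continuous_on_subset[OF cont_W])
        (use ub in auto)
    moreover have d: "(?y has_real_derivative (1 - pos t \<bullet> unit_vec (lo s - 2*pi*x)) / sin (\<psi> x)) (at x)"
      if "u t < x" "x < u s" for x
    proof -
      have "at x within {0..1} = at x" using that ub by (intro at_within_interior) auto
      then show ?thesis
        using DERIV_diff[OF deriv_K[of x] deriv_inner_W[of x "pos t" "lo s"]] that ub
        by (auto simp: diff_divide_distrib)
    qed
    ultimately obtain k x where x: "u t < x" "x < u s"
      and "(?y has_real_derivative k) (at x)" "?y (u s) - ?y (u t) = (u s - u t) * k"
      using MVT[OF less, of ?y] by (metis (no_types, lifting) real_differentiable_def)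
    then have eq: "?y (u s) - ?y (u t) = (u s - u t) * ((1 - pos t \<bullet> unit_vec (lo s - 2*pi*x)) / sin (\<psi> x))"
      using DERIV_unique[OF _ d[OF x]] by metis
    have x01: "x \<in> {0..1}" using x ub by auto
    \<comment> \<open>The same direction, moved by a full turn to lie between \<open>hi s\<close>
      and \<open>hi t\<close>.\<close>
    define \<phi> where "\<phi> = lo s - 2*pi*x + 2*pi"
    have "pi * u t < pi * x" "pi * x < pi * u s" using x by auto
    then have \<phi>: "hi s < \<phi>" "\<phi> < hi t"
      using hi_eq[of s] hi_eq[of t] lo unfolding \<phi>_def pi_u by linarith+
    obtain z where z: "z \<in> {s..t}" "al z + arccos (1 / r z) = \<phi>"
      using run_max_ivt[OF cont_upper, of s t \<phi>] st \<phi> by (auto simp: hi_def)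
    have zin: "z \<in> {t0..T}" "t \<in> {t0..T}" using z st by auto
    have "al z - \<phi> = - bet z" using z by (simp add: bet_def)
    then have "pos z \<bullet> unit_vec \<phi> = 1" using bet_bounds[OF zin(1)] by (simp add: inner_pos)
    then have "1 - pos t \<bullet> unit_vec \<phi> = (pos z - pos t) \<bullet> unit_vec \<phi>" by (simp add: inner_diff_left)
    also have "\<dots> \<le> norm (pos z - pos t)" using norm_cauchy_schwarz[of "pos z - pos t" "unit_vec \<phi>"] by simp
    also have "\<dots> \<le> t - s" using pos_diff[OF zin(2,1)] z by auto
    finally have 1: "1 - pos t \<bullet> unit_vec (lo s - 2*pi*x) \<le> t - s" by (simp add: \<phi>_def)
    have "(1 - pos t \<bullet> unit_vec (lo s - 2*pi*x)) / sin (\<psi> x) \<le> (t - s) * (1 / sin (\<psi> x))"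
      using divide_right_mono[OF 1, of "sin (\<psi> x)"] sin_\<psi>[OF x01] by simp
    also have "\<dots> \<le> (t - s) * (1 + 2*pi)" using csc_\<psi>_le[OF x01] st by (intro mult_left_mono) auto
    finally have "(u s - u t) * ((1 - pos t \<bullet> unit_vec (lo s - 2*pi*x)) / sin (\<psi> x)) \<le> (u s - u t) * ((t - s) * (1 + 2*pi))"
      using less by (intro mult_left_mono) auto
    then show ?thesis unfolding eq by (simp add: mult_ac)
  qed simp
  then show ?thesis by (simp add: Phi_plus_def lo inner_diff_left)
qed

end

section \<open>The energy of a path\<close>

lemma first_below:
  fixes f :: "real \<Rightarrow> real"
  assumes cont: "continuous_on {a..b} f" and ab: "a \<le> b" and fa: "k < f a" and fb: "f b \<le> k"
  obtains x where "a < x" "x \<le> b" "f x \<le> k" "\<And>y. a \<le> y \<Longrightarrow> y < x \<Longrightarrow> k < f y"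
proof -
  have "continuous_on {-b..-a} (\<lambda>x. f (- x))"
    by (intro continuous_on_compose2[OF cont] continuous_intros) auto
  then obtain x where x: "- b \<le> x" "x < - a" "f (- x) \<le> k"
    and above: "\<And>y. x < y \<Longrightarrow> y \<le> - a \<Longrightarrow> k < f (- y)"
    using last_below[of "-b" "-a" "\<lambda>x. f (- x)" k] ab fa fb by auto
  show thesis
  proof (rule that[of "- x"])
    fix y assume "a \<le> y" "y < - x"
    then show "k < f y" using above[of "- y"] by simp
  qed (use x in auto)
qed

context outer_path
begin

lemma mirror_simps:
  "outer_path.hi t0 (\<lambda>t. - al t) r t = - lo t"
  "outer_path.lo t0 (\<lambda>t. - al t) r t = - hi t"
  "outer_path.half t0 (\<lambda>t. - al t) r t = half t"
  "outer_path.u t0 (\<lambda>t. - al t) r t = u t"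
  "outer_path.off t0 (\<lambda>t. - al t) r t = - off t"
  "outer_path.tip t0 (\<lambda>t. - al t) r t = tip t"
  "outer_path.Phi \<psi> t0 (\<lambda>t. - al t) r t = Phi t"
proof -
  interpret mir: outer_path \<psi> t0 T \<theta> "\<lambda>t. - al t" r by (rule mirror)
  show 1: "mir.hi t = - lo t" by (simp add: mir.hi_def lo_def)
  show 2: "mir.lo t = - hi t" by (simp add: mir.lo_def hi_def)
  show 3: "mir.half t = half t" by (simp add: mir.half_def half_def 1 2)
  show 4: "mir.u t = u t" by (simp add: mir.u_def u_def 3)
  show 5: "mir.off t = - off t" by (simp add: mir.off_def off_def 1 2 field_simps)
  show 6: "mir.tip t = tip t" by (simp add: mir.tip_def tip_def mir.bet_def bet_def 3)
  show 7: "mir.Phi t = Phi t" by (simp add: mir.Phi_def Phi_def 3 4 5)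
qed

lemma near:
  fixes g :: "real \<Rightarrow> real"
  assumes "continuous_on {t0..T} g" "t \<in> {t0..T}" "0 < e"
  obtains d where "d > 0" "\<And>s. s \<in> {t0..T} \<Longrightarrow> \<bar>s - t\<bar> < d \<Longrightarrow> \<bar>g s - g t\<bar> < e"
  using assms unfolding continuous_on_iff dist_real_def by metis

lemma lo_const:
  assumes "t0 \<le> s" "s \<le> t" "t \<le> T" "\<And>x. x \<in> {s..t} \<Longrightarrow> lo s \<le> al x - bet x"
  shows "lo t = lo s"
  unfolding lo_def
  by (subst run_max_const[OF cont_lower]) (use assms in \<open>force simp: lo_def bet_def\<close>)+

lemma above_lo:
  assumes t: "t \<in> {t0..T}" and off: "0 \<le> off t" and nt: "\<not> tip t"
  shows "lo t < al t - bet t"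
  using bet_le_half[OF t] off nt by (auto simp: off_def tip_def half_def field_simps)

text \<open>On the upper side and away from tips the visible arc ends strictly above
  \<open>lo\<close>, so \<open>lo\<close> is constant for a short time and
  \<open>Phi_plus_step\<close> applies. Its first term is at most \<open>u t * (s - t)\<close> by
  Cauchy-Schwarz, as \<open>W\<close> has length \<open>u t\<close>; the other one is absorbed in
  \<open>e\<close>.\<close>

lemma Phi_plus_dini:
  assumes t: "t0 \<le> t" "t < T" and off: "0 \<le> off t" and nt: "\<not> tip t" and e: "0 < e"
  shows "\<exists>d>0. \<forall>s. t < s \<and> s < t + d \<and> s \<le> T \<longrightarrow> - ((u t + e) * (s - t)) \<le> Phi_plus s - Phi_plus t"
proof -
  have tin: "t \<in> {t0..T}" using t by auto
  define gap where "gap = al t - bet t - lo t"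
  have gap: "gap > 0" using above_lo[OF tin off nt] by (simp add: gap_def)
  have "continuous_on {t0..T} (\<lambda>s. al s - bet s)" by (intro continuous_intros cont_al cont_bet)
  from near[OF this tin gap] obtain d1 where d1: "d1 > 0"
    "\<And>s. s \<in> {t0..T} \<Longrightarrow> \<bar>s - t\<bar> < d1 \<Longrightarrow> \<bar>al s - bet s - (al t - bet t)\<bar> < gap" by auto
  have pp: "0 < 1 + 2*pi" using pi_gt_zero by linarith
  then have "0 < e / (1 + 2*pi)" using e by simp
  from near[OF cont_u tin this] obtain d2 where d2: "d2 > 0"
    "\<And>s. s \<in> {t0..T} \<Longrightarrow> \<bar>s - t\<bar> < d2 \<Longrightarrow> \<bar>u s - u t\<bar> < e / (1 + 2*pi)" by auto
  show ?thesis
  proof (intro exI[of _ "min d1 d2"] conjI allI impI)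
    show "0 < min d1 d2" using d1 d2 by simp
    fix s assume s: "t < s \<and> s < t + min d1 d2 \<and> s \<le> T"
    then have sd: "s < t + d1" "s < t + d2" "t < s" "s \<le> T" by (auto simp: min_def split: if_splits)
    have "lo s = lo t"
    proof (rule lo_const)
      fix x assume x: "x \<in> {t..s}"
      then have "\<bar>al x - bet x - (al t - bet t)\<bar> < gap" using d1(2)[of x] sd t by auto
      then show "lo t \<le> al x - bet x" by (simp add: gap_def)
    qed (use s t in auto)
    from Phi_plus_step[OF t(1) _ _ this] s
    have 1: "- ((pos s - pos t) \<bullet> W (lo t) (u t)) - (1 + 2*pi) * (s - t) * (u t - u s) \<le> Phi_plus s - Phi_plus t" by auto
    have "(pos s - pos t) \<bullet> W (lo t) (u t) \<le> norm (pos s - pos t) * norm (W (lo t) (u t))"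
      by (rule norm_cauchy_schwarz)
    also have "\<dots> \<le> (s - t) * u t"
      using pos_diff[of t s] u_bounds[OF tin] s t by (intro mult_mono) (auto simp: norm_W)
    finally have 2: "(pos s - pos t) \<bullet> W (lo t) (u t) \<le> (s - t) * u t" .
    have "\<bar>u s - u t\<bar> < e / (1 + 2*pi)" using d2(2)[of s] sd t by auto
    then have "u t - u s < e / (1 + 2*pi)" by linarith
    then have "(1 + 2*pi) * (u t - u s) \<le> e" using pp by (simp add: field_simps)
    then have "(s - t) * ((1 + 2*pi) * (u t - u s)) \<le> (s - t) * e" using s by (intro mult_left_mono) auto
    then show "- ((u t + e) * (s - t)) \<le> Phi_plus s - Phi_plus t" using 1 2 by (simp add: algebra_simps)
  qed
qed

lemma Phi_dini_nonneg:
  assumes t: "t0 \<le> t" "t < T" and off: "0 \<le> off t" and nt: "\<not> tip t" and e: "0 < e"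
  shows "\<exists>d>0. \<forall>s. t < s \<and> s < t + d \<and> s \<le> T \<longrightarrow> - ((u t + e) * (s - t)) \<le> Phi s - Phi t"
proof -
  interpret mir: outer_path \<psi> t0 T \<theta> "\<lambda>t. - al t" r by (rule mirror)
  obtain d1 where d1: "d1 > 0" "\<And>s. t < s \<Longrightarrow> s < t + d1 \<Longrightarrow> s \<le> T \<Longrightarrow> - ((u t + e) * (s - t)) \<le> Phi_plus s - Phi_plus t"
    using Phi_plus_dini[OF t off nt e] by blast
  show ?thesis
  proof (cases "off t = 0")
    case False
    with off have "0 < off t" by simp
    then obtain d2 where d2: "d2 > 0" "\<And>s. s \<in> {t0..T} \<Longrightarrow> \<bar>s - t\<bar> < d2 \<Longrightarrow> \<bar>off s - off t\<bar> < off t"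
      using near[OF cont_off, of t "off t"] t by auto
    show ?thesis
    proof (intro exI[of _ "min d1 d2"] conjI allI impI)
      fix s assume s: "t < s \<and> s < t + min d1 d2 \<and> s \<le> T"
      then have sd: "s < t + d1" "s < t + d2" "t < s" "s \<le> T" by (auto simp: min_def split: if_splits)
      have "\<bar>off s - off t\<bar> < off t" using d2(2)[of s] sd t by auto
      then have "0 \<le> off s" by linarith
      then show "- ((u t + e) * (s - t)) \<le> Phi s - Phi t"
        using d1(2)[of s] sd off by (simp add: Phi_eq_Phi_plus)
    qed (use d1 d2 in auto)
  next
    case True
    \<comment> \<open>On the axis both continuations have the same value; to whichever side the path
      moves, one of the two one-sided estimates applies.\<close>
    obtain d2 where d2: "d2 > 0" "\<And>s. t < s \<Longrightarrow> s < t + d2 \<Longrightarrow> s \<le> T \<Longrightarrow> - ((u t + e) * (s - t)) \<le> mir.Phi_plus s - mir.Phi_plus t"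
      using mir.Phi_plus_dini[OF t _ _ e] True nt by (auto simp: mirror_simps)
    have m: "mir.Phi_plus s = Phi s" if "off s \<le> 0" for s
      using mir.Phi_eq_Phi_plus[of s] that by (simp add: mirror_simps)
    show ?thesis
    proof (intro exI[of _ "min d1 d2"] conjI allI impI)
      fix s assume s: "t < s \<and> s < t + min d1 d2 \<and> s \<le> T"
      then have sd: "s < t + d1" "s < t + d2" "t < s" "s \<le> T" by (auto simp: min_def split: if_splits)
      show "- ((u t + e) * (s - t)) \<le> Phi s - Phi t"
        using d1(2)[of s] d2(2)[of s] sd m[of s] m[of t] True
        by (cases "0 \<le> off s") (auto simp: Phi_eq_Phi_plus)
    qed (use d1 d2 in auto)
  qed
qed

lemma Phi_dini:
  assumes t: "t0 \<le> t" "t < T" and nt: "\<not> tip t" and e: "0 < e"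
  shows "\<exists>d>0. \<forall>s. t < s \<and> s < t + d \<and> s \<le> T \<longrightarrow> - ((u t + e) * (s - t)) \<le> Phi s - Phi t"
proof (cases "0 \<le> off t")
  case True
  then show ?thesis using Phi_dini_nonneg[OF t _ nt e] by simp
next
  case False
  interpret mir: outer_path \<psi> t0 T \<theta> "\<lambda>t. - al t" r by (rule mirror)
  show ?thesis using mir.Phi_dini_nonneg[OF t _ _ e] False nt by (simp add: mirror_simps)
qed

text \<open>The cost accumulated since the end of the deployment: at each instant the fraction still
  uninspected keeps waiting.\<close>

definition elapsed :: "real \<Rightarrow> real" where "elapsed t = integral {t0..t} u"

lemma elapsed_diff:
  assumes "t0 \<le> s" "s \<le> t" "t \<le> T"
  shows "u t * (t - s) \<le> elapsed t - elapsed s" "elapsed t - elapsed s \<le> u s * (t - s)"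
proof -
  have int: "u integrable_on {a..b}" if "t0 \<le> a" "b \<le> T" for a b
    by (intro integrable_continuous_interval continuous_on_subset[OF cont_u]) (use that in auto)
  have "elapsed s + integral {s..t} u = elapsed t"
    unfolding elapsed_def using assms by (intro Henstock_Kurzweil_Integration.integral_combine int) auto
  then have eq: "elapsed t - elapsed s = integral {s..t} u" by simp
  have "integral {s..t} (\<lambda>x. u t) \<le> integral {s..t} u"
    using assms by (intro integral_le int integrable_const_ivl u_antimono) auto
  moreover have "integral {s..t} u \<le> integral {s..t} (\<lambda>x. u s)"
    using assms by (intro integral_le int integrable_const_ivl u_antimono) auto
  moreover have "integral {s..t} (\<lambda>x. c) = c * (t - s)" for c :: real
    using assms by (simp add: mult.commute)
  ultimately show "u t * (t - s) \<le> elapsed t - elapsed s" "elapsed t - elapsed s \<le> u s * (t - s)"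
    unfolding eq by (simp_all only:)
qed

lemma elapsed_start [simp]: "elapsed t0 = 0" by (simp add: elapsed_def)

lemma cont_elapsed: "continuous_on {t0..T} elapsed"
  unfolding elapsed_def by (intro indefinite_integral_continuous_1 integrable_continuous_interval cont_u)

lemma off_tip_step:
  assumes t: "t0 \<le> t" "t < T" and nt: "\<not> tip t" and e: "0 < e"
  shows "\<exists>d>0. \<forall>s. t < s \<and> s < t + d \<and> s \<le> T \<longrightarrow> - (e * (s - t)) \<le> (Phi s + elapsed s) - (Phi t + elapsed t)"
proof -
  have tin: "t \<in> {t0..T}" using t by auto
  have e2: "0 < e/2" using e by simp
  obtain d1 where d1: "d1 > 0" "\<And>s. t < s \<Longrightarrow> s < t + d1 \<Longrightarrow> s \<le> T \<Longrightarrow> - ((u t + e/2) * (s - t)) \<le> Phi s - Phi t"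
    using Phi_dini[OF t nt e2] by blast
  obtain d2 where d2: "d2 > 0" "\<And>s. s \<in> {t0..T} \<Longrightarrow> \<bar>s - t\<bar> < d2 \<Longrightarrow> \<bar>u s - u t\<bar> < e/2"
    using near[OF cont_u tin e2] by auto
  show ?thesis
  proof (intro exI[of _ "min d1 d2"] conjI allI impI)
    fix s assume s: "t < s \<and> s < t + min d1 d2 \<and> s \<le> T"
    then have sd: "s < t + d1" "s < t + d2" "t < s" "s \<le> T" by (auto simp: min_def split: if_splits)
    have "\<bar>u s - u t\<bar> < e/2" using d2(2)[of s] sd t by auto
    then have "u t - e/2 \<le> u s" by linarith
    then have "(u t - e/2) * (s - t) \<le> u s * (s - t)" using sd by (intro mult_right_mono) auto
    also have "\<dots> \<le> elapsed s - elapsed t" using elapsed_diff(1)[of t s] sd t by auto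
    finally have "(u t - e/2) * (s - t) \<le> elapsed s - elapsed t" .
    moreover have "- ((u t + e/2) * (s - t)) \<le> Phi s - Phi t" using d1(2)[of s] sd by auto
    ultimately show "- (e * (s - t)) \<le> (Phi s + elapsed s) - (Phi t + elapsed t)"
      by (simp add: field_simps)
  qed (use d1 d2 in auto)
qed

lemma between_tips_mono:
  assumes "t0 \<le> s" "s \<le> t" "t \<le> T" and nt: "\<And>x. s < x \<Longrightarrow> x < t \<Longrightarrow> \<not> tip x"
  shows "Phi s + elapsed s \<le> Phi t + elapsed t"
proof (rule dini_nondecreasing[of s t "\<lambda>t. Phi t + elapsed t"])
  show "continuous_on {s..t} (\<lambda>t. Phi t + elapsed t)"
    using assms by (intro continuous_intros continuous_on_subset[OF cont_Phi] continuous_on_subset[OF cont_elapsed]) auto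
  fix x e :: real assume x: "s < x" "x < t" "0 < e"
  have "\<exists>d>0. \<forall>z. x < z \<and> z < x + d \<and> z \<le> T \<longrightarrow> - (e * (z - x)) \<le> (Phi z + elapsed z) - (Phi x + elapsed x)"
    by (rule off_tip_step) (use x assms nt in auto)
  then show "\<exists>d>0. \<forall>z. x < z \<and> z < x + d \<and> z \<le> t \<longrightarrow> - (e * (z - x)) \<le> Phi z + elapsed z - (Phi x + elapsed x)"
    using assms by (meson order_trans)
qed (use assms in auto)

lemma last_tip:
  assumes "t0 \<le> s" "s \<le> t" "t \<le> T" "tip s"
  obtains q where "s \<le> q" "q \<le> t" "tip q" "\<And>x. q < x \<Longrightarrow> x \<le> t \<Longrightarrow> \<not> tip x"
proof (cases "tip t")
  case True
  then show thesis using that[of t] assms by auto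
next
  case False
  have "continuous_on {s..t} (\<lambda>x. half x - bet x)"
    using assms by (intro continuous_intros continuous_on_subset[OF cont_half] continuous_on_subset[OF cont_bet]) auto
  moreover have "half s - bet s \<le> 0" using assms by (simp add: tip_def)
  moreover have "0 < half t - bet t" using False bet_le_half[of t] assms by (auto simp: tip_def)
  ultimately obtain q where q: "s \<le> q" "q < t" "half q - bet q \<le> 0"
    and above: "\<And>y. q < y \<Longrightarrow> y \<le> t \<Longrightarrow> 0 < half y - bet y"
    using last_below[of s t "\<lambda>x. half x - bet x" 0] assms by auto
  show thesis
  proof (rule that[of q])
    show "tip q" using q bet_le_half[of q] assms by (auto simp: tip_def)
    show "\<not> tip x" if "q < x" "x \<le> t" for x using above[OF that] by (auto simp: tip_def)
  qed (use q in auto)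
qed

definition energy :: "real \<Rightarrow> real" where
  "energy t = Phi t - surplus (half t) + elapsed t"

lemma cont_energy: "continuous_on {t0..T} energy"
  unfolding energy_def by (intro continuous_intros cont_Phi cont_surplus cont_elapsed)

lemma energy_tip:
  assumes "t \<in> {t0..T}" "tip t"
  shows "energy t = phase_cost (max (half t) optimal_half_angle) - deployment_cost (half t) + elapsed t"
  using phase_cost_minus_surplus[of "half t"] Phi_tip[OF assms]
  by (simp add: energy_def phase_cost_def)

lemma tips_deployment_diff:
  assumes st: "t0 \<le> s" "s \<le> t" "t \<le> T" and tips: "tip s" "tip t"
  shows "deployment_cost (half t) - deployment_cost (half s) \<le> u s * (r t - r s)"
proof -
  have "s \<in> {t0..T}" "t \<in> {t0..T}" using st by auto
  note fs = tip_facts[OF this(1) tips(1)] and ft = tip_facts[OF this(2) tips(2)]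
  show ?thesis
    using deployment_cost_diff_le[of "half s" "half t"] half_bounds[of s] half_mono[of s t] st fs ft \<theta>
    by (simp add: u_def)
qed

text \<open>Two tips are compared without following the path between them: at a tip the radius and
  the half-angle determine each other, and the radius grows at most at unit speed. The defect is a
  product of two increments and so vanishes in a Dini derivative.\<close>

lemma energy_tips:
  assumes st: "t0 \<le> s" "s \<le> t" "t \<le> T" and tips: "tip s" "tip t"
  shows "- ((u s - u t) * (t - s)) \<le> energy t - energy s"
proof -
  have in_: "s \<in> {t0..T}" "t \<in> {t0..T}" using st by auto
  note ft = tip_facts[OF in_(2) tips(2)]
  have "u s * (r t - r s) \<le> u s * (t - s)"
    using r_diff[OF in_] u_bounds[OF in_(1)] st by (intro mult_left_mono) auto
  moreover have "phase_cost (max (half s) optimal_half_angle) \<le> phase_cost (max (half t) optimal_half_angle)"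
    using half_mono[OF st] ft(4) by (intro phase_cost_max_mono) auto
  moreover have "u t * (t - s) \<le> elapsed t - elapsed s" by (rule elapsed_diff[OF st])
  ultimately show ?thesis
    using tips_deployment_diff[OF st tips]
    unfolding energy_tip[OF in_(1) tips(1)] energy_tip[OF in_(2) tips(2)] left_diff_distrib
    by linarith
qed

lemma between_tips_energy_mono:
  assumes st: "t0 \<le> s" "s \<le> t" "t \<le> T" and nt: "\<And>x. s < x \<Longrightarrow> x < t \<Longrightarrow> \<not> tip x"
  shows "energy s \<le> energy t"
  using between_tips_mono[OF assms] surplus_antimono[of "half s" "half t"] half_mono[OF st]
    half_bounds[of s] st \<theta> by (auto simp: energy_def)

text \<open>At a time that is not a tip the calibration estimate suffices, as the surplus only
  decreases. At a tip \<open>x\<close> the step to \<open>z\<close> is cut at the last tip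
  \<open>q\<close> before \<open>z\<close>: \<open>energy_tips\<close> covers the part up to
  \<open>q\<close>, and the rest is free of tips.\<close>

lemma energy_mono:
  assumes st: "t0 \<le> s" "s \<le> t" "t \<le> T"
  shows "energy s \<le> energy t"
proof (rule dini_nondecreasing[OF st(2)])
  show "continuous_on {s..t} energy" using st by (intro continuous_on_subset[OF cont_energy]) auto
  fix x e :: real assume x: "s < x" "x < t" and e: "0 < e"
  have xT: "t0 \<le> x" "x < T" "x \<in> {t0..T}" using x st by auto
  show "\<exists>d>0. \<forall>z. x < z \<and> z < x + d \<and> z \<le> t \<longrightarrow> - (e * (z - x)) \<le> energy z - energy x"
  proof (cases "tip x")
    case False
    obtain d where d: "d > 0" "\<And>z. x < z \<Longrightarrow> z < x + d \<Longrightarrow> z \<le> T \<Longrightarrow>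
        - (e * (z - x)) \<le> (Phi z + elapsed z) - (Phi x + elapsed x)"
      using off_tip_step[OF xT(1,2) False e] by blast
    show ?thesis
    proof (intro exI[of _ d] conjI allI impI d(1))
      fix z assume z: "x < z \<and> z < x + d \<and> z \<le> t"
      have "surplus (half z) \<le> surplus (half x)"
        using surplus_antimono[of "half x" "half z"] half_mono[of x z] half_bounds[of x] xT z st \<theta> by auto
      then show "- (e * (z - x)) \<le> energy z - energy x"
        using d(2)[of z] z st by (simp add: energy_def)
    qed
  next
    case True
    obtain d where d: "d > 0" "\<And>z. z \<in> {t0..T} \<Longrightarrow> \<bar>z - x\<bar> < d \<Longrightarrow> \<bar>u z - u x\<bar> < e"
      using near[OF cont_u xT(3) e] by auto
    show ?thesis
    proof (intro exI[of _ d] conjI allI impI d(1))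
      fix z assume z: "x < z \<and> z < x + d \<and> z \<le> t"
      obtain q where q: "x \<le> q" "q \<le> z" "tip q" "\<And>y. q < y \<Longrightarrow> y \<le> z \<Longrightarrow> \<not> tip y"
        using last_tip[of x z] xT z st True by auto
      have "energy q \<le> energy z" by (rule between_tips_energy_mono) (use q xT z st in auto)
      moreover have "- ((u x - u q) * (q - x)) \<le> energy q - energy x"
        by (rule energy_tips) (use q xT z st True in auto)
      moreover have "(u x - u q) * (q - x) \<le> e * (z - x)"
        using d(2)[of q] u_antimono[of x q] q xT z st by (intro mult_mono) auto
      ultimately show "- (e * (z - x)) \<le> energy z - energy x" by linarith
    qed
  qed
qed

lemma energy_start: "energy t0 = phase_cost (max \<theta> optimal_half_angle) - deployment_cost \<theta>"
  using energy_tip[of t0] tip_start t0T by (simp add: half_start)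

lemma energy_end: "energy T = elapsed T"
proof -
  have "optimal_half_angle \<le> pi" using optimal_half_angle(2) pi_gt_zero by linarith
  then have "surplus (half T) = 0" by (simp add: half_end surplus_def min_absorb2)
  then show ?thesis by (simp add: energy_def Phi_end)
qed

lemma path_cost_ge: "phase_cost (max \<theta> optimal_half_angle) \<le> deployment_cost \<theta> + elapsed T"
  using energy_mono[of t0 T] t0T energy_start energy_end by simp

end

section \<open>Paths of constant energy\<close>

text \<open>A displacement no longer than \<open>d\<close> whose component along \<open>e\<close> is
  nearly \<open>d\<close> is close to \<open>d *\<^sub>R e\<close>. It converts equality in the
  energy estimate into information on the direction; with \<open>k = 0\<close> the displacement is
  determined.\<close>

lemma unit_push:
  fixes w e :: "'a::real_inner"
  assumes e: "norm e = 1" and w: "norm w \<le> d" and push: "d * (1 - k) \<le> w \<bullet> e" and d: "0 \<le> d"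
  shows "(norm (w - d *\<^sub>R e))\<^sup>2 \<le> 2 * k * d\<^sup>2"
proof -
  have "e \<bullet> e = 1" using e by (simp add: dot_square_norm)
  then have "(norm (w - d *\<^sub>R e))\<^sup>2 = (norm w)\<^sup>2 - 2 * d * (w \<bullet> e) + d\<^sup>2"
    unfolding power2_norm_eq_inner
    by (simp add: inner_diff_left inner_diff_right inner_commute[of e w] power2_eq_square algebra_simps)
  moreover have "(norm w)\<^sup>2 \<le> d\<^sup>2" using w by (simp add: power_mono)
  moreover have "d * (d * (1 - k)) \<le> d * (w \<bullet> e)" using push d by (rule mult_left_mono)
  ultimately show ?thesis by (simp add: power2_eq_square algebra_simps)
qed

text \<open>\<open>maximal\<close> says that the deployment phase was not cut short; in these coordinates it runs
  along \<open>unit_vec 0\<close>.\<close>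

locale optimal_path = outer_path +
  assumes optimal: "deployment_cost \<theta> + integral {t0..T} u \<le> phase_cost optimal_half_angle"
    and maximal: "\<And>d. d \<in> {t0..T} \<Longrightarrow>
      (\<And>t. t \<in> {t0..d} \<Longrightarrow> r t *\<^sub>R unit_vec (al t) = t *\<^sub>R unit_vec 0) \<Longrightarrow> d \<le> t0"
begin

lemma optimal_mirror: "optimal_path \<psi> t0 T \<theta> (\<lambda>t. - al t) r"
proof -
  interpret mir: outer_path \<psi> t0 T \<theta> "\<lambda>t. - al t" r by (rule mirror)
  show ?thesis
  proof
    have "mir.u = u" using mirror_simps(4) by auto
    then show "deployment_cost \<theta> + integral {t0..T} mir.u \<le> phase_cost optimal_half_angle"
      using optimal by simp
    fix d assume d: "d \<in> {t0..T}" "\<And>t. t \<in> {t0..d} \<Longrightarrow> r t *\<^sub>R unit_vec (- al t) = t *\<^sub>R unit_vec 0"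
    show "d \<le> t0"
    proof (rule maximal[OF d(1)])
      fix t assume "t \<in> {t0..d}"
      from d(2)[OF this] show "r t *\<^sub>R unit_vec (al t) = t *\<^sub>R unit_vec 0"
        by (auto simp: unit_vec_def)
    qed
  qed
qed

lemma energy_const:
  assumes t: "t \<in> {t0..T}"
  shows "energy t = energy t0"
proof -
  have "phase_cost optimal_half_angle \<le> phase_cost (max \<theta> optimal_half_angle)"
    using phase_cost_increasing[of optimal_half_angle \<theta>] \<theta> by (cases "optimal_half_angle < \<theta>") auto
  then have "energy T \<le> energy t0"
    using optimal by (simp add: energy_start energy_end elapsed_def)
  moreover have "energy t0 \<le> energy t" "energy t \<le> energy T" using energy_mono t by auto
  ultimately show ?thesis by linarith
qed

lemma \<theta>_le: "\<theta> \<le> optimal_half_angle"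
proof (rule ccontr)
  assume "\<not> \<theta> \<le> optimal_half_angle"
  then have "phase_cost optimal_half_angle < phase_cost \<theta>" "max \<theta> optimal_half_angle = \<theta>"
    using phase_cost_increasing[of optimal_half_angle \<theta>] \<theta> by auto
  then show False using path_cost_ge optimal by (simp add: elapsed_def)
qed

text \<open>While nothing new is inspected, constant energy forces the path to run straight along
  \<open>dir_plus\<close>. That direction has the positive component \<open>sin \<psi>\<close> along
  \<open>hi\<close>, so from the tangent at \<open>hi\<close> the path would get beyond it and
  inspect new points after all.\<close>

lemma stall_plus:
  assumes st: "t0 \<le> s" "s < t" "t \<le> T" and u: "u t = u s"
    and off: "0 \<le> off s" "0 \<le> off t" and on: "al s + bet s = hi s"
  shows False
proof -
  have in_: "s \<in> {t0..T}" "t \<in> {t0..T}" using st by auto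
  have us: "u s > 0" using u_pos[of s] st by auto
  have half: "half t = half s" using u by (simp add: u_def)
  then have hilo: "hi t = hi s" "lo t = lo s"
    using hi_mono[of s t] lo_mono[of s t] st by (auto simp: half_def)
  have "energy t = energy s" using energy_const[OF in_(1)] energy_const[OF in_(2)] by simp
  then have "Phi t - Phi s = - (elapsed t - elapsed s)" by (simp add: energy_def half)
  also have "elapsed t - elapsed s = u s * (t - s)" using elapsed_diff[of s t] st u by simp
  finally have "Phi_plus t - Phi_plus s = - (u s * (t - s))" using off by (simp add: Phi_eq_Phi_plus)
  moreover have "Phi_plus t - Phi_plus s = - (u s * ((pos t - pos s) \<bullet> dir_plus s))"
    using W_eq[of s] by (simp add: Phi_plus_def u hilo inner_diff_left algebra_simps)
  ultimately have push: "(pos t - pos s) \<bullet> dir_plus s = t - s" using us by simp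
  have "(norm ((pos t - pos s) - (t - s) *\<^sub>R dir_plus s))\<^sup>2 \<le> 2 * 0 * (t - s)\<^sup>2"
    by (rule unit_push) (use push pos_diff[OF in_] st in \<open>auto simp: dir_plus_def\<close>)
  then have move: "pos t = pos s + (t - s) *\<^sub>R dir_plus s" by (simp add: algebra_simps)
  have "pos s \<bullet> unit_vec (hi s) = r s * cos (- bet s)" using on by (simp add: inner_pos flip: on)
  then have 1: "pos s \<bullet> unit_vec (hi s) = 1" using bet_bounds[OF in_(1)] by simp
  have "dir_plus s \<bullet> unit_vec (hi s) = cos (pi/2 - \<psi> (u s))" by (simp add: dir_plus_def inner_unit_vec)
  then have 2: "dir_plus s \<bullet> unit_vec (hi s) = sin (\<psi> (u s))" by (simp add: cos_diff)
  have "pos t \<bullet> unit_vec (hi t) = 1 + (t - s) * sin (\<psi> (u s))"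
    unfolding move hilo by (simp add: inner_add_left 1 2)
  moreover have "0 < (t - s) * sin (\<psi> (u s))" using sin_\<psi>[OF u_in[OF in_(1)]] st by simp
  ultimately show False using not_beyond_hi[OF in_(2)] by simp
qed

lemma stall_minus:
  assumes st: "t0 \<le> s" "s < t" "t \<le> T" and u: "u t = u s"
    and off: "off s \<le> 0" "off t \<le> 0" and on: "al s - bet s = lo s"
  shows False
proof -
  interpret mir: optimal_path \<psi> t0 T \<theta> "\<lambda>t. - al t" r by (rule optimal_mirror)
  have "mir.bet s = bet s" by (simp add: mir.bet_def bet_def)
  then show False
    using mir.stall_plus[of s t] st u off on by (auto simp: mirror_simps)
qed

lemma off_on_hi: "t \<in> {t0..T} \<Longrightarrow> al t + bet t = hi t \<Longrightarrow> off t = half t - bet t"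
  and off_on_lo: "t \<in> {t0..T} \<Longrightarrow> al t - bet t = lo t \<Longrightarrow> off t = bet t - half t"
  by (simp_all add: off_def half_def field_simps)

text \<open>Away from the axis \<open>t\<close> is replaced by an earlier time up to which
  \<open>off\<close> keeps its sign; from a tip either sign of \<open>off t\<close> leads to one of
  the two previous cases.\<close>

lemma no_stall:
  assumes st: "t0 \<le> s" "s < t" "t \<le> T" and u: "u t = u s"
    and on: "al s + bet s = hi s \<or> al s - bet s = lo s"
  shows False
proof -
  have in_: "s \<in> {t0..T}" using st by auto
  have const: "u x = u s" if "s < x" "x \<le> t" for x
    using u_antimono[of s x] u_antimono[of x t] that st u by auto
  have bh: "bet s \<le> half s" by (rule bet_le_half[OF in_])
  consider "0 < off s" "al s + bet s = hi s" | "off s < 0" "al s - bet s = lo s"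
    | "off s = 0" "al s + bet s = hi s" "al s - bet s = lo s"
  proof (cases "tip s")
    case True
    then show thesis using tip_facts[OF in_ True] that(3) by simp
  next
    case False
    then have "bet s < half s" using bh by (simp add: tip_def)
    then show thesis using on off_on_hi[OF in_] off_on_lo[OF in_] that(1,2) by auto
  qed
  then show False
  proof cases
    case 1
    obtain d where d: "d > 0" "\<And>x. x \<in> {t0..T} \<Longrightarrow> \<bar>x - s\<bar> < d \<Longrightarrow> \<bar>off x - off s\<bar> < off s"
      using near[OF cont_off in_ 1(1)] by auto
    define x where "x = min t (s + d/2)"
    have x: "s < x" "x \<le> t" "\<bar>x - s\<bar> < d" using st d by (auto simp: x_def)
    then have "\<bar>off x - off s\<bar> < off s" using d(2)[of x] st by auto
    then have "0 \<le> off x" by linarith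
    then show False using stall_plus[of s x] const[of x] x st 1 by auto
  next
    case 2
    then have "0 < - off s" by simp
    then obtain d where d: "d > 0" "\<And>x. x \<in> {t0..T} \<Longrightarrow> \<bar>x - s\<bar> < d \<Longrightarrow> \<bar>off x - off s\<bar> < - off s"
      using near[OF cont_off in_] by metis
    define x where "x = min t (s + d/2)"
    have x: "s < x" "x \<le> t" "\<bar>x - s\<bar> < d" using st d by (auto simp: x_def)
    then have "\<bar>off x - off s\<bar> < - off s" using d(2)[of x] st by auto
    then have "off x \<le> 0" by linarith
    then show False using stall_minus[of s x] const[of x] x st 2 by auto
  next
    case 3
    then show False using stall_plus[OF st u] stall_minus[OF st u] by (cases "0 \<le> off t") auto
  qed
qed

text \<open>Otherwise, after the last time \<open>s\<close> on one of the two bounding tangents,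
  neither end of the arc would change up to \<open>t\<close>, since an end moves only while the path
  touches its tangent. This is a stall starting at \<open>s\<close>.\<close>

lemma on_boundary:
  assumes t: "t0 \<le> t" "t < T"
  shows "al t + bet t = hi t \<or> al t - bet t = lo t"
proof (rule ccontr)
  assume not: "\<not> ?thesis"
  let ?g = "\<lambda>x. min (hi x - (al x + bet x)) ((al x - bet x) - lo x)"
  have gnn: "0 \<le> hi x - (al x + bet x)" "0 \<le> (al x - bet x) - lo x" if "x \<in> {t0..T}" for x
    using hi_ge[of x x] lo_le[of x x] that by auto
  have "continuous_on {t0..t} ?g"
    using t by (intro continuous_intros continuous_on_subset[OF cont_hi] continuous_on_subset[OF cont_lo]
        continuous_on_subset[OF cont_al] continuous_on_subset[OF cont_bet]) auto
  moreover have "?g t0 \<le> 0" by (simp add: hi_start al_start bet_start)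
  moreover have "0 < ?g t" using not gnn[of t] t by auto
  ultimately obtain s where s: "t0 \<le> s" "s < t" "?g s \<le> 0" and above: "\<And>y. s < y \<Longrightarrow> y \<le> t \<Longrightarrow> 0 < ?g y"
    using last_below[of t0 t ?g 0] t by auto
  have "hi t = hi s"
  proof (rule ccontr)
    assume "hi t \<noteq> hi s"
    then have "hi s < hi t" using hi_mono[of s t] s t by auto
    then obtain z where z: "z \<in> {s..t}" "al z + arccos (1 / r z) = hi t"
      using run_max_ivt[OF cont_upper, of s t "hi t"] s t by (auto simp: hi_def)
    then have zz: "al z + bet z = hi t" by (simp add: bet_def)
    have "hi z \<le> hi t" using hi_mono[of z t] z s t by auto
    then have "?g z \<le> 0" using zz by auto
    then have "z = s" using above[of z] z by force
    then show False using zz hi_ge[of s s] s t \<open>hi s < hi t\<close> by auto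
  qed
  moreover have "lo t = lo s"
  proof (rule ccontr)
    assume "lo t \<noteq> lo s"
    then have "lo t < lo s" using lo_mono[of s t] s t by auto
    then obtain z where z: "z \<in> {s..t}" "- al z + arccos (1 / r z) = - lo t"
      using run_max_ivt[OF cont_lower, of s t "- lo t"] s t by (auto simp: lo_def)
    then have zz: "al z - bet z = lo t" by (simp add: bet_def)
    have "lo t \<le> lo z" using lo_mono[of z t] z s t by auto
    then have "?g z \<le> 0" using zz by auto
    then have "z = s" using above[of z] z by force
    then show False using zz lo_le[of s s] s t \<open>lo t < lo s\<close> by auto
  qed
  ultimately have "u t = u s" by (simp add: u_def half_def)
  moreover have "al s + bet s = hi s \<or> al s - bet s = lo s"
    using s gnn[of s] t by (auto simp: min_def split: if_splits)
  ultimately show False using no_stall[of s t] s t by auto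
qed

lemma u_strict:
  assumes "t0 \<le> s" "s < t" "t \<le> T"
  shows "u t < u s"
  using u_antimono[of s t] no_stall[of s t] on_boundary[of s] assms by fastforce

lemma half_strict: "t0 \<le> s \<Longrightarrow> s < t \<Longrightarrow> t \<le> T \<Longrightarrow> half s < half t"
  using u_strict[of s t] by (simp add: u_def divide_less_cancel)

text \<open>Below the minimizer the surplus decreases strictly, so constant energy allows no
  excursion from the tips, and along tips it forces the radius to grow at unit speed. The path would
  then prolong the segment, against \<open>maximal\<close>.\<close>

lemma \<theta>_eq: "\<theta> = optimal_half_angle"
proof (rule ccontr)
  assume "\<theta> \<noteq> optimal_half_angle"
  then have less: "\<theta> < optimal_half_angle" using \<theta>_le by simp
  have "optimal_half_angle \<le> pi" using optimal_half_angle(2) pi_gt_zero by linarith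
  then obtain te where te: "t0 \<le> te" "te \<le> T" "half te = optimal_half_angle"
    using IVT'[of half t0 optimal_half_angle T, OF _ _ t0_le cont_half] less by (auto simp: half_start half_end)
  have tte: "t0 < te" using te half_start less by (cases "t0 = te") auto
  have below: "half t < optimal_half_angle" if "t0 \<le> t" "t < te" for t
    using half_strict[of t te] that te by auto
  have tips: "tip t" if t: "t0 \<le> t" "t < te" for t
  proof (rule ccontr)
    assume nt: "\<not> tip t"
    obtain q where q: "t0 \<le> q" "q \<le> t" "tip q" "\<And>x. q < x \<Longrightarrow> x \<le> t \<Longrightarrow> \<not> tip x"
      using last_tip[of t0 t] t te tip_start by auto
    have qt: "q < t" using q nt by (cases "q = t") auto
    have "Phi q + elapsed q \<le> Phi t + elapsed t"
      by (rule between_tips_mono) (use q t te in auto)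
    moreover have "surplus (half t) < surplus (half q)"
      using half_strict[OF q(1) qt] half_bounds[of q] below[of q] q t te \<theta> by (intro surplus_strict) auto
    moreover have "energy q = energy t" using energy_const[of q] energy_const[of t] q t te by auto
    ultimately show False by (simp add: energy_def)
  qed
  define d where "d = (t0 + te) / 2"
  have d: "t0 < d" "d < te" using tte by (auto simp: d_def)
  have dT: "d \<in> {t0..T}" using d te by auto
  have el: "elapsed t - elapsed s = deployment_cost (half t) - deployment_cost (half s)"
    if "t0 \<le> s" "s < te" "t0 \<le> t" "t < te" for s t
  proof -
    have "energy s = energy t" using energy_const[of s] energy_const[of t] that te by auto
    then show ?thesis
      using energy_tip[of s] energy_tip[of t] tips[of s] tips[of t] below[of s] below[of t] that te
      by (simp add: max_absorb2)
  qed
  \<comment> \<open>The upper bound is the Lipschitz property. For the lower one, the energy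
    identity at tips reads \<open>u s * (s - x) \<le> u x * (r s - r x)\<close>, and
    \<open>u s\<close> is close to \<open>u x\<close>.\<close>
  have "r t = t" if t: "t \<in> {t0..d}" for t
  proof (rule antisym)
    show "r t \<le> t" using r_diff[of t0 t] t dT r_start by auto
    have "r t0 - t0 \<le> r t - t"
    proof (rule dini_nondecreasing[of t0 t "\<lambda>t. r t - t"])
      show "continuous_on {t0..t} (\<lambda>t. r t - t)"
        using t dT by (intro continuous_intros continuous_on_subset[OF cont_r]) auto
      fix x e :: real assume x: "t0 < x" "x < t" and e: "0 < e"
      have xin: "x \<in> {t0..T}" using x t dT by auto
      have ux: "u x > 0" using x t d te by (intro u_pos) auto
      then have "0 < e * u x" using e by simp
      then obtain k where k: "k > 0" "\<And>s. s \<in> {t0..T} \<Longrightarrow> \<bar>s - x\<bar> < k \<Longrightarrow> \<bar>u s - u x\<bar> < e * u x"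
        using near[OF cont_u xin] by metis
      show "\<exists>k>0. \<forall>s. x < s \<and> s < x + k \<and> s \<le> t \<longrightarrow> - (e * (s - x)) \<le> r s - s - (r x - x)"
      proof (intro exI[of _ k] conjI allI impI k(1))
        fix s assume s: "x < s \<and> s < x + k \<and> s \<le> t"
        have sT: "s \<le> T" "s < te" "x < te" using s x t d te by auto
        have "u s * (s - x) \<le> elapsed s - elapsed x" using elapsed_diff(1)[of x s] s x sT by auto
        also have "\<dots> = deployment_cost (half s) - deployment_cost (half x)" using el[of x s] s x sT by auto
        also have "\<dots> \<le> u x * (r s - r x)"
          using tips_deployment_diff[of x s] tips[of x] tips[of s] s x sT by auto
        finally have 1: "u s * (s - x) \<le> u x * (r s - r x)" .
        have "\<bar>u s - u x\<bar> < e * u x" using k(2)[of s] s x sT by auto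
        then have "u x - e * u x \<le> u s" by linarith
        then have "(u x - e * u x) * (s - x) \<le> u s * (s - x)" using s by (intro mult_right_mono) auto
        then have "u x * ((1 - e) * (s - x)) \<le> u x * (r s - r x)" using 1 by (simp add: algebra_simps)
        then have "(1 - e) * (s - x) \<le> r s - r x" using ux by simp
        then show "- (e * (s - x)) \<le> r s - s - (r x - x)" by (simp add: algebra_simps)
      qed
    qed (use t in auto)
    then show "t \<le> r t" using r_start by simp
  qed
  then have "r t *\<^sub>R unit_vec (al t) = t *\<^sub>R unit_vec 0" if t: "t \<in> {t0..d}" for t
  proof -
    have rt: "r t = t" using \<open>\<And>t. t \<in> {t0..d} \<Longrightarrow> r t = t\<close> t by simp
    have tin: "t \<in> {t0..T}" "t0 \<in> {t0..T}" using t dT by auto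
    have "norm (pos t) \<le> norm (pos t0) + norm (pos t - pos t0)"
      by (metis add.commute norm_triangle_sub)
    moreover have "norm (pos t - pos t0) \<le> t - t0" using pos_diff[OF tin(2,1)] t by auto
    ultimately have nd: "norm (pos t - pos t0) = t - t0" using norm_pos tin rt r_start by auto
    \<comment> \<open>Equality in the triangle inequality: the whole length has gone into the
      radius, so the motion is radial.\<close>
    have "norm (pos t0 + (pos t - pos t0)) = norm (pos t0) + norm (pos t - pos t0)"
      using norm_pos tin rt r_start nd by simp
    then have "norm (pos t0) *\<^sub>R (pos t - pos t0) = norm (pos t - pos t0) *\<^sub>R pos t0"
      by (simp only: norm_triangle_eq)
    then have "t0 *\<^sub>R (pos t - pos t0) = (t - t0) *\<^sub>R t0 *\<^sub>R unit_vec 0"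
      using norm_pos[OF tin(2)] nd r_start al_start by (simp add: pos_def)
    then have eq: "t0 *\<^sub>R (pos t - pos t0) = t0 *\<^sub>R (t - t0) *\<^sub>R unit_vec 0" by (simp add: mult.commute)
    have "pos t - pos t0 = (t - t0) *\<^sub>R unit_vec 0"
      by (rule scaleR_left_imp_eq[OF _ eq]) (use t0_pos in simp)
    then show ?thesis by (simp add: pos_def r_start al_start algebra_simps)
  qed
  from maximal[OF dT this] show False using d by simp
qed

lemma surplus_half: "t \<in> {t0..T} \<Longrightarrow> surplus (half t) = 0"
  using half_bounds[of t] \<theta>_eq by (simp add: surplus_def min_absorb2)

lemma Phi_elapsed_const: "t \<in> {t0..T} \<Longrightarrow> Phi t + elapsed t = Phi t0 + elapsed t0"
  using energy_const[of t] surplus_half[of t] surplus_half[of t0] t0_le by (simp add: energy_def)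

end

lemma has_vector_derivative_unit_vec:
  assumes "(f has_real_derivative d) (at t)"
  shows "((\<lambda>t. unit_vec (f t)) has_vector_derivative d *\<^sub>R unit_vec (f t + pi/2)) (at t)"
proof -
  have "((\<lambda>t. cos (f t)) has_real_derivative d * cos (f t + pi/2)) (at t)"
    "((\<lambda>t. sin (f t)) has_real_derivative d * sin (f t + pi/2)) (at t)"
    by (auto intro!: derivative_eq_intros assms simp: cos_add sin_add)
  then show ?thesis
    unfolding unit_vec_def has_real_derivative_iff_has_vector_derivative
    by (auto intro!: has_vector_derivative_Pair)
qed

lemma has_real_derivative_inner:
  fixes f g :: "real \<Rightarrow> plane"
  assumes "(f has_vector_derivative f') (at t)" "(g has_vector_derivative g') (at t)"
  shows "((\<lambda>t. f t \<bullet> g t) has_real_derivative f t \<bullet> g' + f' \<bullet> g t) (at t)"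
  using bounded_bilinear.has_vector_derivative[OF bounded_bilinear_inner assms]
  by (simp add: has_real_derivative_iff_has_vector_derivative)

section \<open>Pieces without tips on one side of the axis\<close>

context optimal_path
begin

lemma half_ge: "t \<in> {t0..T} \<Longrightarrow> pi/6 \<le> half t"
  using half_bounds[of t] \<theta>_eq optimal_half_angle(1) by auto

context
  fixes s s' :: real
  assumes ss: "t0 \<le> s" "s < s'" "s' \<le> T"
    and no_tip: "\<And>t. s < t \<Longrightarrow> t < s' \<Longrightarrow> \<not> tip t"
    and off_pos: "\<And>t. s < t \<Longrightarrow> t < s' \<Longrightarrow> 0 < off t"
begin

lemma gap_above_lo: "s < t \<Longrightarrow> t < s' \<Longrightarrow> lo t < al t - bet t"
  using above_lo[of t] off_pos[of t] no_tip[of t] ss by auto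

lemma gap_lo_const_open:
  assumes t: "s \<le> t" "t < s'"
  shows "lo t = lo s"
proof (rule ccontr)
  assume "lo t \<noteq> lo s"
  moreover have "lo t \<le> lo s" using t ss by (intro lo_mono) auto
  ultimately have less: "lo t < lo s" by simp
  then obtain z where z: "z \<in> {s..t}" "- al z + arccos (1 / r z) = - lo t"
    using run_max_ivt[OF cont_lower, of s t "- lo t"] t ss by (auto simp: lo_def)
  then have zz: "al z - bet z = lo t" by (simp add: bet_def)
  have "z \<noteq> s" using zz lo_le[of s s] less ss by auto
  then have "lo z < al z - bet z" using gap_above_lo[of z] z t by auto
  then show False using zz lo_mono[of z t] z t ss by auto
qed

lemma gap_lo_const:
  assumes t: "s \<le> t" "t \<le> s'"
  shows "lo t = lo s"
proof (cases "t < s'")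
  case True
  then show ?thesis by (rule gap_lo_const_open[OF t(1)])
next
  case False
  then have t: "t = s'" using t by simp
  show ?thesis
  proof (rule ccontr)
    assume "lo t \<noteq> lo s"
    then have "0 < \<bar>lo s - lo t\<bar>" by simp
    then obtain d where d: "d > 0" "\<And>x. x \<in> {t0..T} \<Longrightarrow> \<bar>x - t\<bar> < d \<Longrightarrow> \<bar>lo x - lo t\<bar> < \<bar>lo s - lo t\<bar>"
      using near[OF cont_lo, of t "\<bar>lo s - lo t\<bar>"] t ss by auto
    define x where "x = max s (t - d/2)"
    have x: "s \<le> x" "x < t" "\<bar>x - t\<bar> < d" using d t ss by (auto simp: x_def)
    then have "lo x = lo s" using gap_lo_const_open[of x] t by simp
    then show False using d(2)[of x] x t ss by auto
  qed
qed

lemma gap_on_hi: "s < t \<Longrightarrow> t < s' \<Longrightarrow> al t + bet t = hi t"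
  using on_boundary[of t] gap_above_lo[of t] ss by auto

text \<open>As the energy is constant and the surplus is zero, \<open>Phi_plus_step\<close> bounds
  the component of the displacement along \<open>dir_plus\<close> from below, and
  \<open>unit_push\<close> applies. In \<open>2 + 2 * pi\<close>, the error of
  \<open>Phi_plus_step\<close> accounts for \<open>1 + 2 * pi\<close> and the replacement of
  \<open>u a\<close> by \<open>u b\<close> for 1.\<close>

lemma gap_step:
  assumes ab: "s < a" "a < b" "b < s'"
  shows "norm (pos b - pos a - (b - a) *\<^sub>R dir_plus a) \<le> (b - a) * sqrt (2 * ((2 + 2*pi) * (u a - u b) / u a))"
proof -
  have in_: "a \<in> {t0..T}" "b \<in> {t0..T}" using ab ss by auto
  have ua: "u a > 0" using u_pos[of a] ab ss by auto
  define k where "k = (2 + 2*pi) * (u a - u b) / u a"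
  have uab: "u b \<le> u a" using u_antimono[of a b] ab ss by auto
  have k: "0 \<le> k" using uab ua by (simp add: k_def)
  have "lo b = lo a" using gap_lo_const[of a] gap_lo_const[of b] ab by simp
  from Phi_plus_step[OF _ _ _ this]
  have "- ((pos b - pos a) \<bullet> W (lo a) (u a)) - (1 + 2*pi) * (b - a) * (u a - u b) \<le> Phi_plus b - Phi_plus a"
    using ab ss by auto
  also have "Phi_plus b - Phi_plus a = Phi b - Phi a"
    using off_pos[of a] off_pos[of b] ab by (simp add: Phi_eq_Phi_plus)
  also have "\<dots> = - (elapsed b - elapsed a)"
    using Phi_elapsed_const[OF in_(1)] Phi_elapsed_const[OF in_(2)] by simp
  also have "\<dots> \<le> - (u b * (b - a))" using elapsed_diff(1)[of a b] ab ss by auto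
  finally have 1: "u b * (b - a) - (1 + 2*pi) * (b - a) * (u a - u b) \<le> u a * ((pos b - pos a) \<bullet> dir_plus a)"
    by (simp add: W_eq)
  have "u a * ((b - a) * (1 - k)) = u b * (b - a) - (1 + 2*pi) * (b - a) * (u a - u b)"
    using ua by (simp add: k_def field_simps)
  with 1 have "u a * ((b - a) * (1 - k)) \<le> u a * ((pos b - pos a) \<bullet> dir_plus a)" by simp
  then have push: "(b - a) * (1 - k) \<le> (pos b - pos a) \<bullet> dir_plus a" using ua by simp
  have "(norm ((pos b - pos a) - (b - a) *\<^sub>R dir_plus a))\<^sup>2 \<le> 2 * k * (b - a)\<^sup>2"
    by (rule unit_push[OF _ _ push]) (use pos_diff[OF in_] ab in \<open>auto simp: dir_plus_def\<close>)
  then have "norm ((pos b - pos a) - (b - a) *\<^sub>R dir_plus a) \<le> sqrt (2 * k * (b - a)\<^sup>2)"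
    by (rule real_le_rsqrt)
  also have "\<dots> = (b - a) * sqrt (2 * k)" using ab k by (simp add: real_sqrt_mult)
  finally show ?thesis by (simp add: k_def)
qed

lemma cont_dir_plus: "continuous_on {t0..T} dir_plus"
  unfolding dir_plus_def by (intro continuous_intros cont_hi cont_comp_u[OF cont_\<psi>]) auto

text \<open>The square root in \<open>gap_step\<close> tends to 0 because \<open>u\<close> is
  continuous, so the steps are straight to first order. For \<open>x < t\<close> the step starts at
  \<open>x\<close> and follows \<open>dir_plus x\<close>, which is why \<open>f\<close> also
  contains the change of \<open>dir_plus\<close>.\<close>

lemma gap_deriv:
  assumes t: "s < t" "t < s'"
  shows "(pos has_vector_derivative dir_plus t) (at t)"
proof -
  have tin: "t \<in> {t0..T}" using t ss by auto
  have ut: "u t > 0" using u_pos[of t] t ss by auto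
  define f where "f x = sqrt (2 * ((2 + 2*pi) * \<bar>u x - u t\<bar> / u t)) + norm (dir_plus x - dir_plus t)" for x
  have contf: "continuous_on {t0..T} f"
    unfolding f_def using ut by (intro continuous_intros cont_u cont_dir_plus) auto
  have bound: "norm (pos x - pos t - (x - t) *\<^sub>R dir_plus t) \<le> f x * \<bar>x - t\<bar>" if x: "s < x" "x < s'" for x
  proof (cases "x = t")
    case False
    have sq: "sqrt (2 * ((2 + 2*pi) * (u a - u b) / u a)) \<le> sqrt (2 * ((2 + 2*pi) * \<bar>u x - u t\<bar> / u t))"
      if "u b \<le> u a" "u t \<le> u a" "u a - u b \<le> \<bar>u x - u t\<bar>" for a b
      using that ut by (intro real_sqrt_le_mono mult_left_mono frac_le) auto
    show ?thesis
    proof (cases "x < t")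
      case True
      have eq: "pos x - pos t - (x - t) *\<^sub>R dir_plus t = - (pos t - pos x - (t - x) *\<^sub>R dir_plus x) - (t - x) *\<^sub>R (dir_plus x - dir_plus t)"
        by (simp add: algebra_simps)
      have "norm (pos x - pos t - (x - t) *\<^sub>R dir_plus t)
          \<le> norm (pos t - pos x - (t - x) *\<^sub>R dir_plus x) + norm ((t - x) *\<^sub>R (dir_plus x - dir_plus t))"
        unfolding eq by (rule order_trans[OF norm_triangle_ineq4]) (simp only: norm_minus_cancel order_refl)
      also have "\<dots> \<le> (t - x) * sqrt (2 * ((2 + 2*pi) * \<bar>u x - u t\<bar> / u t)) + (t - x) * norm (dir_plus x - dir_plus t)"
      proof (rule add_mono)
        have "u t \<le> u x" using u_antimono[of x t] x t True ss by auto
        then have "sqrt (2 * ((2 + 2*pi) * (u x - u t) / u x)) \<le> sqrt (2 * ((2 + 2*pi) * \<bar>u x - u t\<bar> / u t))"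
          by (intro sq) auto
        then show "norm (pos t - pos x - (t - x) *\<^sub>R dir_plus x) \<le> (t - x) * sqrt (2 * ((2 + 2*pi) * \<bar>u x - u t\<bar> / u t))"
          using gap_step[OF x(1) True t(2)] True by (meson diff_ge_0_iff_ge less_imp_le mult_left_mono order_trans)
      qed (use True in simp)
      also have "\<dots> = f x * \<bar>x - t\<bar>" using True by (simp add: f_def algebra_simps)
      finally show ?thesis .
    next
      case False
      with \<open>x \<noteq> t\<close> have tx: "t < x" by simp
      have "u x \<le> u t" using u_antimono[of t x] x t tx ss by auto
      then have "sqrt (2 * ((2 + 2*pi) * (u t - u x) / u t)) \<le> sqrt (2 * ((2 + 2*pi) * \<bar>u x - u t\<bar> / u t))"
        by (intro sq) auto
      also have "\<dots> \<le> f x" by (simp add: f_def)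
      finally have "(x - t) * sqrt (2 * ((2 + 2*pi) * (u t - u x) / u t)) \<le> (x - t) * f x"
        using tx by (intro mult_left_mono) auto
      from order_trans[OF gap_step[OF t(1) tx x(2)] this] tx show ?thesis by (simp add: mult.commute)
    qed
  qed simp
  show ?thesis
    unfolding has_vector_derivative_def has_derivative_at_alt
  proof (intro conjI allI impI)
    show "bounded_linear (\<lambda>h. h *\<^sub>R dir_plus t)" by (rule bounded_linear_scaleR_left)
    fix e :: real assume e: "0 < e"
    obtain d where d: "d > 0" "\<And>x. x \<in> {t0..T} \<Longrightarrow> \<bar>x - t\<bar> < d \<Longrightarrow> \<bar>f x - f t\<bar> < e"
      using near[OF contf tin e] by auto
    show "\<exists>d>0. \<forall>y. norm (y - t) < d \<longrightarrow> norm (pos y - pos t - (y - t) *\<^sub>R dir_plus t) \<le> e * norm (y - t)"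
    proof (intro exI[of _ "min d (min (t - s) (s' - t))"] conjI allI impI)
      show "0 < min d (min (t - s) (s' - t))" using d t by simp
      fix y assume "norm (y - t) < min d (min (t - s) (s' - t))"
      then have y: "\<bar>y - t\<bar> < d" "s < y" "y < s'" by (auto simp: abs_if split: if_splits)
      then have "\<bar>f y - f t\<bar> < e" using d(2)[of y] ss by auto
      then have "f y \<le> e" by (simp add: f_def)
      then have "f y * \<bar>y - t\<bar> \<le> e * \<bar>y - t\<bar>" by (intro mult_right_mono) auto
      then show "norm (pos y - pos t - (y - t) *\<^sub>R dir_plus t) \<le> e * norm (y - t)"
        using bound[OF y(2,3)] by simp
    qed
  qed
qed

text \<open>At every tip the path is on the tangent at \<open>lo\<close>, which does not change on
  this side. But the field moves strictly away from that tangent: the rate is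
  \<open>- sin (2 * half t - \<psi>)\<close>, and before a tip \<open>half t < pi/2\<close>, so that
  \<open>u t \<ge> 1/2\<close> and \<psi> \<le> pi/4, while
  \<open>half t \<ge> pi/6\<close>.\<close>

lemma gap_plus_tips: "tip s \<Longrightarrow> tip s' \<Longrightarrow> False"
proof -
  assume tips: "tip s" "tip s'"
  have in_: "s \<in> {t0..T}" "s' \<in> {t0..T}" using ss by auto
  let ?f = "\<lambda>t. pos t \<bullet> unit_vec (lo s)"
  have one: "pos t \<bullet> unit_vec (lo t) = 1" if "t \<in> {t0..T}" "tip t" for t
  proof -
    have "al t - lo t = bet t" using tip_facts(3)[OF that] by simp
    then show ?thesis using bet_bounds[OF that(1)] by (simp add: inner_pos)
  qed
  have "lo s' = lo s" using gap_lo_const[of s'] ss by simp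
  then have "?f s' = ?f s" using one in_ tips by metis
  moreover have "?f s' < ?f s"
  proof (rule DERIV_neg_imp_decreasing_open[OF ss(2)])
    show "continuous_on {s..s'} ?f"
      using ss by (intro continuous_intros continuous_on_subset[OF cont_pos]) auto
    fix t assume t: "s < t" "t < s'"
    have tin: "t \<in> {t0..T}" using t ss by auto
    have d: "(?f has_real_derivative dir_plus t \<bullet> unit_vec (lo s)) (at t)"
      using has_real_derivative_inner[OF gap_deriv[OF t] has_vector_derivative_const[of "unit_vec (lo s)"]] by simp
    have "half t \<le> half s'" using half_mono[of t s'] t ss by auto
    then have h: "half t < pi/2" using tip_facts(4)[OF in_(2) tips(2)] by simp
    have "1/2 \<le> u t" "u t \<le> 1" using h u_bounds[OF tin] by (auto simp: u_def field_simps)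
    then have \<psi>: "\<psi> (u t) \<le> pi/4" "0 < \<psi> (u t)" using \<psi>_le_pi4 \<psi>_bounds[OF u_in[OF tin]] by auto
    have "hi t = lo s + 2 * half t" using gap_lo_const[of t] t by (simp add: hi_eq)
    then have "dir_plus t \<bullet> unit_vec (lo s) = cos ((2 * half t - \<psi> (u t)) + pi/2)"
      by (simp add: dir_plus_def inner_unit_vec algebra_simps)
    also have "\<dots> = - sin (2 * half t - \<psi> (u t))" by (simp add: cos_add)
    also have "\<dots> < 0"
    proof -
      have "0 < sin (2 * half t - \<psi> (u t))"
        using half_ge[OF tin] h \<psi> pi_gt_zero by (intro sin_gt_zero) linarith+
      then show ?thesis by simp
    qed
    finally show "\<exists>y. (?f has_real_derivative y) (at t) \<and> y < 0" using d by blast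
  qed
  ultimately show False by simp
qed

end

lemma off_nonzero:
  assumes t: "t0 \<le> t" "t < T" and nt: "\<not> tip t"
  shows "off t \<noteq> 0"
proof -
  have "t \<in> {t0..T}" using t by auto
  then show ?thesis
    using on_boundary[OF t] nt off_on_hi[of t] off_on_lo[of t] by (auto simp: tip_def)
qed

lemma off_sign:
  assumes ss: "t0 \<le> s" "s < s'" "s' \<le> T" and nt: "\<And>t. s < t \<Longrightarrow> t < s' \<Longrightarrow> \<not> tip t"
  shows "(\<forall>t. s < t \<and> t < s' \<longrightarrow> 0 < off t) \<or> (\<forall>t. s < t \<and> t < s' \<longrightarrow> off t < 0)"
proof (rule ccontr)
  have nz: "off t \<noteq> 0" if "s < t" "t < s'" for t
    using off_nonzero[of t] nt that ss by auto
  assume "\<not> ?thesis"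
  then obtain x y where xy: "s < x" "x < s'" "off x < 0" "s < y" "y < s'" "0 < off y"
    using nz by (metis linorder_neqE_linordered_idom)
  have "\<exists>z. s < z \<and> z < s' \<and> off z = 0"
  proof (cases "x \<le> y")
    case True
    have "continuous_on {x..y} off" using xy ss by (intro continuous_on_subset[OF cont_off]) auto
    then obtain z where "x \<le> z" "z \<le> y" "off z = 0"
      using IVT'[of off x 0 y] xy True by auto
    then show ?thesis using xy by (intro exI[of _ z]) auto
  next
    case False
    have "continuous_on {y..x} off" using xy ss by (intro continuous_on_subset[OF cont_off]) auto
    then obtain z where "y \<le> z" "z \<le> x" "off z = 0"
      using IVT2'[of off x 0 y] xy False by auto
    then show ?thesis using xy by (intro exI[of _ z]) auto
  qed
  then show False using nz by blast
qed

lemma consecutive_tips: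
  assumes ss: "t0 \<le> s" "s < s'" "s' \<le> T" and nt: "\<And>t. s < t \<Longrightarrow> t < s' \<Longrightarrow> \<not> tip t"
    and tips: "tip s" "tip s'"
  shows False
proof -
  interpret mir: optimal_path \<psi> t0 T \<theta> "\<lambda>t. - al t" r by (rule optimal_mirror)
  from off_sign[OF ss nt] show False
  proof
    assume "\<forall>t. s < t \<and> t < s' \<longrightarrow> 0 < off t"
    then show False using gap_plus_tips[OF ss nt _ tips] by blast
  next
    assume "\<forall>t. s < t \<and> t < s' \<longrightarrow> off t < 0"
    then have *: "0 < mir.off t" if "s < t" "t < s'" for t using that by (simp add: mirror_simps)
    have "\<not> mir.tip t" if "s < t" "t < s'" for t using nt that by (simp add: mirror_simps)
    from mir.gap_plus_tips[OF ss this *] show False using tips by (simp add: mirror_simps)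
  qed
qed

lemma tips_before_tip:
  assumes t1: "t1 \<in> {t0..T}" "tip t1" and t: "t0 \<le> t" "t \<le> t1"
  shows "tip t"
proof (rule ccontr)
  assume nt: "\<not> tip t"
  obtain q where q: "t0 \<le> q" "q \<le> t" "tip q" "\<And>x. q < x \<Longrightarrow> x \<le> t \<Longrightarrow> \<not> tip x"
    using last_tip[of t0 t] t t1 tip_start by auto
  have "continuous_on {t..t1} (\<lambda>x. half x - bet x)"
    using t t1 by (intro continuous_intros continuous_on_subset[OF cont_half] continuous_on_subset[OF cont_bet]) auto
  moreover have "0 < half t - bet t" using nt bet_le_half[of t] t t1 by (auto simp: tip_def)
  moreover have "half t1 - bet t1 \<le> 0" using t1 by (simp add: tip_def)
  ultimately obtain p where p: "t < p" "p \<le> t1" "half p - bet p \<le> 0"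
    and before: "\<And>y. t \<le> y \<Longrightarrow> y < p \<Longrightarrow> 0 < half y - bet y"
    using first_below[of t t1 "\<lambda>x. half x - bet x" 0] t by auto
  have "tip p" using p bet_le_half[of p] t t1 by (auto simp: tip_def)
  moreover have "\<not> tip x" if "q < x" "x < p" for x
    using q(4)[of x] before[of x] that by (cases "x \<le> t") (auto simp: tip_def)
  ultimately show False using consecutive_tips[of q p] q p t t1 by auto
qed

text \<open>All points before a later tip would be tips. Moving along tips is prolonging the
  deployment, and the resulting cost comparison would give
  \<open>phase_cost (half t1) \<le> phase_cost \<theta>\<close>, although \<open>phase_cost\<close>
  increases strictly beyond \<theta>, the minimizer.\<close>

lemma tip_only_start:
  assumes t1: "t1 \<in> {t0..T}" "tip t1"
  shows "t1 = t0"
proof (rule ccontr)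
  assume "t1 \<noteq> t0"
  with t1 have less: "t0 < t1" by auto
  have tips: "tip t" if "t \<in> {t0..t1}" for t using tips_before_tip[OF t1] that by auto
  let ?f = "\<lambda>t. elapsed t - deployment_cost (half t)"
  have half_rng: "0 \<le> half t" "half t < pi/2" if "t \<in> {t0..t1}" for t
    using tip_facts(4)[OF _ tips[OF that]] half_bounds[of t] that t1 \<theta> by auto
  have "?f t0 \<le> ?f t1"
  proof (rule dini_nondecreasing[of t0 t1 ?f])
    have "continuous_on {0..half t1} deployment_cost"
      using half_rng[of t1] less
      by (intro continuous_at_imp_continuous_on ballI DERIV_isCont[OF deriv_deployment_cost]) auto
    then have "continuous_on {t0..t1} (\<lambda>t. deployment_cost (half t))"
    proof (rule continuous_on_compose2)
      show "continuous_on {t0..t1} half" using t1 by (intro continuous_on_subset[OF cont_half]) auto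
      show "half ` {t0..t1} \<subseteq> {0..half t1}" using half_rng half_mono[of _ t1] t1 by auto
    qed
    then show "continuous_on {t0..t1} ?f"
      using t1 by (intro continuous_intros continuous_on_subset[OF cont_elapsed]) auto
    fix x e :: real assume x: "t0 < x" "x < t1" and e: "0 < e"
    have xin: "x \<in> {t0..T}" using x t1 by auto
    obtain d where d: "d > 0" "\<And>s. s \<in> {t0..T} \<Longrightarrow> \<bar>s - x\<bar> < d \<Longrightarrow> \<bar>u s - u x\<bar> < e"
      using near[OF cont_u xin e] by auto
    show "\<exists>d>0. \<forall>s. x < s \<and> s < x + d \<and> s \<le> t1 \<longrightarrow> - (e * (s - x)) \<le> ?f s - ?f x"
    proof (intro exI[of _ d] conjI allI impI d(1))
      fix s assume s: "x < s \<and> s < x + d \<and> s \<le> t1"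
      have sT: "s \<in> {t0..T}" using s x t1 by auto
      have "deployment_cost (half s) - deployment_cost (half x) \<le> u x * (r s - r x)"
        using tips_deployment_diff[of x s] tips[of x] tips[of s] s x t1 by auto
      also have "\<dots> \<le> u x * (s - x)"
        using r_diff[OF xin sT] u_bounds[OF xin] s by (intro mult_left_mono) auto
      finally have 1: "deployment_cost (half s) - deployment_cost (half x) \<le> u x * (s - x)" .
      have 2: "u s * (s - x) \<le> elapsed s - elapsed x" using elapsed_diff(1)[of x s] s x t1 by auto
      have "\<bar>u s - u x\<bar> < e" using d(2)[OF sT] s by auto
      then have "u x - u s \<le> e" by linarith
      then have "(u x - u s) * (s - x) \<le> e * (s - x)" using s by (intro mult_right_mono) auto
      then show "- (e * (s - x)) \<le> ?f s - ?f x" using 1 2 by (simp add: algebra_simps)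
    qed
  qed (use less in auto)
  moreover have "elapsed t1 - elapsed t0 = inspection_cost \<theta> - inspection_cost (half t1)"
    using Phi_elapsed_const[OF t1(1)] Phi_tip[OF t1] Phi_tip[OF _ tip_start] t0_le by (simp add: half_start)
  ultimately have "phase_cost (half t1) \<le> phase_cost \<theta>"
    by (simp add: half_start phase_cost_def)
  moreover have "phase_cost \<theta> < phase_cost (half t1)"
    using half_strict[OF order_refl less] half_rng[of t1] less t1 \<theta>_eq by (intro phase_cost_increasing) (auto simp: half_start)
  ultimately show False by simp
qed

lemma off_sign_all:
  "(\<forall>t. t0 < t \<and> t < T \<longrightarrow> 0 < off t) \<or> (\<forall>t. t0 < t \<and> t < T \<longrightarrow> off t < 0)"
proof (rule off_sign)
  fix t assume "t0 < t" "t < T"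
  then show "\<not> tip t" using tip_only_start[of t] by auto
qed (use t0T in auto)

end

section \<open>The tangent length along the path\<close>

context optimal_path
begin

definition tlen :: "real \<Rightarrow> real" where "tlen t = r t * sin (bet t)"

lemma tlen_pos: "t \<in> {t0..T} \<Longrightarrow> 0 < tlen t"
  using bet_bounds[of t] r_gt[of t] by (auto simp: tlen_def intro!: mult_pos_pos sin_gt_zero)

lemma tlen_start: "tlen t0 = tan \<theta>"
proof -
  have "tlen t0 = t0 * sin \<theta>" by (simp add: tlen_def bet_start r_start)
  also have "\<dots> = tan \<theta>" by (simp add: t0 tan_def)
  finally show ?thesis .
qed

context
  assumes plus: "\<And>t. t0 < t \<Longrightarrow> t < T \<Longrightarrow> 0 < off t"
begin

lemma no_tip: "t0 < t \<Longrightarrow> t < T \<Longrightarrow> \<not> tip t"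
  using tip_only_start[of t] by auto

lemma lo_eq: "t \<in> {t0..T} \<Longrightarrow> lo t = - \<theta>"
  using gap_lo_const[OF order_refl t0T order_refl no_tip plus, of t] lo_start by auto

lemma on_hi_open: "t0 < t \<Longrightarrow> t < T \<Longrightarrow> al t + bet t = hi t"
  using gap_on_hi[OF order_refl t0T order_refl no_tip plus, of t] by auto

lemma on_hi:
  assumes t: "t \<in> {t0..T}"
  shows "al t + bet t = hi t"
proof -
  consider "t = t0" | "t0 < t" "t < T" | "t = T" using t by force
  then show ?thesis
  proof cases
    case 1
    then show ?thesis by (simp add: al_start bet_start hi_start)
  next
    case 2
    then show ?thesis by (rule on_hi_open)
  next
    case 3
    show ?thesis
    proof (rule ccontr)
      let ?g = "\<lambda>x. hi x - (al x + bet x)"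
      assume "al t + bet t \<noteq> hi t"
      then have "0 < \<bar>?g t\<bar>" by simp
      moreover have "continuous_on {t0..T} ?g"
        by (intro continuous_intros cont_hi cont_al cont_bet)
      ultimately obtain d where d: "d > 0" "\<And>x. x \<in> {t0..T} \<Longrightarrow> \<bar>x - t\<bar> < d \<Longrightarrow> \<bar>?g x - ?g t\<bar> < \<bar>?g t\<bar>"
        using near[of ?g t "\<bar>?g t\<bar>"] t by blast
      define x where "x = max ((t0 + T) / 2) (T - d/2)"
      have x1: "t0 < x" "x < T" "T - d/2 \<le> x" using d t0T by (auto simp: x_def less_max_iff_disj)
      then have x: "t0 < x" "x < T" "\<bar>x - t\<bar> < d" using d 3 by auto
      then have "?g x = 0" using on_hi_open by simp
      then show False using d(2)[of x] x by auto
    qed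
  qed
qed

lemma hi_u: "t \<in> {t0..T} \<Longrightarrow> hi t = 2 * pi - \<theta> - 2 * pi * u t"
  using lo_eq[of t] hi_eq[of t] pi_u[of t] by linarith

lemma deriv_pos: "t0 < t \<Longrightarrow> t < T \<Longrightarrow> (pos has_vector_derivative dir_plus t) (at t)"
  using gap_deriv[OF order_refl t0T order_refl no_tip plus, of t] by auto

text \<open>\<open>hi\<close> is differentiable since it is determined by \<open>pos t \<bullet> unit_vec (hi t) = 1\<close>.\<close>

lemma deriv_hi:
  assumes t: "t0 < t" "t < T"
  shows "(hi has_real_derivative sin (\<psi> (u t)) / tlen t) (at t)"
proof -
  have tin: "t \<in> {t0..T}" using t by auto
  have one: "pos x \<bullet> unit_vec (hi x) = 1" if "x \<in> {t0..T}" for x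
  proof -
    have "al x - hi x = - bet x" using on_hi[OF that] by simp
    then show ?thesis using bet_bounds[OF that] by (simp add: inner_pos)
  qed
  let ?g = "\<lambda>\<phi>. pos t \<bullet> unit_vec \<phi>"
  have "al t - hi t = - bet t" using on_hi[OF tin] by simp
  then have "(?g has_real_derivative - tlen t) (at (hi t))"
    unfolding inner_pos by (auto intro!: derivative_eq_intros simp: tlen_def)
  \<comment> \<open>Caratheodory's form of the derivative with respect to the angle: it isolates the
    increment of \<open>hi\<close> as a factor without presupposing that \<open>hi\<close> is
    differentiable.\<close>
  then obtain q where q: "\<And>z. ?g z - ?g (hi t) = q z * (z - hi t)" "isCont q (hi t)" "q (hi t) = - tlen t"
    unfolding CARAT_DERIV by blast
  have nz: "q (hi t) \<noteq> 0" using q(3) tlen_pos[OF tin] by simp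
  have conthi: "isCont hi t" using continuous_on_interior[OF cont_hi, of t] t by auto
  have q': "((\<lambda>x. q (hi x)) \<longlongrightarrow> q (hi t)) (at t)"
    using continuous_at_compose[OF conthi] q(2) by (auto simp: isCont_def o_def)
  have comp: "((\<lambda>x. fst (pos x)) has_real_derivative fst (dir_plus t)) (at t)"
    "((\<lambda>x. snd (pos x)) has_real_derivative snd (dir_plus t)) (at t)"
    using has_real_derivative_inner[OF deriv_pos[OF t] has_vector_derivative_const[of "(1, 0)"]]
      has_real_derivative_inner[OF deriv_pos[OF t] has_vector_derivative_const[of "(0, 1)"]]
    by (simp_all add: inner_prod_def flip: zero_prod_def)
  let ?h = "\<lambda>x. - ((fst (pos x) - fst (pos t)) / (x - t) * cos (hi x) + (snd (pos x) - snd (pos t)) / (x - t) * sin (hi x)) / q (hi x)"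
  have "(?h \<longlongrightarrow> - (fst (dir_plus t) * cos (hi t) + snd (dir_plus t) * sin (hi t)) / q (hi t)) (at t)"
    using conthi[unfolded isCont_def] comp[unfolded has_field_derivative_iff]
    by (intro tendsto_intros q' nz)
  moreover have "- (fst (dir_plus t) * cos (hi t) + snd (dir_plus t) * sin (hi t)) / q (hi t) = sin (\<psi> (u t)) / tlen t"
  proof -
    have "fst (dir_plus t) * cos (hi t) + snd (dir_plus t) * sin (hi t) = dir_plus t \<bullet> unit_vec (hi t)"
      by (simp add: unit_vec_def inner_prod_def)
    also have "\<dots> = cos (pi/2 - \<psi> (u t))" by (simp add: dir_plus_def inner_unit_vec)
    also have "\<dots> = sin (\<psi> (u t))" by (simp add: cos_diff)
    finally show ?thesis by (simp add: q(3))
  qed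
  moreover have "eventually (\<lambda>x. ?h x = (hi x - hi t) / (x - t)) (at t)"
  proof -
    have "eventually (\<lambda>x. q (hi x) \<noteq> 0) (at t)"
      using tendsto_imp_eventually_ne[OF q' nz] .
    moreover have "eventually (\<lambda>x. x \<in> {t0<..<T}) (at t)"
      using t by (intro eventually_at_in_open') auto
    moreover have "eventually (\<lambda>x. x \<noteq> t) (at t)" by (simp add: eventually_at_filter)
    ultimately show ?thesis
    proof eventually_elim
      case (elim x)
      have "(pos x - pos t) \<bullet> unit_vec (hi x) = - (q (hi x) * (hi x - hi t))"
        using q(1)[of "hi x"] one[of x] one[OF tin] elim by (simp add: inner_diff_left)
      then have "(fst (pos x) - fst (pos t)) * cos (hi x) + (snd (pos x) - snd (pos t)) * sin (hi x) = - (q (hi x) * (hi x - hi t))"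
        by (simp add: unit_vec_def inner_prod_def)
      then have "?h x = (q (hi x) * (hi x - hi t)) / (x - t) / q (hi x)"
        by (simp add: add_divide_distrib[symmetric])
      then show ?case using elim by simp
    qed
  qed
  ultimately show ?thesis
    unfolding has_field_derivative_iff by (simp add: tendsto_cong)
qed

lemma deriv_u:
  assumes t: "t0 < t" "t < T"
  shows "(u has_real_derivative - sin (\<psi> (u t)) / (2 * pi * tlen t)) (at t)"
proof -
  have d: "((\<lambda>x. 1 - (hi x + \<theta>) / (2 * pi)) has_real_derivative - sin (\<psi> (u t)) / (2 * pi * tlen t)) (at t)"
    by (auto intro!: derivative_eq_intros deriv_hi[OF t])
  have "1 - (hi x + \<theta>) / (2 * pi) = u x" if "x \<in> {t0<..<T}" for x
    using hi_u[of x] that by (simp add: field_simps)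
  note eq = this
  show ?thesis
    by (rule has_field_derivative_transform_within_open[OF d, of "{t0<..<T}"]) (use t eq in auto)
qed

lemma deriv_tlen:
  assumes t: "t0 < t" "t < T"
  shows "(tlen has_real_derivative sin (\<psi> (u t)) / tlen t - cos (\<psi> (u t))) (at t)"
proof -
  have tlen_eq: "tlen x = pos x \<bullet> unit_vec (hi x - pi/2)" if "x \<in> {t0..T}" for x
  proof -
    have "al x - (hi x - pi/2) = pi/2 - bet x" using on_hi[OF that] by simp
    then have "cos (al x - (hi x - pi/2)) = cos (pi/2 - bet x)" by (simp only:)
    also have "\<dots> = sin (bet x)" by (simp add: cos_diff)
    finally show ?thesis by (simp only: inner_pos tlen_def)
  qed
  have tin: "t \<in> {t0..T}" using t by auto
  have "((\<lambda>x. hi x - pi/2) has_real_derivative sin (\<psi> (u t)) / tlen t) (at t)"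
    by (auto intro!: derivative_eq_intros deriv_hi[OF t])
  from has_real_derivative_inner[OF deriv_pos[OF t] has_vector_derivative_unit_vec[OF this]]
  have "((\<lambda>x. pos x \<bullet> unit_vec (hi x - pi/2)) has_real_derivative
     sin (\<psi> (u t)) / tlen t * (pos t \<bullet> unit_vec (hi t)) + dir_plus t \<bullet> unit_vec (hi t - pi/2)) (at t)"
    by simp
  moreover have "pos t \<bullet> unit_vec (hi t) = 1"
  proof -
    have "al t - hi t = - bet t" using on_hi[OF tin] by simp
    then show ?thesis using bet_bounds[OF tin] by (simp add: inner_pos)
  qed
  moreover have "dir_plus t \<bullet> unit_vec (hi t - pi/2) = - cos (\<psi> (u t))"
  proof -
    have "hi t + pi/2 - \<psi> (u t) - (hi t - pi/2) = pi - \<psi> (u t)" by simp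
    then show ?thesis by (simp add: dir_plus_def inner_unit_vec cos_diff)
  qed
  ultimately have "((\<lambda>x. pos x \<bullet> unit_vec (hi x - pi/2)) has_real_derivative
     sin (\<psi> (u t)) / tlen t - cos (\<psi> (u t))) (at t)" by simp
  then show ?thesis
    by (rule has_field_derivative_transform_within_open[of _ _ _ "{t0<..<T}"]) (use t tlen_eq in auto)
qed

lemma cont_tlen: "continuous_on {t0..T} tlen"
  unfolding tlen_def by (intro continuous_intros cont_r cont_bet)

text \<open>Divided by the derivative of \<open>u\<close>, the derivative of \<open>tlen\<close>
  gives the linear equation of \<tau> in the variable \<open>u\<close>. Hence the difference, scaled
  by the integrating factor, is constant, and it is 0 at the end of the deployment.\<close>

lemma tlen_eq_\<tau>:
  assumes \<tau>: "\<And>x. x \<in> {0..1} \<Longrightarrow> (\<tau> has_real_derivative 2*pi * (\<tau> x * cot (\<psi> x) - 1)) (at x within {0..1})"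
    and start: "\<tau> (1 - \<theta>/pi) = tan \<theta>" and t: "t \<in> {t0..T}"
  shows "tlen t = \<tau> (u t)"
proof -
  have cont\<tau>: "continuous_on {0..1} \<tau>" by (rule DERIV_continuous_on) (use \<tau> in blast)
  let ?z = "\<lambda>t. (tlen t - \<tau> (u t)) * exp (- acc (u t))"
  have "continuous_on {t0..T} ?z"
    by (intro continuous_intros cont_tlen cont_comp_u[OF cont\<tau>] cont_comp_u[OF cont_acc])
  moreover have "(?z has_real_derivative 0) (at x)" if x: "t0 < x" "x < T" for x
  proof -
    have xin: "x \<in> {t0..T}" using x by auto
    have ux: "0 < u x" "u x < 1"
      using u_pos[of x] u_strict[of t0 x] u_bounds[of t0] x by auto
    have e: "at (u x) within {0..1} = at (u x)" using ux by (intro at_within_interior) auto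
    have s: "sin (\<psi> (u x)) > 0" using ux by (intro sin_\<psi>) auto
    have tx: "tlen x > 0" by (rule tlen_pos[OF xin])
    define S C where "S = sin (\<psi> (u x))" and "C = cos (\<psi> (u x))"
    have du: "(u has_real_derivative - S / (2 * pi * tlen x)) (at x)" using deriv_u[OF x] by (simp add: S_def)
    have d\<tau>: "(\<tau> has_real_derivative 2*pi * (\<tau> (u x) * (C / S) - 1)) (at (u x))"
      using \<tau>[of "u x"] ux e by (auto simp: cot_def S_def C_def)
    have dacc: "(acc has_real_derivative 2*pi * (C / S)) (at (u x))"
      using deriv_acc[of "u x"] ux e by (auto simp: cot_def S_def C_def)
    have 1: "((\<lambda>t. tlen t - \<tau> (u t)) has_real_derivative
        (S / tlen x - C) - 2*pi * (\<tau> (u x) * (C / S) - 1) * (- S / (2 * pi * tlen x))) (at x)"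
      using DERIV_diff[OF deriv_tlen[OF x] DERIV_chain2[OF d\<tau> du]] by (simp add: S_def C_def)
    have 2: "((\<lambda>t. exp (- acc (u t))) has_real_derivative
        exp (- acc (u x)) * (- (2*pi * (C / S) * (- S / (2 * pi * tlen x))))) (at x)"
      by (rule DERIV_chain2[OF DERIV_exp DERIV_minus[OF DERIV_chain2[OF dacc du]]])
    have 3: "(S / tlen x - C) - 2*pi * (\<tau> (u x) * (C / S) - 1) * (- S / (2 * pi * tlen x)) = - (C / tlen x) * (tlen x - \<tau> (u x))"
      using s tx by (simp add: S_def[symmetric] field_simps)
    have 4: "- (2*pi * (C / S) * (- S / (2 * pi * tlen x))) = C / tlen x"
      using s tx by (simp add: S_def[symmetric] field_simps)
    show ?thesis
      by (rule DERIV_cong[OF DERIV_mult[OF 1[unfolded 3] 2[unfolded 4]]]) (use tx in \<open>simp add: field_simps\<close>)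
  qed
  ultimately have "?z t = ?z t0"
    using DERIV_isconst2[OF t0T, of ?z t] t by auto
  also have "u t0 = 1 - \<theta>/pi" by (simp add: u_def half_start)
  then have "?z t0 = 0" using start tlen_start by simp
  finally show ?thesis by simp
qed

lemma curve_plus:
  assumes \<tau>: "\<And>x. x \<in> {0..1} \<Longrightarrow> (\<tau> has_real_derivative 2*pi * (\<tau> x * cot (\<psi> x) - 1)) (at x within {0..1})"
    and start: "\<tau> (1 - \<theta>/pi) = tan \<theta>" and t: "t \<in> {t0..T}"
  shows "r t *\<^sub>R unit_vec (al t + \<theta>) = curve \<tau> (u t)"
proof -
  have rc: "r t * cos (bet t) = 1" by (rule bet_bounds(4)[OF t])
  have tlen: "r t * sin (bet t) = \<tau> (u t)" using tlen_eq_\<tau>[OF assms] by (simp add: tlen_def)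
  have al: "al t + \<theta> = 2 * pi - (2 * pi * u t + bet t)" using on_hi[OF t] hi_u[OF t] by simp
  have c: "cos (al t + \<theta>) = cos (2 * pi * u t + bet t)" and s: "sin (al t + \<theta>) = - sin (2 * pi * u t + bet t)"
    unfolding al by (simp_all add: cos_diff sin_diff)
  have "r t * cos (2 * pi * u t + bet t) = (r t * cos (bet t)) * cos (2 * pi * u t) - (r t * sin (bet t)) * sin (2 * pi * u t)"
    "r t * - sin (2 * pi * u t + bet t) = - ((r t * cos (bet t)) * sin (2 * pi * u t)) - (r t * sin (bet t)) * cos (2 * pi * u t)"
    by (simp_all add: cos_add sin_add algebra_simps)
  then show ?thesis
    unfolding rc tlen by (simp add: unit_vec_def curve_def c s)
qed

end

lemma curve_up_to_reflection:
  assumes \<tau>: "\<And>x. x \<in> {0..1} \<Longrightarrow> (\<tau> has_real_derivative 2*pi * (\<tau> x * cot (\<psi> x) - 1)) (at x within {0..1})"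
    and start: "\<tau> (1 - \<theta>/pi) = tan \<theta>"
  shows "(\<forall>t\<in>{t0..T}. r t *\<^sub>R unit_vec (al t + \<theta>) = curve \<tau> (u t)) \<or>
         (\<forall>t\<in>{t0..T}. r t *\<^sub>R unit_vec (- al t + \<theta>) = curve \<tau> (u t))"
  using off_sign_all
proof
  assume "\<forall>t. t0 < t \<and> t < T \<longrightarrow> 0 < off t"
  then show ?thesis using curve_plus[OF _ \<tau> start] by blast
next
  assume neg: "\<forall>t. t0 < t \<and> t < T \<longrightarrow> off t < 0"
  interpret mir: optimal_path \<psi> t0 T \<theta> "\<lambda>t. - al t" r by (rule optimal_mirror)
  have "0 < mir.off t" if "t0 < t" "t < T" for t using neg that by (simp add: mirror_simps)
  from mir.curve_plus[OF this \<tau> start] show ?thesis by (simp add: mirror_simps)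
qed

lemma bij_betw_u: "bij_betw u {t0..T} {0..1 - \<theta>/pi}"
  unfolding bij_betw_def
proof
  show "inj_on u {t0..T}"
    by (rule linorder_inj_onI) (use u_strict in force)+
  have u0: "u t0 = 1 - \<theta>/pi" by (simp add: u_def half_start)
  show "u ` {t0..T} = {0..1 - \<theta>/pi}"
  proof
    show "u ` {t0..T} \<subseteq> {0..1 - \<theta>/pi}" using u_bounds u_antimono[of t0] u0 by auto
    show "{0..1 - \<theta>/pi} \<subseteq> u ` {t0..T}"
    proof
      fix x assume "x \<in> {0..1 - \<theta>/pi}"
      then obtain t where "t0 \<le> t" "t \<le> T" "u t = x"
        using IVT2'[of u T x t0, OF _ _ t0_le cont_u] u_end u0 by auto
      then show "x \<in> u ` {t0..T}" by auto
    qed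
  qed
qed

end

section \<open>Average cost from below and uniqueness of the curve\<close>

text \<open>Fubini for the region between the level \<open>c\<close> and the graph of
  \<open>g\<close>, sliced at constant \<open>t\<close>. A slice only has to contain an interval of
  length \<open>l t\<close>.\<close>

lemma layer_cake_lower_bound:
  fixes g l :: "real \<Rightarrow> real"
  assumes g: "g \<in> borel_measurable borel" and int: "g integrable_on {a..b}" and ab: "a \<le> b"
    and ge: "\<And>\<phi>. \<phi> \<in> {a..b} \<Longrightarrow> c \<le> g \<phi>"
    and cd: "c \<le> d" and contl: "continuous_on {c..d} l" and lnn: "\<And>t. t \<in> {c..d} \<Longrightarrow> 0 \<le> l t"
    and late: "\<And>t. c \<le> t \<Longrightarrow> t < d \<Longrightarrow> \<exists>x y. a \<le> x \<and> y \<le> b \<and> l t \<le> y - x \<and> (\<forall>\<phi>. x < \<phi> \<and> \<phi> < y \<longrightarrow> t < g \<phi>)"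
  shows "c * (b - a) + integral {c..d} l \<le> integral {a..b} g"
proof -
  define S where "S = {z \<in> space (lborel \<Otimes>\<^sub>M lborel). a \<le> fst z \<and> fst z \<le> b \<and> c \<le> snd z \<and> snd z < g (fst z)}"
  have [measurable]: "g \<in> borel_measurable lborel" using g by simp
  have S: "S \<in> sets (lborel \<Otimes>\<^sub>M lborel)" unfolding S_def by measurable
  have memS: "(\<phi>, t) \<in> S \<longleftrightarrow> a \<le> \<phi> \<and> \<phi> \<le> b \<and> c \<le> t \<and> t < g \<phi>" for \<phi> t
    by (simp add: S_def space_pair_measure)
  have gap: "((\<lambda>\<phi>. g \<phi> - c) has_integral integral {a..b} g - c * (b - a)) {a..b}"
    using has_integral_diff[OF integrable_integral[OF int] has_integral_const_real[of c a b]] ab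
    by (simp add: mult.commute)
  have "emeasure (lborel \<Otimes>\<^sub>M lborel) S = (\<integral>\<^sup>+\<phi>. emeasure lborel (Pair \<phi> -` S) \<partial>lborel)"
    by (rule lborel.emeasure_pair_measure_alt[OF S])
  also have "\<dots> = (\<integral>\<^sup>+\<phi>. ennreal (g \<phi> - c) * indicator {a..b} \<phi> \<partial>lborel)"
  proof (rule nn_integral_cong)
    fix \<phi> :: real
    show "emeasure lborel (Pair \<phi> -` S) = ennreal (g \<phi> - c) * indicator {a..b} \<phi>"
    proof (cases "\<phi> \<in> {a..b}")
      case True
      then have "Pair \<phi> -` S = {c..<g \<phi>}" by (auto simp: memS)
      then show ?thesis using True ge[OF True] by simp
    next
      case False
      then have "Pair \<phi> -` S = {}" by (auto simp: memS)
      then show ?thesis using False by simp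
    qed
  qed
  also have "\<dots> = ennreal (integral {a..b} g - c * (b - a))"
    by (rule nn_integral_has_integral_lebesgue'[OF _ gap]) (use ge in auto)
  finally have e1: "emeasure (lborel \<Otimes>\<^sub>M lborel) S = ennreal (integral {a..b} g - c * (b - a))" .
  have e2: "emeasure (lborel \<Otimes>\<^sub>M lborel) S = (\<integral>\<^sup>+t. emeasure lborel ((\<lambda>\<phi>. (\<phi>, t)) -` S) \<partial>lborel)"
    by (rule lborel_pair.emeasure_pair_measure_alt2[OF S])
  have "(l has_integral integral {c..d} l) {c..d}"
    by (intro integrable_integral integrable_continuous_interval contl)
  then have "ennreal (integral {c..d} l) = (\<integral>\<^sup>+t. ennreal (l t) * indicator {c..d} t \<partial>lborel)"
    by (intro nn_integral_has_integral_lebesgue'[symmetric]) (use lnn in auto)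
  also have "\<dots> \<le> (\<integral>\<^sup>+t. emeasure lborel ((\<lambda>\<phi>. (\<phi>, t)) -` S) \<partial>lborel)"
  proof (rule nn_integral_mono_AE)
    \<comment> \<open>\<open>late\<close> gives nothing at \<open>t = d\<close>, which is a null
      set.\<close>
    have "AE t in lborel. t \<noteq> d" by (rule AE_lborel_singleton)
    then show "AE t in lborel. ennreal (l t) * indicator {c..d} t \<le> emeasure lborel ((\<lambda>\<phi>. (\<phi>, t)) -` S)"
    proof eventually_elim
      case (elim t)
      show ?case
      proof (cases "t \<in> {c..d}")
        case True
        then have t: "c \<le> t" "t < d" using elim by auto
        obtain x y where xy: "a \<le> x" "y \<le> b" "l t \<le> y - x" "\<And>\<phi>. x < \<phi> \<Longrightarrow> \<phi> < y \<Longrightarrow> t < g \<phi>"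
          using late[OF t] by blast
        have "{x<..<y} \<subseteq> (\<lambda>\<phi>. (\<phi>, t)) -` S" using xy t by (auto simp: memS)
        moreover have "(\<lambda>\<phi>. (\<phi>, t)) -` S \<in> sets lborel"
          using sets_Pair2[OF S, of t] by simp
        ultimately have "emeasure lborel {x<..<y} \<le> emeasure lborel ((\<lambda>\<phi>. (\<phi>, t)) -` S)"
          by (rule emeasure_mono)
        moreover have "ennreal (l t) \<le> emeasure lborel {x<..<y}"
          using xy(3) lnn[OF True] by (simp add: ennreal_leI)
        ultimately show ?thesis using True by simp
      qed simp
    qed
  qed
  finally have "ennreal (integral {c..d} l) \<le> ennreal (integral {a..b} g - c * (b - a))"
    using e1 e2 by simp
  moreover have "0 \<le> integral {a..b} g - c * (b - a)"
    using has_integral_nonneg[OF gap] ge by auto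
  ultimately show ?thesis by (simp add: ennreal_le_iff)
qed

lemma norm_curve: "norm (curve \<tau> x) = sqrt (1 + (\<tau> x)\<^sup>2)"
proof -
  have "(c - t * s)\<^sup>2 + (- s - t * c)\<^sup>2 = (s\<^sup>2 + c\<^sup>2) * (1 + t\<^sup>2)" for c s t :: real
    by (simp add: power2_eq_square algebra_simps)
  then show ?thesis by (simp add: curve_def norm_Pair)
qed

lemma norm_curve_gt_1_iff: "1 < norm (curve \<tau> x) \<longleftrightarrow> \<tau> x \<noteq> 0"
  by (simp add: norm_curve)

lemma fst_curve_neq_1:
  assumes "0 < x" "x \<le> 1/2" "0 < \<tau> x"
  shows "fst (curve \<tau> x) \<noteq> 1"
proof -
  have "pi * x \<le> pi * (1/2)" "0 < pi * x" using assms by (auto intro!: mult_left_mono)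
  then have "0 < sin (pi * x)" "0 \<le> cos (pi * x)"
    by (intro sin_gt_zero cos_ge_zero; use pi_gt_zero in linarith)+
  then have "0 < sin (pi * x) + \<tau> x * cos (pi * x)" using assms by (simp add: add_pos_nonneg)
  then show ?thesis using fst_curve_eq_1_iff[of x \<tau>] assms by auto
qed

section \<open>Uniqueness for the system and positivity of the tangent length\<close>

lemma Sys_start: "Sys \<tau>0 \<psi> \<tau> \<Longrightarrow> \<psi> 0 = pi/2"
  unfolding Sys_def by blast

lemma Sys_sin_pos:
  assumes sys: "Sys \<tau>0 \<psi> \<tau>" and x: "x \<in> {0..1}"
  shows "0 < sin (\<psi> x)"
proof (rule ccontr)
  assume "\<not> 0 < sin (\<psi> x)"
  moreover have "continuous_on {0..x} (\<lambda>x. sin (\<psi> x))"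
    using sys x by (intro continuous_intros) (auto simp: Sys_def intro: continuous_on_subset)
  moreover have "sin (\<psi> 0) = 1" unfolding Sys_start[OF sys] by (rule sin_pi_half)
  ultimately obtain z where "0 \<le> z" "z \<le> x" "sin (\<psi> z) = 0"
    using IVT2'[of "\<lambda>x. sin (\<psi> x)" x 0 0] x by auto
  then show False using sys x by (auto simp: Sys_def)
qed

lemma Sys_deriv_x_cos:
  assumes sys: "Sys \<tau>0 \<psi> \<tau>" and x: "0 < x" "x < 1"
  shows "((\<lambda>x. x * cos (\<psi> x)) has_real_derivative 2 * pi * x * sin (\<psi> x)) (at x)"
proof -
  have "at x within {0..1} = at x" using x by (intro at_within_interior) auto
  moreover have "(\<psi> has_real_derivative - 2*pi + cot (\<psi> x) / x) (at x within {0..1})"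
    using sys x unfolding Sys_def by auto
  ultimately have d: "(\<psi> has_real_derivative - 2*pi + cot (\<psi> x) / x) (at x)" by simp
  have s: "sin (\<psi> x) > 0" using Sys_sin_pos[OF sys] x by simp
  show ?thesis
    by (rule derivative_eq_intros refl d)+ (use s x in \<open>simp add: cot_def field_simps\<close>)
qed

lemma Sys_cont_x_cos: "Sys \<tau>0 \<psi> \<tau> \<Longrightarrow> continuous_on {0..1} (\<lambda>x. x * cos (\<psi> x))"
  unfolding Sys_def by (intro continuous_intros) auto

lemma Sys_cos_nonneg:
  assumes sys: "Sys \<tau>0 \<psi> \<tau>" and x: "x \<in> {0..1}"
  shows "0 \<le> x * cos (\<psi> x)"
proof -
  have "0 * cos (\<psi> 0) \<le> x * cos (\<psi> x)"
  proof (rule DERIV_nonneg_imp_increasing_open[of 0 x "\<lambda>x. x * cos (\<psi> x)"])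
    fix y assume "0 < y" "y < x"
    then show "\<exists>d. ((\<lambda>x. x * cos (\<psi> x)) has_real_derivative d) (at y) \<and> 0 \<le> d"
      using Sys_deriv_x_cos[OF sys, of y] Sys_sin_pos[OF sys, of y] x
      by (intro exI[of _ "2 * pi * y * sin (\<psi> y)"]) auto
  qed (use x in \<open>auto intro: continuous_on_subset[OF Sys_cont_x_cos[OF sys]]\<close>)
  then show ?thesis by simp
qed

text \<open>Uniqueness: \<open>sin \<psi>\<close> decreases when \<open>cos \<psi>\<close> increases, so a positive difference of two
  solutions \<open>x cos \<psi>\<close> would be decreasing.\<close>

lemma Sys_x_cos_le:
  assumes sys1: "Sys a \<psi>1 \<tau>1" and sys2: "Sys b \<psi>2 \<tau>2" and x: "x \<in> {0..1}"
  shows "x * cos (\<psi>1 x) \<le> x * cos (\<psi>2 x)"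
proof (rule ccontr)
  let ?D = "\<lambda>x. x * cos (\<psi>1 x) - x * cos (\<psi>2 x)"
  assume "\<not> ?thesis"
  then have pos: "0 < ?D x" by simp
  have cont: "continuous_on {0..1} ?D"
    by (intro continuous_intros Sys_cont_x_cos[OF sys1] Sys_cont_x_cos[OF sys2])
  then have "continuous_on {0..x} ?D" by (rule continuous_on_subset) (use x in auto)
  then obtain x0 where x0: "0 \<le> x0" "x0 < x" "?D x0 \<le> 0"
    and above: "\<And>y. x0 < y \<Longrightarrow> y \<le> x \<Longrightarrow> 0 < ?D y"
    using last_below[of 0 x ?D 0] pos x by auto
  have "?D x \<le> ?D x0"
  proof (rule DERIV_nonpos_imp_decreasing_open[of x0 x ?D])
    fix y assume y: "x0 < y" "y < x"
    then have yin: "0 < y" "y < 1" "y \<in> {0..1}" using x0 x by auto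
    have d: "(?D has_real_derivative 2 * pi * y * sin (\<psi>1 y) - 2 * pi * y * sin (\<psi>2 y)) (at y)"
      by (intro DERIV_diff Sys_deriv_x_cos[OF sys1] Sys_deriv_x_cos[OF sys2] yin)
    have "y * cos (\<psi>2 y) < y * cos (\<psi>1 y)" using above[of y] y by simp
    moreover have "0 \<le> cos (\<psi>2 y)"
      using Sys_cos_nonneg[OF sys2 yin(3)] yin by (simp add: zero_le_mult_iff)
    ultimately have "(cos (\<psi>2 y))\<^sup>2 \<le> (cos (\<psi>1 y))\<^sup>2" using yin by (intro power_mono) auto
    then have "(sin (\<psi>1 y))\<^sup>2 \<le> (sin (\<psi>2 y))\<^sup>2" by (simp add: sin_squared_eq)
    then have "sin (\<psi>1 y) \<le> sin (\<psi>2 y)"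
      by (rule power2_le_imp_le) (use Sys_sin_pos[OF sys2 yin(3)] in simp)
    then have "2 * pi * y * sin (\<psi>1 y) \<le> 2 * pi * y * sin (\<psi>2 y)"
      using yin by (intro mult_left_mono) auto
    then show "\<exists>z. (?D has_real_derivative z) (at y) \<and> z \<le> 0" using d by force
  qed (use x0 x in \<open>auto intro: continuous_on_subset[OF cont]\<close>)
  then show False using x0 pos by simp
qed

lemma Sys_cot_unique:
  assumes sys1: "Sys a \<psi>1 \<tau>1" and sys2: "Sys b \<psi>2 \<tau>2" and x: "x \<in> {0..1}"
  shows "cot (\<psi>1 x) = cot (\<psi>2 x)"
proof (cases "x = 0")
  case True
  then show ?thesis by (simp only: Sys_start[OF sys1] Sys_start[OF sys2])
next
  case False
  have c: "cos (\<psi>1 x) = cos (\<psi>2 x)"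
    using Sys_x_cos_le[OF sys1 sys2 x] Sys_x_cos_le[OF sys2 sys1 x] False x by auto
  then have "(sin (\<psi>1 x))\<^sup>2 = (sin (\<psi>2 x))\<^sup>2" by (simp add: sin_squared_eq)
  then have "sin (\<psi>1 x) = sin (\<psi>2 x)"
    using Sys_sin_pos[OF sys1 x] Sys_sin_pos[OF sys2 x] by (simp add: power2_eq_iff)
  with c show ?thesis by (simp add: cot_def)
qed

context steering_angle
begin

lemma Sys_iff:
  "Sys \<tau>0 \<psi> \<tau> \<longleftrightarrow> \<tau> 0 = \<tau>0 \<and>
    (\<forall>x\<in>{0..1}. (\<tau> has_real_derivative 2*pi * (\<tau> x * cot (\<psi> x) - 1)) (at x within {0..1}))"
  using cont_\<psi> \<psi>_0 deriv_\<psi> sin_\<psi> unfolding Sys_def by force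

text \<open>After subtraction of a constant \<open>k\<close> and scaling by the integrating factor,
  the derivative is free of \<tau> and has the sign of \<open>k * cot (\<psi> x) - 1\<close>. This
  makes \<open>k\<close> a barrier; with \<open>k = 0\<close> the expression shows
  uniqueness.\<close>

lemma tangent_length_scaled:
  assumes \<tau>: "\<And>x. x \<in> {0..1} \<Longrightarrow> (\<tau> has_real_derivative 2*pi * (\<tau> x * cot (\<psi> x) - 1)) (at x within {0..1})"
    and x: "0 < x" "x < 1"
  shows "((\<lambda>x. (\<tau> x - k) * exp (- acc x)) has_real_derivative 2*pi * (k * cot (\<psi> x) - 1) * exp (- acc x)) (at x)"
proof -
  have e: "at x within {0..1} = at x" using x by (intro at_within_interior) auto
  have d: "(\<tau> has_real_derivative 2*pi * (\<tau> x * cot (\<psi> x) - 1)) (at x)" using \<tau>[of x] x e by auto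
  have a: "(acc has_real_derivative 2 * pi * cot (\<psi> x)) (at x)" using deriv_acc[of x] x e by auto
  show ?thesis
    by (rule derivative_eq_intros refl d a)+ (simp add: algebra_simps)
qed

lemma cont_scaled:
  assumes \<tau>: "\<And>x. x \<in> {0..1} \<Longrightarrow> (\<tau> has_real_derivative 2*pi * (\<tau> x * cot (\<psi> x) - 1)) (at x within {0..1})"
  shows "continuous_on {0..1} \<tau>" "continuous_on {0..1} (\<lambda>x. (\<tau> x - k) * exp (- acc x))"
proof -
  show "continuous_on {0..1} \<tau>" by (rule DERIV_continuous_on) (use \<tau> in blast)
  then show "continuous_on {0..1} (\<lambda>x. (\<tau> x - k) * exp (- acc x))"
    by (intro continuous_intros cont_acc)
qed

lemma tangent_length_unique:
  assumes \<tau>1: "\<And>x. x \<in> {0..1} \<Longrightarrow> (\<tau>1 has_real_derivative 2*pi * (\<tau>1 x * cot (\<psi> x) - 1)) (at x within {0..1})"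
    and \<tau>2: "\<And>x. x \<in> {0..1} \<Longrightarrow> (\<tau>2 has_real_derivative 2*pi * (\<tau>2 x * cot (\<psi> x) - 1)) (at x within {0..1})"
    and eq: "\<tau>1 0 = \<tau>2 0" and x: "x \<in> {0..1}"
  shows "\<tau>1 x = \<tau>2 x"
proof -
  let ?f = "\<lambda>x. (\<tau>1 x - 0) * exp (- acc x) - (\<tau>2 x - 0) * exp (- acc x)"
  have "continuous_on {0..1} ?f"
    by (intro continuous_on_diff cont_scaled(2)[OF \<tau>1] cont_scaled(2)[OF \<tau>2])
  moreover have "(?f has_real_derivative 0) (at y)" if "0 < y" "y < 1" for y
    using DERIV_diff[OF tangent_length_scaled[OF \<tau>1 that, of 0] tangent_length_scaled[OF \<tau>2 that, of 0]] by simp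
  ultimately have "?f x = ?f 0" using DERIV_isconst2[of 0 1 ?f x] x by auto
  then show ?thesis using eq by (simp flip: left_diff_distrib)
qed

text \<open>Beyond \<open>\<xi>\<close> the constant \<open>tan (\<psi> \<xi>)\<close> is a lower barrier for \<open>\<tau>\<close>, because \<open>\<psi>\<close> decreases.\<close>

lemma tangent_length_stays_positive:
  assumes \<tau>: "\<And>x. x \<in> {0..1} \<Longrightarrow> (\<tau> has_real_derivative 2*pi * (\<tau> x * cot (\<psi> x) - 1)) (at x within {0..1})"
    and \<xi>: "1/2 \<le> \<xi>" "\<xi> \<le> 1" and start: "tan (\<psi> \<xi>) \<le> \<tau> \<xi>" and x: "\<xi> \<le> x" "x \<le> 1"
  shows "0 < \<tau> x"
proof -
  let ?k = "tan (\<psi> \<xi>)"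
  have \<psi>\<xi>: "0 < \<psi> \<xi>" "\<psi> \<xi> \<le> pi/4" using \<psi>_bounds[of \<xi>] \<psi>_le_pi4[of \<xi>] \<xi> by auto
  have k: "0 < ?k" using \<psi>\<xi> pi_gt_zero by (intro tan_gt_zero) linarith+
  have "(\<tau> \<xi> - ?k) * exp (- acc \<xi>) \<le> (\<tau> x - ?k) * exp (- acc x)"
  proof (rule DERIV_nonneg_imp_increasing_open[OF x(1), of "\<lambda>x. (\<tau> x - ?k) * exp (- acc x)"])
    show "continuous_on {\<xi>..x} (\<lambda>x. (\<tau> x - ?k) * exp (- acc x))"
      by (rule continuous_on_subset[OF cont_scaled(2)[OF \<tau>]]) (use \<xi> x in auto)
    fix y assume y: "\<xi> < y" "y < x"
    have "\<psi> y \<le> \<psi> \<xi>" using \<psi>_antimono[of \<xi> y] y \<xi> x by auto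
    then have "cot (\<psi> \<xi>) \<le> cot (\<psi> y)"
      using \<psi>_bounds[of y] \<psi>_bounds[of \<xi>] y \<xi> x by (intro cot_mono_rev) auto
    then have "?k * cot (\<psi> \<xi>) \<le> ?k * cot (\<psi> y)" using k by (intro mult_left_mono) auto
    moreover have "?k * cot (\<psi> \<xi>) = 1"
    proof -
      have "0 < cos (\<psi> \<xi>)" using \<psi>\<xi> pi_gt_zero by (intro cos_gt_zero_pi) linarith+
      then show ?thesis using sin_\<psi>[of \<xi>] \<xi> by (simp add: tan_def cot_def)
    qed
    ultimately have "0 \<le> 2*pi * (?k * cot (\<psi> y) - 1) * exp (- acc y)" by simp
    then show "\<exists>d. ((\<lambda>x. (\<tau> x - ?k) * exp (- acc x)) has_real_derivative d) (at y) \<and> 0 \<le> d"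
      using tangent_length_scaled[OF \<tau>, of y ?k] y \<xi> x by auto
  qed
  moreover have "0 \<le> (\<tau> \<xi> - ?k) * exp (- acc \<xi>)" using start by simp
  ultimately have "0 \<le> (\<tau> x - ?k) * exp (- acc x)" by simp
  then show ?thesis using k by (simp add: zero_le_mult_iff)
qed

text \<open>Up to 1/2 the line x = 1 is not met. Between 1/2 and \<xi> the velocity has an angle
  strictly between -pi/2 and pi/2, because \<open>\<theta> \<ge> pi/6\<close> and \<psi> \<le> pi/4.
  So the first coordinate increases strictly and reaches 1 at \<xi> only.\<close>

lemma deployment_param_unique:
  assumes \<tau>: "\<And>x. x \<in> {0..1} \<Longrightarrow> (\<tau> has_real_derivative 2*pi * (\<tau> x * cot (\<psi> x) - 1)) (at x within {0..1})"
    and pos: "\<And>x. x \<in> {0..1} \<Longrightarrow> 0 < \<tau> x"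
    and \<theta>: "pi/6 \<le> \<theta>" "\<theta> < pi/2" and start: "\<tau> (1 - \<theta>/pi) = tan \<theta>"
  shows "deployment_param \<tau> = 1 - \<theta>/pi"
  unfolding deployment_param_def
proof (rule Least_equality)
  let ?\<xi> = "1 - \<theta>/pi"
  have \<theta>0: "0 < \<theta>" using \<theta> pi_gt_zero by linarith
  have \<xi>: "1/2 < ?\<xi>" "?\<xi> < 1" using \<theta> \<theta>0 by (auto simp: field_simps)
  have at\<xi>: "fst (curve \<tau> ?\<xi>) = 1" using curve_at_deployment(1)[where \<tau> = \<tau>, OF \<theta>0 \<theta>(2) start] by simp
  show "0 < ?\<xi> \<and> ?\<xi> \<le> 1 \<and> fst (curve \<tau> ?\<xi>) = 1"
    using \<xi> by (intro conjI at\<xi>) linarith+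
  fix y assume y: "0 < y \<and> y \<le> 1 \<and> fst (curve \<tau> y) = 1"
  show "?\<xi> \<le> y"
  proof (rule ccontr)
    assume "\<not> ?\<xi> \<le> y"
    then have less: "y < ?\<xi>" by simp
    have half: "1/2 < y" using fst_curve_neq_1[of y \<tau>] y pos[of y] by force
    have "fst (curve \<tau> y) < fst (curve \<tau> ?\<xi>)"
    proof (rule DERIV_pos_imp_increasing_open[OF less, of "\<lambda>x. fst (curve \<tau> x)"])
      have "continuous_on {0..1} (\<lambda>x. fst (curve \<tau> x))"
        unfolding curve_def fst_conv by (intro continuous_intros cont_scaled(1)[OF \<tau>])
      then show "continuous_on {y..?\<xi>} (\<lambda>x. fst (curve \<tau> x))"
        by (rule continuous_on_subset) (use \<xi> y in auto)
      fix x assume x: "y < x" "x < ?\<xi>"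
      have x01: "0 < x" "x < 1" "x \<in> {0..1}" "1/2 \<le> x" using x half \<xi> by auto
      have e: "at x within {0..1} = at x" using x01 by (intro at_within_interior) auto
      have d: "(\<tau> has_real_derivative 2*pi * (\<tau> x * cot (\<psi> x) - 1)) (at x)" using \<tau>[OF x01(3)] e by simp
      have s: "0 < sin (\<psi> x)" by (rule sin_\<psi>[OF x01(3)])
      let ?v = "2*pi * \<tau> x / sin (\<psi> x)" and ?a = "3*pi/2 - 2*pi*x - \<psi> x"
      have v: "0 < ?v" using pos[OF x01(3)] s by simp
      have "((\<lambda>x. curve \<tau> x \<bullet> (1, 0)) has_real_derivative (?v *\<^sub>R unit_vec ?a) \<bullet> (1, 0)) (at x)"
        using has_real_derivative_inner[OF deriv_curve[OF d] has_vector_derivative_const[of "(1, 0)"]] s by simp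
      then have d1: "((\<lambda>x. fst (curve \<tau> x)) has_real_derivative ?v * cos ?a) (at x)"
        by (simp add: inner_prod_def unit_vec_def)
      have "pi * (1/2) < pi * x" "pi * x < pi * ?\<xi>" using x half by auto
      then have b: "pi < 2*pi*x" "2*pi*x < 2*pi - 2*\<theta>" by (auto simp: algebra_simps)
      have \<psi>x: "0 < \<psi> x" "\<psi> x \<le> pi/4" using \<psi>_bounds[OF x01(3)] \<psi>_le_pi4[of x] x01 by auto
      have "0 < cos ?a" by (intro cos_gt_zero_pi) (use b \<psi>x \<theta> pi_gt_zero in linarith)+
      then show "\<exists>d. ((\<lambda>x. fst (curve \<tau> x)) has_real_derivative d) (at x) \<and> 0 < d"
        using d1 v by (meson mult_pos_pos)
    qed
    then show False using y at\<xi> by simp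
  qed
qed

text \<open>By uniqueness every solution for \<tau>0 shares its \<tau> with the one witnessing
  feasibility, so \<tau> has no zero and stays positive. Then the deployment parameter lies strictly
  between 1/2 and 1 and yields a genuine candidate trajectory.\<close>

lemma optimal_cost_le_feasible:
  assumes feas: "\<tau>0 \<in> inspection_feasible" and sys: "Sys \<tau>0 \<psi>' \<tau>'"
  shows "optimal_cost \<le> total_cost (deployment_param \<tau>') \<psi>' \<tau>'"
proof -
  obtain \<psi>2 \<tau>2 where sys2: "Sys \<tau>0 \<psi>2 \<tau>2" and out: "\<And>x. x \<in> {0..1} \<Longrightarrow> 1 < norm (curve \<tau>2 x)" and \<tau>0: "0 \<le> \<tau>0"
    using feas by (auto simp: inspection_feasible_def)
  obtain \<tau>1 where "\<forall>x\<in>{0..1}. (\<tau>1 has_real_derivative 2*pi * (\<tau>1 x * cot (\<psi> x) - 1)) (at x within {0..1})"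
    using tangent_length_exists[of 1 1] by auto
  then have sys1: "Sys (\<tau>1 0) \<psi> \<tau>1" by (simp add: Sys_iff)
  have ode: "(\<tau>'' has_real_derivative 2*pi * (\<tau>'' x * cot (\<psi> x) - 1)) (at x within {0..1})"
    if "Sys \<tau>0 \<psi>'' \<tau>''" "x \<in> {0..1}" for \<psi>'' \<tau>'' x
  proof -
    have "(\<tau>'' has_real_derivative 2*pi * (\<tau>'' x * cot (\<psi>'' x) - 1)) (at x within {0..1})"
      using that unfolding Sys_def by blast
    then show ?thesis by (simp only: Sys_cot_unique[OF that(1) sys1 that(2)])
  qed
  have eq: "\<tau>' x = \<tau>2 x" if "x \<in> {0..1}" for x
    by (rule tangent_length_unique[OF ode[OF sys] ode[OF sys2] _ that]) (use sys sys2 in \<open>auto simp: Sys_def\<close>)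
  have nz: "\<tau>' x \<noteq> 0" if "x \<in> {0..1}" for x using out[OF that] eq[OF that] by (simp add: norm_curve_gt_1_iff)
  have cont: "continuous_on {0..1} \<tau>'" by (rule cont_scaled(1)[OF ode[OF sys]])
  have pos: "0 < \<tau>' x" if x: "x \<in> {0..1}" for x
  proof (rule ccontr)
    assume "\<not> 0 < \<tau>' x"
    moreover have "0 \<le> \<tau>' 0" using sys \<tau>0 by (simp add: Sys_def)
    moreover have "continuous_on {0..x} \<tau>'" using x by (intro continuous_on_subset[OF cont]) auto
    ultimately obtain z where "0 \<le> z" "z \<le> x" "\<tau>' z = 0" using IVT2'[of \<tau>' x 0 0] x by auto
    then show False using nz[of z] x by auto
  qed
  \<comment> \<open>The factor left over in \<open>fst_curve_eq_1_iff\<close>. Positivity of \<tau>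
    gives it opposite signs at 1/2 and at 1, and its first zero is the deployment parameter.\<close>
  let ?F = "\<lambda>x. sin (pi * x) + \<tau>' x * cos (pi * x)"
  have contF: "continuous_on {1/2..1} ?F"
    by (intro continuous_intros continuous_on_subset[OF cont]) auto
  have F0: "0 < ?F (1/2)" by simp
  have F1: "?F 1 < 0" using pos[of 1] by simp
  obtain \<xi> where \<xi>: "1/2 < \<xi>" "\<xi> \<le> 1" "?F \<xi> \<le> 0" and before: "\<And>y. 1/2 \<le> y \<Longrightarrow> y < \<xi> \<Longrightarrow> 0 < ?F y"
    using first_below[OF contF _ F0] F1 by (metis divide_le_eq_1_pos less_eq_real_def one_le_numeral zero_less_numeral)
  have F\<xi>: "?F \<xi> = 0"
  proof (rule ccontr)
    assume "?F \<xi> \<noteq> 0"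
    then have neg: "?F \<xi> < 0" using \<xi> by simp
    have "continuous_on {1/2..\<xi>} ?F" using \<xi> by (intro continuous_on_subset[OF contF]) auto
    then obtain z where z: "1/2 \<le> z" "z \<le> \<xi>" "?F z = 0"
      using IVT2'[of ?F \<xi> 0 "1/2"] neg F0 \<xi> by auto
    moreover have "z \<noteq> \<xi>" using z neg by auto
    ultimately show False using before[of z] by simp
  qed
  have "\<xi> \<noteq> 1" using F\<xi> F1 by auto
  then have \<xi>1: "\<xi> < 1" using \<xi> by simp
  define \<theta> where "\<theta> = (1 - \<xi>) * pi"
  have \<xi>\<theta>: "\<xi> = 1 - \<theta>/pi" by (simp add: \<theta>_def)
  have "(1 - \<xi>) * pi < (1/2) * pi" using \<xi> by (intro mult_strict_right_mono) auto
  then have \<theta>: "0 < \<theta>" "\<theta> < pi/2" using \<xi>1 by (auto simp: \<theta>_def)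
  have "pi * \<xi> = pi - \<theta>" by (simp add: \<theta>_def algebra_simps)
  then have "sin \<theta> - \<tau>' \<xi> * cos \<theta> = 0" using F\<xi> by simp
  moreover have "0 < cos \<theta>" using \<theta> by (intro cos_gt_zero_pi) auto
  ultimately have start: "\<tau>' \<xi> = tan \<theta>" by (simp add: tan_def field_simps)
  have "deployment_param \<tau>' = \<xi>"
    unfolding deployment_param_def
  proof (rule Least_equality)
    show "0 < \<xi> \<and> \<xi> \<le> 1 \<and> fst (curve \<tau>' \<xi>) = 1"
      using \<xi> \<xi>1 F\<xi> fst_curve_eq_1_iff[of \<xi> \<tau>'] by auto
    fix y assume y: "0 < y \<and> y \<le> 1 \<and> fst (curve \<tau>' y) = 1"
    show "\<xi> \<le> y"
    proof (rule ccontr)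
      assume "\<not> \<xi> \<le> y"
      then show False
        using y fst_curve_neq_1[of y \<tau>'] pos[of y] before[of y] fst_curve_eq_1_iff[of y \<tau>'] \<xi>
        by (cases "y \<le> 1/2") auto
    qed
  qed
  moreover have "optimal_cost \<le> total_cost (1 - \<theta>/pi) \<psi>' \<tau>'"
  proof (rule optimal_cost_le_total_cost[OF \<theta>])
    show "continuous_on {0..1} \<psi>'" using sys by (simp add: Sys_def)
    show "0 < sin (\<psi>' x)" if "x \<in> {0..1}" for x using Sys_sin_pos[OF sys that] .
    show "(\<tau>' has_real_derivative 2*pi * (\<tau>' x * cot (\<psi>' x) - 1)) (at x within {0..1})" if "x \<in> {0..1}" for x
      using sys that by (simp add: Sys_def)
    show "0 < \<tau>' x" if "x \<in> {0..1 - \<theta>/pi}" for x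
      using pos[of x] that \<xi>1 \<xi>\<theta> by auto
    show "\<tau>' (1 - \<theta>/pi) = tan \<theta>" using start \<xi>\<theta> by simp
  qed
  ultimately show ?thesis using \<xi>\<theta> by simp
qed

end

section \<open>Polar coordinates\<close>

lemma norm_polar_diff:
  "(norm (a *\<^sub>R unit_vec x - b *\<^sub>R unit_vec y))\<^sup>2 = a\<^sup>2 + b\<^sup>2 - 2 * a * b * cos (x - y)"
proof -
  have "unit_vec y \<bullet> unit_vec x = cos (x - y)" by (metis inner_commute inner_unit_vec)
  then show ?thesis
    unfolding power2_norm_eq_inner
    by (simp add: inner_diff_left inner_diff_right inner_unit_vec power2_eq_square algebra_simps)
qed

text \<open>A complex logarithm along the interval provides a continuous angle. It is determined up
  to full turns only; the constant \<open>c\<close> collects them so that the angle starts at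
  0.\<close>

lemma polar_lift:
  fixes \<gamma> :: "real \<Rightarrow> plane"
  assumes cont: "continuous_on {a..b} \<gamma>" and ab: "a \<le> b" and nz: "\<And>t. t \<in> {a..b} \<Longrightarrow> \<gamma> t \<noteq> 0"
    and start: "\<gamma> a = \<rho> *\<^sub>R unit_vec \<theta>" and \<rho>: "0 < \<rho>"
  obtains al where "continuous_on {a..b} al" "al a = 0"
    "\<And>t. t \<in> {a..b} \<Longrightarrow> \<gamma> t = norm (\<gamma> t) *\<^sub>R unit_vec (al t + \<theta>)"
proof -
  define f where "f t = Complex (fst (\<gamma> t)) (snd (\<gamma> t))" for t
  have "continuous_on {a..b} f"
    unfolding f_def by (intro continuous_on_Complex continuous_intros cont)
  moreover have "contractible {a..b}" by (intro convex_imp_contractible) auto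
  moreover have "f t \<noteq> 0" if "t \<in> {a..b}" for t
    using nz[OF that] by (auto simp: f_def complex_eq_iff prod_eq_iff)
  ultimately obtain g where g: "continuous_on {a..b} g" "\<And>t. t \<in> {a..b} \<Longrightarrow> f t = exp (g t)"
    by (rule continuous_logarithm_on_contractible) auto
  have polar: "\<gamma> t = exp (Re (g t)) *\<^sub>R unit_vec (Im (g t))" if "t \<in> {a..b}" for t
  proof -
    have "fst (\<gamma> t) = Re (exp (g t))" "snd (\<gamma> t) = Im (exp (g t))"
      using g(2)[OF that] by (auto simp: f_def complex_eq_iff)
    then show ?thesis by (simp add: unit_vec_def prod_eq_iff Re_exp Im_exp)
  qed
  then have norm: "norm (\<gamma> t) = exp (Re (g t))" if "t \<in> {a..b}" for t using that by simp
  define c where "c = Im (g a) - \<theta>"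
  have "unit_vec (Im (g a)) = unit_vec \<theta>"
  proof -
    have "exp (Re (g a)) = \<rho>" using norm[of a] start \<rho> ab by simp
    then show ?thesis using polar[of a] start \<rho> ab by simp
  qed
  then have "cos (Im (g a)) = cos \<theta>" "sin (Im (g a)) = sin \<theta>" by (simp_all add: unit_vec_def)
  then have c: "cos c = 1" "sin c = 0"
    using sin_cos_squared_add[of \<theta>] by (simp_all add: c_def cos_diff sin_diff power2_eq_square algebra_simps)
  have shift: "unit_vec (x - c) = unit_vec x" for x
    by (simp add: unit_vec_def cos_diff sin_diff c)
  show thesis
  proof (rule that[of "\<lambda>t. Im (g t) - \<theta> - c"])
    show "continuous_on {a..b} (\<lambda>t. Im (g t) - \<theta> - c)" by (intro continuous_intros g)
    show "Im (g a) - \<theta> - c = 0" by (simp add: c_def)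
    fix t assume t: "t \<in> {a..b}"
    have "Im (g t) - \<theta> - c + \<theta> = Im (g t) - c" by simp
    then show "\<gamma> t = norm (\<gamma> t) *\<^sub>R unit_vec (Im (g t) - \<theta> - c + \<theta>)"
      using polar[OF t] norm[OF t] by (simp only: shift)
  qed
qed

lemma cos_ge_imp_near:
  assumes c: "cos \<beta> \<le> cos x" and \<beta>: "0 \<le> \<beta>" "\<beta> \<le> pi"
  obtains k :: int where "\<bar>x + 2 * pi * k\<bar> \<le> \<beta>"
proof -
  define n where "n = \<lfloor>(x + pi) / (2*pi)\<rfloor>"
  define k where "k = - n"
  define y where "y = x + 2 * pi * k"
  have "real_of_int n \<le> (x + pi) / (2*pi)" "(x + pi) / (2*pi) < real_of_int n + 1"
    unfolding n_def by linarith+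
  then have "2*pi * real_of_int n \<le> x + pi" "x + pi < 2*pi * (real_of_int n + 1)"
    by (simp_all add: field_simps)
  then have y: "\<bar>y\<bar> \<le> pi" by (simp add: y_def k_def abs_le_iff algebra_simps)
  have "cos y = cos x"
    using cos_int_2pin[of k] sin_int_2pin[of k] by (simp add: y_def cos_add)
  then have "cos \<beta> \<le> cos \<bar>y\<bar>" using c by simp
  then have "\<bar>y\<bar> \<le> \<beta>" using cos_mono_le_eq[of \<beta> "\<bar>y\<bar>"] y \<beta> by auto
  then show thesis using that[of k] by (simp add: y_def)
qed

text \<open>Polar coordinates of a path outside the disk, in the frame turned by \<open>\<theta>\<close>. \<open>hi\<close> and \<open>- lw\<close>
  bound the arc inspected since time \<open>t0\<close>.\<close>

locale polar_path =
  fixes t0 T \<theta> :: real and al r :: "real \<Rightarrow> real"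
  assumes \<theta>: "0 < \<theta>" "\<theta> < pi/2" and t0T: "t0 \<le> T"
    and cont_al: "continuous_on {t0..T} al" and cont_r: "continuous_on {t0..T} r"
    and r_gt: "\<And>t. t \<in> {t0..T} \<Longrightarrow> 1 < r t"
    and al_start: "al t0 = 0" and r_start: "r t0 = 1 / cos \<theta>"
begin

abbreviation "hi \<equiv> run_max (\<lambda>s. al s + arccos (1 / r s)) t0"
abbreviation "lw \<equiv> run_max (\<lambda>s. - al s + arccos (1 / r s)) t0"

lemma inv_r: "t \<in> {t0..T} \<Longrightarrow> 0 < 1 / r t \<and> 1 / r t < 1"
  using r_gt[of t] by auto

lemma arccos_r:
  assumes "t \<in> {t0..T}"
  shows "cos (arccos (1 / r t)) = 1 / r t" "0 \<le> arccos (1 / r t)" "arccos (1 / r t) \<le> pi" "r t * cos (arccos (1 / r t)) = 1"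
proof -
  have "- 1 \<le> 1 / r t" "1 / r t \<le> 1" using inv_r[OF assms] by linarith+
  then show "cos (arccos (1 / r t)) = 1 / r t" "0 \<le> arccos (1 / r t)" "arccos (1 / r t) \<le> pi"
    by (auto intro: cos_arccos arccos_lbound arccos_ubound)
  then show "r t * cos (arccos (1 / r t)) = 1" using r_gt[OF assms] by simp
qed

lemma cont_arccos_r: "continuous_on {t0..T} (\<lambda>s. arccos (1 / r s))"
proof (intro continuous_on_arccos continuous_intros cont_r ballI)
  fix t assume "t \<in> {t0..T}"
  then have "1 < r t" "0 < 1 / r t \<and> 1 / r t < 1" by (rule r_gt, rule inv_r)
  then show "r t \<noteq> 0" "- 1 \<le> 1 / r t \<and> 1 / r t \<le> 1" by linarith+
qed

lemma cont_up: "continuous_on {t0..T} (\<lambda>s. al s + arccos (1 / r s))"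
  by (rule continuous_on_add[OF cont_al cont_arccos_r])

lemma cont_dn: "continuous_on {t0..T} (\<lambda>s. - al s + arccos (1 / r s))"
  by (rule continuous_on_add[OF continuous_on_minus[OF cont_al] cont_arccos_r])

lemma start: "al t0 + arccos (1 / r t0) = \<theta>" "- al t0 + arccos (1 / r t0) = \<theta>"
  using \<theta> by (simp_all add: al_start r_start arccos_cos)

lemma hi_ge_\<theta>: "t \<in> {t0..T} \<Longrightarrow> \<theta> \<le> hi t" and lw_ge_\<theta>: "t \<in> {t0..T} \<Longrightarrow> \<theta> \<le> lw t"
  using run_max_ge[OF cont_up, of t0 t] run_max_ge[OF cont_dn, of t0 t] start by auto

text \<open>Modulo full turns \<phi> becomes a \<open>y\<close> between the two ends. Beyond
  -\<theta> or \<theta> a running maximum has passed \<open>y\<close>, and when it did, the path was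
  on the tangent there; the middle part is visible at \<open>t0\<close>.\<close>

lemma all_inspected:
  assumes t: "t \<in> {t0..T}" and full: "2 * pi \<le> hi t + lw t"
  shows "\<exists>s\<in>{t0..t}. 1 \<le> r s * cos (al s - \<phi>)"
proof -
  define k where "k = \<lfloor>(\<phi> + lw t) / (2*pi)\<rfloor>"
  define y where "y = \<phi> - 2 * pi * k"
  have "real_of_int k \<le> (\<phi> + lw t) / (2*pi)" "(\<phi> + lw t) / (2*pi) < real_of_int k + 1"
    unfolding k_def by linarith+
  then have "2*pi * real_of_int k \<le> \<phi> + lw t" "\<phi> + lw t < 2*pi * (real_of_int k + 1)"
    by (simp_all add: field_simps)
  then have y: "- lw t \<le> y" "y \<le> hi t" using full by (auto simp: y_def algebra_simps)
  have cosy: "cos (x - \<phi>) = cos (x - y)" for x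
  proof -
    have e: "x - y = (x - \<phi>) + 2 * pi * k" by (simp add: y_def)
    show ?thesis unfolding e cos_add using cos_int_2pin[of k] sin_int_2pin[of k] by simp
  qed
  consider "y < - \<theta>" | "- \<theta> \<le> y" "y \<le> \<theta>" | "\<theta> < y" by linarith
  then show ?thesis
  proof cases
    case 1
    then obtain s where s: "s \<in> {t0..t}" "- al s + arccos (1 / r s) = - y"
      using run_max_ivt[OF cont_dn, of t0 t "- y"] t y start by auto
    then have e: "al s - y = arccos (1 / r s)" by simp
    have "r s * cos (al s - \<phi>) = 1" unfolding cosy e by (rule arccos_r(4)) (use s t in auto)
    then show ?thesis using s by (intro bexI[of _ s]) simp_all
  next
    case 2
    have "cos \<theta> \<le> cos \<bar>y\<bar>" using 2 \<theta> by (intro cos_monotone_0_pi_le) auto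
    then have "cos \<theta> \<le> cos y" by simp
    moreover have "0 < cos \<theta>" using \<theta> by (intro cos_gt_zero_pi) auto
    ultimately have "1 \<le> r t0 * cos y" by (simp add: r_start field_simps)
    moreover have "cos (al t0 - \<phi>) = cos y" unfolding cosy al_start by simp
    ultimately show ?thesis using t by (intro bexI[of _ t0]) simp_all
  next
    case 3
    then obtain s where s: "s \<in> {t0..t}" "al s + arccos (1 / r s) = y"
      using run_max_ivt[OF cont_up, of t0 t y] t y start by auto
    then have e: "al s - y = - arccos (1 / r s)" by simp
    have "r s * cos (al s - \<phi>) = 1" unfolding cosy e cos_minus by (rule arccos_r(4)) (use s t in auto)
    then show ?thesis using s by (intro bexI[of _ s]) simp_all
  qed
qed

text \<open>If \<phi> were inspected at \<open>s\<close>, one of its translates by full turns would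
  lie between \<open>- lw t\<close> and \<open>hi t\<close>; but all translates of the open gap
  avoid that interval.\<close>

lemma not_inspected:
  assumes t: "t \<in> {t0..T}" and \<phi>: "hi t < \<phi>" "\<phi> < 2 * pi - lw t" and s: "s \<in> {t0..t}"
  shows "r s * cos (al s - \<phi>) < 1"
proof (rule ccontr)
  assume "\<not> ?thesis"
  then have "1 \<le> r s * cos (al s - \<phi>)" by simp
  moreover have sin_: "s \<in> {t0..T}" using s t by auto
  ultimately have "cos (arccos (1 / r s)) \<le> cos (al s - \<phi>)"
    using arccos_r(1)[OF sin_] r_gt[OF sin_] by (simp add: field_simps)
  then obtain k :: int where k: "\<bar>al s - \<phi> + 2 * pi * k\<bar> \<le> arccos (1 / r s)"
    using cos_ge_imp_near arccos_r[OF sin_] by blast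
  have "al s + arccos (1 / r s) \<le> hi t" "- al s + arccos (1 / r s) \<le> lw t"
    using run_max_ge[OF cont_up, of s t] run_max_ge[OF cont_dn, of s t] s t by auto
  then have b: "\<phi> - 2 * pi * k \<le> hi t" "- lw t \<le> \<phi> - 2 * pi * k" using k by (auto simp: abs_le_iff)
  show False
  proof (cases "k \<le> 0")
    case True
    then have "2 * pi * real_of_int k \<le> 2 * pi * 0" by (intro mult_left_mono) auto
    then show False using b \<phi> by simp
  next
    case False
    then have "1 \<le> real_of_int k" by linarith
    then have "2 * pi * 1 \<le> 2 * pi * real_of_int k" by (intro mult_left_mono) auto
    then show False using b \<phi> by linarith
  qed
qed

end

text \<open>Each point has an attained inspection time that is at most every admissible completion
  time, hence at most their infimum. So everything is inspected by \<open>completion_time\<close>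
  itself.\<close>

lemma completion_time_facts:
  assumes ins: "inspective_trajectory \<gamma> L"
  shows "completion_time \<gamma> L \<in> {0..L}"
    and "\<And>P. norm P = 1 \<Longrightarrow> \<exists>s\<in>{0..completion_time \<gamma> L}. 1 \<le> \<gamma> s \<bullet> P"
    and "\<And>t. 0 \<le> t \<Longrightarrow> t \<le> L \<Longrightarrow> (\<And>P. norm P = 1 \<Longrightarrow> \<exists>s\<in>{0..t}. 1 \<le> \<gamma> s \<bullet> P) \<Longrightarrow> completion_time \<gamma> L \<le> t"
    and "\<And>P. norm P = 1 \<Longrightarrow> inspection_time \<gamma> L P \<le> completion_time \<gamma> L"
proof -
  let ?C = "{t \<in> {0..L}. cball 0 1 \<subseteq> convex hull (\<gamma> ` {0..t})}"
  note cont = inspective_continuous[OF ins]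
  have C_iff: "t \<in> ?C \<longleftrightarrow> (\<forall>P. norm P = 1 \<longrightarrow> (\<exists>s\<in>{0..t}. 1 \<le> \<gamma> s \<bullet> P))" if "t \<in> {0..L}" for t
  proof -
    have "compact (\<gamma> ` {0..t})"
      by (intro compact_continuous_image continuous_on_subset[OF cont]) (use that in auto)
    from cball_subset_hull_iff[OF this] that show ?thesis by auto
  qed
  have L0: "0 \<le> L" using ins by (simp add: inspective_trajectory_def)
  then have LC: "L \<in> ?C" using inspective_covers[OF ins] by (subst C_iff) auto
  have bdd: "bdd_below ?C" by (auto simp: bdd_below_def)
  show least: "completion_time \<gamma> L \<le> t"
    if "0 \<le> t" "t \<le> L" "\<And>P. norm P = 1 \<Longrightarrow> \<exists>s\<in>{0..t}. 1 \<le> \<gamma> s \<bullet> P" for t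
  proof -
    have "t \<in> ?C" using that by (subst C_iff) auto
    then show ?thesis unfolding completion_time_def by (rule cInf_lower[OF _ bdd])
  qed
  have "completion_time \<gamma> L \<le> L" unfolding completion_time_def by (rule cInf_lower[OF LC bdd])
  moreover have "0 \<le> completion_time \<gamma> L"
    unfolding completion_time_def by (rule cInf_greatest) (use LC in auto)
  ultimately show "completion_time \<gamma> L \<in> {0..L}" by simp
  fix P :: plane assume P: "norm P = 1"
  have ex: "\<exists>t\<in>{0..L}. inspects (\<gamma> t) P" using inspective_covers[OF ins P] by (simp add: inspects_iff[OF P])
  show le: "inspection_time \<gamma> L P \<le> completion_time \<gamma> L"
    unfolding completion_time_def
  proof (rule cInf_greatest)
    fix t assume t: "t \<in> ?C"
    then have "t \<in> {0..L}" by simp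
    then obtain s where "s \<in> {0..t}" "1 \<le> \<gamma> s \<bullet> P" using C_iff[of t] t P by blast
    then show "inspection_time \<gamma> L P \<le> t"
      using inspection_time_le[of s L \<gamma> P] t by (auto simp: inspects_iff[OF P])
  qed (use LC in auto)
  show "\<exists>s\<in>{0..completion_time \<gamma> L}. 1 \<le> \<gamma> s \<bullet> P"
    using inspection_time_attained[OF cont ex] le by (intro bexI[of _ "inspection_time \<gamma> L P"]) (auto simp: inspects_iff[OF P])
qed

theorem theorem2:
  fixes \<gamma> :: "real \<Rightarrow> plane" and L \<theta> :: real
  assumes "optimal_trajectory \<gamma> L"
    and "deployment_phase \<gamma> L \<theta>"
    and "\<gamma> ` inspection_interval \<gamma> L \<theta> \<inter> cball 0 1 = {}"
  shows "\<exists>\<tau>0 \<psi> \<tau> \<xi>.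
      \<tau>0 \<in> inspection_feasible \<and> Sys \<tau>0 \<psi> \<tau> \<and>
      \<xi> = deployment_param \<tau> \<and> \<xi> > 1/2 \<and>
      \<theta> = (1 - \<xi>) * pi \<and> curve \<tau> \<xi> = (1, tan \<theta>) \<and>
      \<comment> \<open>up to reflection in the line through the deployment segment, the inspection phase
          runs through the curve from parameter \<open>\<xi>\<close> down to \<open>0\<close>\<close>
      (\<exists>R \<sigma>. orthogonal_transformation R \<and> R (1, tan \<theta>) = (1, tan \<theta>) \<and>
         bij_betw \<sigma> {0..\<xi>} (inspection_interval \<gamma> L \<theta>) \<and>
         strict_antimono_on {0..\<xi>} \<sigma> \<and>
         (\<forall>x\<in>{0..\<xi>}. R (\<gamma> (\<sigma> x)) = curve \<tau> x)) \<and>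
      optimal_cost = total_cost \<xi> \<psi> \<tau> \<and>
      (\<forall>\<tau>0'\<in>inspection_feasible. \<forall>\<psi>' \<tau>'. Sys \<tau>0' \<psi>' \<tau>' \<longrightarrow>
         optimal_cost \<le> total_cost (deployment_param \<tau>') \<psi>' \<tau>')"
proof -
  have ins: "inspective_trajectory \<gamma> L" using assms(1) by (simp add: optimal_trajectory_def)
  note cont = inspective_continuous[OF ins] and lips = inspective_lipschitz[OF ins]
  define t0 where "t0 = 1 / cos \<theta>"
  define T where "T = completion_time \<gamma> L"
  note comp = completion_time_facts[OF ins, folded T_def]
  have \<theta>0: "0 \<le> \<theta>" "\<theta> < pi/2" and t0L: "t0 \<le> L"
    and straight: "\<And>t. t \<in> {0..t0} \<Longrightarrow> \<gamma> t = t *\<^sub>R unit_vec \<theta>"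
    and longest: "\<And>d. d \<in> {0..L} \<Longrightarrow> (\<And>t. t \<in> {0..d} \<Longrightarrow> \<gamma> t = t *\<^sub>R unit_vec \<theta>) \<Longrightarrow> d \<le> t0"
    using assms(2) unfolding deployment_phase_def t0_def unit_vec_def by blast+
  have c: "0 < cos \<theta>" using \<theta>0 by (intro cos_gt_zero_pi) auto
  have t0: "0 < t0" using c by (simp add: t0_def)
  \<comment> \<open>The point opposite to the deployment direction cannot be inspected from the
    segment.\<close>
  have t0T: "t0 < T"
  proof -
    obtain s where s: "s \<in> {0..T}" "1 \<le> \<gamma> s \<bullet> (- unit_vec \<theta>)" using comp(2)[of "- unit_vec \<theta>"] by auto
    have "\<not> s \<le> t0"
    proof
      assume "s \<le> t0"
      then have "\<gamma> s = s *\<^sub>R unit_vec \<theta>" using s straight by auto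
      then show False using s by (simp add: inner_unit_vec)
    qed
    then show ?thesis using s by auto
  qed
  have TL: "T \<le> L" using comp(1) by simp
  have interval: "inspection_interval \<gamma> L \<theta> = {t0..T}" by (simp add: inspection_interval_def t0_def T_def)
  define r where "r t = norm (\<gamma> t)" for t
  have r_gt: "1 < r t" if "t \<in> {t0..T}" for t
  proof -
    have "\<gamma> t \<in> \<gamma> ` inspection_interval \<gamma> L \<theta>" using that interval by blast
    then have "\<gamma> t \<notin> cball 0 1" using assms(3) by blast
    then show ?thesis by (simp add: r_def)
  qed
  have contT: "continuous_on {t0..T} \<gamma>" using t0 TL by (intro continuous_on_subset[OF cont]) auto
  have \<gamma>t0: "\<gamma> t0 = t0 *\<^sub>R unit_vec \<theta>" using straight t0 by simp
  have rt0: "r t0 = t0" using t0 by (simp add: r_def \<gamma>t0)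
  have "\<theta> \<noteq> 0"
  proof
    assume "\<theta> = 0"
    then have "t0 = 1" by (simp add: t0_def)
    then show False using r_gt[of t0] rt0 t0T by simp
  qed
  with \<theta>0 have \<theta>: "0 < \<theta>" "\<theta> < pi/2" by auto
  have nz: "\<gamma> t \<noteq> 0" if "t \<in> {t0..T}" for t using r_gt[OF that] by (auto simp: r_def)
  obtain al where al: "continuous_on {t0..T} al" "al t0 = 0"
    and polar: "\<And>t. t \<in> {t0..T} \<Longrightarrow> \<gamma> t = r t *\<^sub>R unit_vec (al t + \<theta>)"
    using polar_lift[OF contT less_imp_le[OF t0T] nz \<gamma>t0 t0] unfolding r_def by metis
  have contr: "continuous_on {t0..T} r" unfolding r_def by (intro continuous_intros contT)
  interpret pp: polar_path t0 T \<theta> al r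
    by unfold_locales (use \<theta> t0T al contr r_gt rt0 in \<open>auto simp: t0_def\<close>)
  have inner: "\<gamma> t \<bullet> unit_vec (\<phi> + \<theta>) = r t * cos (al t - \<phi>)" if "t \<in> {t0..T}" for t \<phi>
    using polar[OF that] by (simp add: inner_unit_vec)
  have unseen: "\<gamma> s \<bullet> unit_vec (\<phi> + \<theta>) < 1"
    if t: "t \<in> {t0..T}" and \<phi>: "pp.hi t < \<phi>" "\<phi> < 2 * pi - pp.lw t" and s: "s \<in> {0..t}" for s t \<phi>
  proof (cases "t0 \<le> s")
    case True
    then show ?thesis using pp.not_inspected[OF t \<phi>, of s] inner[of s \<phi>] s t by auto
  next
    case False
    have "cos \<phi> \<le> cos \<theta>"
      using \<phi> pp.hi_ge_\<theta>[OF t] pp.lw_ge_\<theta>[OF t] \<theta> by (intro cos_le_cos_outside) auto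
    then have "s * cos \<phi> \<le> s * cos \<theta>" using s by (intro mult_left_mono) auto
    also have "s * cos \<theta> < t0 * cos \<theta>" using False c by simp
    also have "t0 * cos \<theta> = 1" using c by (simp add: t0_def)
    finally show ?thesis using straight[of s] s False by (simp add: inner_unit_vec)
  qed
  have incomplete: "pp.hi t + pp.lw t < 2 * pi" if t: "t0 \<le> t" "t < T" for t
  proof (rule ccontr)
    assume "\<not> ?thesis"
    then have full: "2 * pi \<le> pp.hi t + pp.lw t" by simp
    have "T \<le> t"
    proof (rule comp(3))
      fix P :: plane assume P: "norm P = 1"
      then have "(fst P)\<^sup>2 + (snd P)\<^sup>2 = 1" by (cases P) (simp add: norm_Pair)
      then obtain \<phi> where "fst P = cos \<phi>" "snd P = sin \<phi>" by (rule sincos_total_2pi)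
      then have P: "P = unit_vec ((\<phi> - \<theta>) + \<theta>)" by (simp add: unit_vec_def prod_eq_iff)
      obtain s where s: "s \<in> {t0..t}" "1 \<le> r s * cos (al s - (\<phi> - \<theta>))"
        using pp.all_inspected[OF _ full, of "\<phi> - \<theta>"] t by auto
      then have "1 \<le> \<gamma> s \<bullet> P" unfolding P using inner[of s "\<phi> - \<theta>"] t by auto
      then show "\<exists>s\<in>{0..t}. 1 \<le> \<gamma> s \<bullet> P" using s t0 by (intro bexI[of _ s]) auto
    qed (use t t0 TL in auto)
    then show False using t by simp
  qed
  \<comment> \<open>A gap left at \<open>T\<close> would contain an uninspected direction; an
    overlap at \<open>T\<close> would by continuity exist shortly before, against
    \<open>incomplete\<close>.\<close>
  have complete: "pp.hi T + pp.lw T = 2 * pi"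
  proof (rule antisym)
    show "2 * pi \<le> pp.hi T + pp.lw T"
    proof (rule ccontr)
      assume less: "\<not> ?thesis"
      define \<phi> where "\<phi> = (pp.hi T + (2 * pi - pp.lw T)) / 2"
      have \<phi>: "pp.hi T < \<phi>" "\<phi> < 2 * pi - pp.lw T" using less by (auto simp: \<phi>_def)
      obtain s where "s \<in> {0..T}" "1 \<le> \<gamma> s \<bullet> unit_vec (\<phi> + \<theta>)" using comp(2)[of "unit_vec (\<phi> + \<theta>)"] by auto
      then show False using unseen[of T \<phi> s] \<phi> t0T by auto
    qed
    show "pp.hi T + pp.lw T \<le> 2 * pi"
    proof (rule ccontr)
      assume "\<not> ?thesis"
      then have pos: "0 < pp.hi T + pp.lw T - 2 * pi" by simp
      have "continuous_on {t0..T} (\<lambda>t. pp.hi t + pp.lw t)"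
        by (intro continuous_intros continuous_on_run_max pp.cont_up pp.cont_dn)
      then obtain d where d: "d > 0" "\<And>x. x \<in> {t0..T} \<Longrightarrow> dist x T < d \<Longrightarrow>
          dist (pp.hi x + pp.lw x) (pp.hi T + pp.lw T) < pp.hi T + pp.lw T - 2 * pi"
        unfolding continuous_on_iff using pos t0T by (meson atLeastAtMost_iff less_imp_le order_refl)
      define x where "x = max t0 (T - d/2)"
      have x: "t0 \<le> x" "x < T" "dist x T < d" using d t0T by (auto simp: x_def dist_real_def)
      then show False using d(2)[of x] incomplete[of x] by (auto simp: dist_real_def abs_if split: if_splits)
    qed
  qed
  obtain \<psi> where \<psi>: "steering_angle \<psi>"
    using direction_angle_exists unfolding steering_angle_def by metis
  interpret steering_angle \<psi> by (rule \<psi>)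
  interpret op: outer_path \<psi> t0 T \<theta> al r
  proof
    fix s t assume st: "s \<in> {t0..T}" "t \<in> {t0..T}"
    have "(norm (r t *\<^sub>R unit_vec (al t) - r s *\<^sub>R unit_vec (al s)))\<^sup>2 = (norm (\<gamma> t - \<gamma> s))\<^sup>2"
      unfolding polar[OF st(1)] polar[OF st(2)] norm_polar_diff by simp
    then have "norm (r t *\<^sub>R unit_vec (al t) - r s *\<^sub>R unit_vec (al s)) = norm (\<gamma> t - \<gamma> s)"
      by (simp add: power2_eq_iff_nonneg)
    then show "norm (r t *\<^sub>R unit_vec (al t) - r s *\<^sub>R unit_vec (al s)) \<le> \<bar>t - s\<bar>"
      using lips[of s t] st t0 TL by auto
  qed (use \<theta> t0T al contr r_gt rt0 incomplete complete in \<open>auto simp: t0_def\<close>)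
  let ?I = "\<lambda>\<phi>. inspection_time \<gamma> L (unit_vec \<phi>)"
  note int = avg_cost_eq_integral[OF ins]
  have I_facts: "?I \<phi> \<in> {0..T}" "1 \<le> \<gamma> (?I \<phi>) \<bullet> unit_vec \<phi>" for \<phi>
    using inspection_time_attained[OF cont, of "unit_vec \<phi>"] inspective_covers[OF ins, of "unit_vec \<phi>"]
      comp(4)[of "unit_vec \<phi>"] by (auto simp: inspects_iff)
  have I1: "ln ((1 + sin \<theta>) / (1 - sin \<theta>)) \<le> integral {0..2*\<theta>} ?I"
  proof (rule has_integral_le[OF has_integral_sec[OF \<theta>]])
    show "(?I has_integral integral {0..2*\<theta>} ?I) {0..2*\<theta>}"
      using \<theta> by (intro integrable_integral integrable_subinterval_real[OF int(1)]) auto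
    fix \<phi> assume \<phi>: "\<phi> \<in> {0..2*\<theta>}"
    have "cos \<theta> \<le> cos \<bar>\<phi> - \<theta>\<bar>" using \<phi> \<theta> by (intro cos_monotone_0_pi_le) auto
    then have c': "cos \<theta> \<le> cos (\<phi> - \<theta>)" by simp
    show "1 / cos (\<phi> - \<theta>) \<le> ?I \<phi>"
    proof (cases "?I \<phi> \<le> t0")
      case True
      then have "1 \<le> ?I \<phi> * cos (\<theta> - \<phi>)"
        using I_facts[of \<phi>] straight[of "?I \<phi>"] by (simp add: inner_unit_vec)
      moreover have "cos (\<theta> - \<phi>) = cos (\<phi> - \<theta>)" by (metis cos_minus minus_diff_eq)
      ultimately show ?thesis using c c' by (simp add: field_simps)
    next
      case False
      have "1 / cos (\<phi> - \<theta>) \<le> t0" unfolding t0_def using c c' by (intro frac_le) auto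
      then show ?thesis using False by simp
    qed
  qed
  have meas: "(\<lambda>\<phi>. ?I \<phi>) \<in> borel_measurable borel"
    using borel_measurable_inspection_time[OF cont] by measurable
  \<comment> \<open>Directions outside [0, 2 * \<theta>] are not seen before \<open>t0\<close>, and
    those not seen by time \<open>t\<close> contain an interval of length
    \<open>2 * pi * u t\<close>. The layer-cake bound turns this into the integral of
    \<open>u\<close>.\<close>
  have I2: "t0 * (2*pi - 2*\<theta>) + integral {t0..T} (\<lambda>t. 2*pi * op.u t) \<le> integral {2*\<theta>..2*pi} ?I"
  proof (rule layer_cake_lower_bound[OF meas])
    show "?I integrable_on {2*\<theta>..2*pi}" using \<theta> by (intro integrable_subinterval_real[OF int(1)]) auto
    show "continuous_on {t0..T} (\<lambda>t. 2*pi * op.u t)" by (intro continuous_intros op.cont_u)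
    show "0 \<le> 2*pi * op.u t" if "t \<in> {t0..T}" for t using op.u_bounds[OF that] by simp
    have late: "t < ?I \<phi>" if "t \<in> {t0..T}" "pp.hi t < \<phi> - \<theta>" "\<phi> - \<theta> < 2 * pi - pp.lw t" for t \<phi>
    proof (rule ccontr)
      assume "\<not> ?thesis"
      then show False using unseen[OF that, of "?I \<phi>"] I_facts[of \<phi>] by auto
    qed
    show "t0 \<le> ?I \<phi>" if "\<phi> \<in> {2*\<theta>..2*pi}" for \<phi>
    proof (rule ccontr)
      assume "\<not> ?thesis"
      then have less: "?I \<phi> < t0" by simp
      have "cos (\<phi> - \<theta>) \<le> cos \<theta>" using that \<theta> by (intro cos_le_cos_outside) auto
      then have "?I \<phi> * cos (\<phi> - \<theta>) \<le> ?I \<phi> * cos \<theta>" using I_facts[of \<phi>] by (intro mult_left_mono) auto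
      also have "\<dots> < t0 * cos \<theta>" using less c by simp
      also have "\<dots> = 1" using c by (simp add: t0_def)
      also have "?I \<phi> * cos (\<phi> - \<theta>) = \<gamma> (?I \<phi>) \<bullet> unit_vec \<phi>"
        using straight[of "?I \<phi>"] I_facts[of \<phi>] less by (simp add: inner_unit_vec) (metis cos_minus minus_diff_eq)
      finally show False using I_facts[of \<phi>] by simp
    qed
    show "\<exists>x y. 2*\<theta> \<le> x \<and> y \<le> 2*pi \<and> 2*pi * op.u t \<le> y - x \<and> (\<forall>\<phi>. x < \<phi> \<and> \<phi> < y \<longrightarrow> t < ?I \<phi>)"
      if "t0 \<le> t" "t < T" for t
    proof (intro exI conjI allI impI)
      have tin: "t \<in> {t0..T}" using that by simp
      show "2*\<theta> \<le> pp.hi t + \<theta>" "2 * pi - pp.lw t + \<theta> \<le> 2*pi"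
        using pp.hi_ge_\<theta>[OF tin] pp.lw_ge_\<theta>[OF tin] by auto
      have "2 * pi * op.u t = 2 * pi - (pp.hi t + pp.lw t)"
        by (simp add: op.u_def op.half_def op.hi_def op.lo_def field_simps)
      then show "2*pi * op.u t \<le> (2 * pi - pp.lw t + \<theta>) - (pp.hi t + \<theta>)" by simp
      fix \<phi> assume "pp.hi t + \<theta> < \<phi> \<and> \<phi> < 2 * pi - pp.lw t + \<theta>"
      then show "t < ?I \<phi>" using late[OF tin, of \<phi>] by auto
    qed
  qed (use \<theta> t0T in auto)
  have "integral {0..2*pi} ?I = integral {0..2*\<theta>} ?I + integral {2*\<theta>..2*pi} ?I"
    using \<theta> by (intro Henstock_Kurzweil_Integration.integral_combine[symmetric] int(1)) auto
  then have "1 / (2*pi) * (ln ((1 + sin \<theta>) / (1 - sin \<theta>)) + (t0 * (2*pi - 2*\<theta>) + 2*pi * integral {t0..T} op.u)) \<le> avg_cost \<gamma> L"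
    unfolding int(2) using I1 I2 by (intro mult_left_mono) auto
  also have "1 / (2*pi) * (ln ((1 + sin \<theta>) / (1 - sin \<theta>)) + (t0 * (2*pi - 2*\<theta>) + 2*pi * integral {t0..T} op.u))
      = deployment_cost \<theta> + integral {t0..T} op.u"
  proof -
    have "2*pi * (1 - \<theta>/pi) = 2*pi - 2*\<theta>" by (simp add: algebra_simps)
    then have "t0 * (2*pi - 2*\<theta>) = 2*pi * ((1 - \<theta>/pi) / cos \<theta>)"
      unfolding t0_def by (metis mult.commute times_divide_eq_right mult.right_neutral)
    then show ?thesis by (simp add: deployment_cost_def distrib_left)
  qed
  finally have lower: "deployment_cost \<theta> + integral {t0..T} op.u \<le> optimal_cost"
    using optimal_cost_eq[OF assms(1)] by simp
  \<comment> \<open>Every half-angle provides a candidate. At \<open>optimal_half_angle\<close> this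
    upper bound meets the lower bound for the given path, which is the assumption
    \<open>optimal\<close> of the locale below.\<close>
  have upper: "optimal_cost \<le> phase_cost h" if h: "0 < h" "h < pi/2" for h
  proof -
    have "0 < tan h" using h by (intro tan_gt_zero) auto
    moreover have "1 - h/pi \<in> {0..1}" using h by (auto simp: field_simps)
    ultimately obtain \<tau> where \<tau>:
      "\<forall>x\<in>{0..1}. (\<tau> has_real_derivative 2*pi * (\<tau> x * cot (\<psi> x) - 1)) (at x within {0..1})"
      "\<tau> (1 - h/pi) = tan h" "\<forall>x\<in>{0..1 - h/pi}. 0 < \<tau> x"
      using tangent_length_exists[of "1 - h/pi" "tan h"] by blast
    have "optimal_cost \<le> total_cost (1 - h/pi) \<psi> \<tau>"
      by (rule optimal_cost_le_total_cost[OF h cont_\<psi>]) (use sin_\<psi> \<tau> in blast)+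
    also have "\<dots> = phase_cost h"
      by (rule total_cost_eq_phase_cost[OF h]) (use \<tau> in blast)+
    finally show ?thesis .
  qed
  interpret op: optimal_path \<psi> t0 T \<theta> al r
  proof
    have "0 < optimal_half_angle" using optimal_half_angle(1) pi_gt_zero by linarith
    then show "deployment_cost \<theta> + integral {t0..T} op.u \<le> phase_cost optimal_half_angle"
      using lower upper[OF _ optimal_half_angle(2)] by linarith
    fix d assume d: "d \<in> {t0..T}" "\<And>t. t \<in> {t0..d} \<Longrightarrow> r t *\<^sub>R unit_vec (al t) = t *\<^sub>R unit_vec 0"
    show "d \<le> t0"
    proof (rule longest)
      fix t assume t: "t \<in> {0..d}"
      show "\<gamma> t = t *\<^sub>R unit_vec \<theta>"
      proof (cases "t \<le> t0")
        case False
        then have tin: "t \<in> {t0..d}" "t \<in> {t0..T}" using t d by auto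
        have rc: "r t * cos (al t) = t" and rs: "r t * sin (al t) = 0"
          using d(2)[OF tin(1)] by (simp_all add: unit_vec_def)
        have "r t * cos (al t + \<theta>) = (r t * cos (al t)) * cos \<theta> - (r t * sin (al t)) * sin \<theta>"
          "r t * sin (al t + \<theta>) = (r t * sin (al t)) * cos \<theta> + (r t * cos (al t)) * sin \<theta>"
          by (simp_all add: cos_add sin_add algebra_simps)
        then show ?thesis unfolding polar[OF tin(2)] rc rs by (simp add: unit_vec_def)
      qed (use straight t in auto)
    qed (use d t0 TL in auto)
  qed
  have \<theta>6: "pi/6 \<le> \<theta>" using optimal_half_angle(1) op.\<theta>_eq by simp
  define \<xi> where "\<xi> = 1 - \<theta>/pi"
  have \<xi>: "1/2 < \<xi>" "\<xi> < 1" using \<theta> by (auto simp: \<xi>_def field_simps)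
  have "0 < tan \<theta>" using \<theta> by (intro tan_gt_zero) auto
  then obtain \<tau> where \<tau>':
    "\<forall>x\<in>{0..1}. (\<tau> has_real_derivative 2*pi * (\<tau> x * cot (\<psi> x) - 1)) (at x within {0..1})"
    and start: "\<tau> \<xi> = tan \<theta>" and pos\<xi>: "\<forall>x\<in>{0..\<xi>}. 0 < \<tau> x"
    using tangent_length_exists[of \<xi> "tan \<theta>"] \<xi> by auto
  note \<tau> = bspec[OF \<tau>'] and start' = start[unfolded \<xi>_def]
  have pos: "0 < \<tau> x" if "x \<in> {0..1}" for x
  proof (cases "x \<le> \<xi>")
    case True
    then show ?thesis using pos\<xi> that by auto
  next
    case False
    show ?thesis
    proof (rule tangent_length_stays_positive[OF \<tau>])
      have \<psi>\<xi>: "0 < \<psi> \<xi>" "\<psi> \<xi> \<le> pi/4" using \<psi>_bounds[of \<xi>] \<psi>_le_pi4[of \<xi>] \<xi> by auto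
      have "3 * \<theta> = pi/2 + \<psi> \<xi>" using optimal_half_angle(3) op.\<theta>_eq by (simp add: \<xi>_def)
      \<comment> \<open>As \<open>\<psi> \<xi> \<le> pi/4\<close>, the transversality condition
        gives 3 * \<theta> \<ge> 3 * \<psi> \<xi>, which puts \<open>tan \<theta>\<close> above the
        barrier \<open>tan (\<psi> \<xi>)\<close>.\<close>
      then have "\<psi> \<xi> \<le> \<theta>" using \<psi>\<xi> by linarith
      then show "tan (\<psi> \<xi>) \<le> \<tau> \<xi>" unfolding start using \<psi>\<xi> \<theta> by (intro tan_mono_le) auto
    qed (use False \<xi> that in auto)
  qed
  have sys: "Sys (\<tau> 0) \<psi> \<tau>" using \<tau>' by (simp add: Sys_iff)
  have at\<xi>: "curve \<tau> \<xi> = (1, tan \<theta>)" unfolding \<xi>_def by (rule curve_at_deployment(1)[where \<tau> = \<tau>, OF \<theta> start'])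
  have feas: "\<tau> 0 \<in> inspection_feasible"
    unfolding inspection_feasible_def mem_Collect_eq
  proof (intro conjI exI)
    show "0 \<le> \<tau> 0" using pos[of 0] by simp
    show "Sys (\<tau> 0) \<psi> \<tau>" by (rule sys)
    show "\<forall>x\<in>{0..1}. 1 < norm (curve \<tau> x)" using pos by (force simp: norm_curve_gt_1_iff)
    show "\<exists>\<xi>\<in>{0<..1}. fst (curve \<tau> \<xi>) = 1" using at\<xi> \<xi> by (intro bexI[of _ \<xi>]) auto
  qed
  have param: "\<xi> = deployment_param \<tau>"
    using deployment_param_unique[OF \<tau> pos \<theta>6 \<theta>(2) start'] by (simp add: \<xi>_def)
  have cost: "total_cost \<xi> \<psi> \<tau> = phase_cost \<theta>"
    unfolding \<xi>_def by (rule total_cost_eq_phase_cost[OF \<theta> \<tau> start'])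
  have "phase_cost \<theta> \<le> deployment_cost \<theta> + integral {t0..T} op.u"
    using op.path_cost_ge op.\<theta>_eq by (simp add: op.elapsed_def)
  then have opt: "optimal_cost = total_cost \<xi> \<psi> \<tau>"
    using lower upper[OF \<theta>] cost by simp
  \<comment> \<open>The curve parameter of a point of the path is the fraction still uninspected, so
    the reparametrization is the inverse of \<open>u\<close>.\<close>
  define \<sigma> where "\<sigma> = the_inv_into {t0..T} op.u"
  have bij_u: "bij_betw op.u {t0..T} {0..\<xi>}" unfolding \<xi>_def by (rule op.bij_betw_u)
  have bij: "bij_betw \<sigma> {0..\<xi>} {t0..T}" unfolding \<sigma>_def by (rule bij_betw_the_inv_into[OF bij_u])
  have u\<sigma>: "op.u (\<sigma> x) = x" "\<sigma> x \<in> {t0..T}" if "x \<in> {0..\<xi>}" for x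
    using f_the_inv_into_f_bij_betw[OF bij_u, of x] that bij bij_betwE[OF bij] by (auto simp: \<sigma>_def)
  have anti: "strict_antimono_on {0..\<xi>} \<sigma>"
  proof (rule monotone_onI)
    fix x y assume xy: "x \<in> {0..\<xi>}" "y \<in> {0..\<xi>}" "x < y"
    show "\<sigma> y < \<sigma> x"
    proof (rule ccontr)
      assume "\<not> \<sigma> y < \<sigma> x"
      then have "op.u (\<sigma> y) \<le> op.u (\<sigma> x)" using u\<sigma>(2)[OF xy(1)] u\<sigma>(2)[OF xy(2)] by (intro op.u_antimono) auto
      then show False using xy u\<sigma> by simp
    qed
  qed
  have "\<exists>R. orthogonal_transformation R \<and> R (1, tan \<theta>) = (1, tan \<theta>) \<and> (\<forall>t\<in>{t0..T}. R (\<gamma> t) = curve \<tau> (op.u t))"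
    using op.curve_up_to_reflection[OF \<tau> start']
  proof
    assume *: "\<forall>t\<in>{t0..T}. r t *\<^sub>R unit_vec (al t + \<theta>) = curve \<tau> (op.u t)"
    show ?thesis
    proof (intro exI[of _ "\<lambda>p. p"] conjI ballI)
      show "orthogonal_transformation (\<lambda>p :: plane. p)" by (simp add: orthogonal_transformation_id)
      fix t assume "t \<in> {t0..T}"
      then show "\<gamma> t = curve \<tau> (op.u t)" using * polar by simp
    qed simp
  next
    assume *: "\<forall>t\<in>{t0..T}. r t *\<^sub>R unit_vec (- al t + \<theta>) = curve \<tau> (op.u t)"
    define e where "e = unit_vec \<theta>"
    have ee: "e \<bullet> e = 1" by (simp add: e_def inner_unit_vec)
    \<comment> \<open>The reflection in the line spanned by \<open>e\<close>.\<close>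
    define R where "R p = (2 * (p \<bullet> e)) *\<^sub>R e - p" for p
    have R: "R (c *\<^sub>R unit_vec (a + \<theta>)) = c *\<^sub>R unit_vec (- a + \<theta>)" for c a
    proof -
      have "2 * cos a * cos \<theta> - cos (a + \<theta>) = cos (- a + \<theta>)" "2 * cos a * sin \<theta> - sin (a + \<theta>) = sin (- a + \<theta>)"
        by (simp_all add: cos_add sin_add cos_diff sin_diff)
      moreover have "unit_vec (a + \<theta>) \<bullet> e = cos a" by (simp add: e_def inner_unit_vec)
      ultimately have "R (unit_vec (a + \<theta>)) = unit_vec (- a + \<theta>)"
        by (simp add: R_def) (simp add: e_def unit_vec_def)
      moreover have "R (c *\<^sub>R p) = c *\<^sub>R R p" for p by (simp add: R_def algebra_simps)
      ultimately show ?thesis by simp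
    qed
    show ?thesis
    proof (intro exI[of _ R] conjI ballI)
      have "linear R" by (rule linearI) (simp_all add: R_def inner_add_left algebra_simps)
      moreover have "R v \<bullet> R w = v \<bullet> w" for v w
      proof -
        have "e \<bullet> w = w \<bullet> e" by (rule inner_commute)
        then show ?thesis by (simp add: R_def inner_diff_left inner_diff_right ee)
      qed
      ultimately show "orthogonal_transformation R" by (simp add: orthogonal_transformation_def)
      have "(1, tan \<theta>) = (1 / cos \<theta>) *\<^sub>R unit_vec (0 + \<theta>)" using c by (simp add: unit_vec_def tan_def)
      then show "R (1, tan \<theta>) = (1, tan \<theta>)" using R[of "1 / cos \<theta>" 0] by simp
      fix t assume "t \<in> {t0..T}"
      then show "R (\<gamma> t) = curve \<tau> (op.u t)" using * polar R by simp
    qed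
  qed
  then obtain R where R: "orthogonal_transformation R" "R (1, tan \<theta>) = (1, tan \<theta>)"
    "\<forall>t\<in>{t0..T}. R (\<gamma> t) = curve \<tau> (op.u t)" by blast
  show ?thesis
  proof (rule exI[of _ "\<tau> 0"], rule exI[of _ \<psi>], rule exI[of _ \<tau>], rule exI[of _ \<xi>], intro conjI)
    show "\<theta> = (1 - \<xi>) * pi" by (simp add: \<xi>_def)
    show "\<exists>R \<sigma>. orthogonal_transformation R \<and> R (1, tan \<theta>) = (1, tan \<theta>) \<and>
         bij_betw \<sigma> {0..\<xi>} (inspection_interval \<gamma> L \<theta>) \<and>
         strict_antimono_on {0..\<xi>} \<sigma> \<and>
         (\<forall>x\<in>{0..\<xi>}. R (\<gamma> (\<sigma> x)) = curve \<tau> x)"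
    proof (intro exI[of _ R] exI[of _ \<sigma>] conjI ballI)
      show "bij_betw \<sigma> {0..\<xi>} (inspection_interval \<gamma> L \<theta>)" unfolding interval by (rule bij)
      fix x assume "x \<in> {0..\<xi>}"
      then show "R (\<gamma> (\<sigma> x)) = curve \<tau> x" using R(3) u\<sigma>[of x] by simp
    qed (rule R(1) R(2) anti)+
    show "\<forall>\<tau>0'\<in>inspection_feasible. \<forall>\<psi>' \<tau>'. Sys \<tau>0' \<psi>' \<tau>' \<longrightarrow>
         optimal_cost \<le> total_cost (deployment_param \<tau>') \<psi>' \<tau>'"
      using optimal_cost_le_feasible by blast
  qed (use feas sys param \<xi> at\<xi> opt in auto)
qed

end
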